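(* Let $L$, $\mu$, $\Psi$, $\Phi$ and the family of normalized wave profiles $(V_\delta,R_\delta,\lambda_\delta)_{\delta>0}$ be as described in the context. For $\delta>0$ and $x\in\mathbb{R}$ put $$\overline{V}_\delta(x):=\frac{(1+\delta)\sinh\left(\frac{1}{2\delta}\right)}{\cosh\left(\frac{1}{2\delta}\right)+\cosh\left(\frac{x}{\delta}\right)},\qquad \overline{R}_\delta(x):=(\delta+\delta^2)\ln\left(1+\frac{\sinh^2\left(\frac{1}{2\delta}\right)}{\cosh^2\left(\frac{x}{2\delta}\right)}\right).$$ Then $$\lambda_\delta^2\,\delta^\mu\exp\left(-\frac1\delta\right)\;\longrightarrow\;\exp(1)\qquad\text{as }\delta\to0.$$ Moreover, there exists a constant $C$ independent of $\delta$ such that for all sufficiently small $\delta>0$ and any $1\le p\le\infty$ (with $1/p:=0$ for $p=\infty$) $$\|V_\delta-\overline{V}_\delta\|_p\le C\delta\,\|V_\delta-V_0\|_p\le C\delta^{1+1/p},\qquad \|R_\delta-\overline{R}_\delta\|_p\le C\delta\,\|R_\delta-R_0\|_p\le C\delta^2,$$ where the norms $\|\cdot\|_p$ are the Lebesgue norms on the interval $[-L,L]$ and the letter $C$ may stand for different constants in different inequalities.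
   Context: Standing assumptions. Fix a real number $2<L<\infty$, a parameter $\mu\in\mathbb{R}$, and write $\mathbb{R}_+=[0,\infty)$. The force function is $\Phi'(r)=\Psi(r)\exp(r)$ for $r\ge0$, where $\Psi:\mathbb{R}_+\to\mathbb{R}_+$ is continuously differentiable, $\Psi(0)=0$, and there is a constant $C_\Psi>0$ such that for all $r>0$: $\Psi(r)>0$, $\Psi'(r)+\Psi(r)\ge0$ and $\left|\Psi(r)/r^\mu-1\right|\le C_\Psi/r$. The potential $\Phi:\mathbb{R}_+\to\mathbb{R}$ is an antiderivative of $\Phi'$ (in particular, it is convex and minimal at $0$). Notation. All profiles are $2L$-periodic functions on $\mathbb{R}$; $\|\cdot\|_p$ is the Lebesgue norm on $[-L,L]$. For a $2L$-periodic $V$ put $(\mathcal{A}V)(x):=\int_{x-1/2}^{x+1/2}V(\tilde x)\,d\tilde x$ and $\mathcal{P}_\delta(V):=\int_{-L}^{L}\Phi\left((\mathcal{A}V)(x)/\delta\right)dx$. The cone $\mathcal{C}$ consists of all $2L$-periodic, square-integrable (on $[-L,L]$) functions $V$ with $V(-x)=V(x)\ge V(\tilde x)\ge0$ for almost all $0\le x\le\tilde x\le L$. Let $V_0$ be the $2L$-periodic function that coincides on $[-L,L]$ with the indicator function of $[-\frac12,\frac12]$, and $R_0:=\mathcal{A}V_0$ (on $[-L,L]$ this is the tent map $\max\{0,1-|x|\}$). Wave profiles. For each $\delta>0$, $V_\delta$ denotes a maximizer of the problem: maximize $\mathcal{P}_\delta(V)$ subject to $\|V\|_2=1$ and $V\in\mathcal{C}$.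 Moreover $R_\delta:=\mathcal{A}V_\delta$, and $\lambda_\delta>0$ is the number for which the traveling wave equation $$\lambda_\delta^2V_\delta=\frac1\delta\,\mathcal{A}\,\Phi'\left(\frac{\mathcal{A}V_\delta}{\delta}\right)$$ holds ($V_\delta$ being identified with its continuous representative). The profiles $V_\delta$ and $R_\delta$ are $2L$-periodic, belong to $\mathcal{C}$, are pointwise positive, and satisfy $\|V_\delta-V_0\|_2+\|R_\delta-R_0\|_\infty\to0$ as $\delta\to0$. *)

theory Defs
  imports "HOL-Probability.Essential_Supremum"
begin

text \<open>Lebesgue norm on \<open>[-L, L]\<close> for \<open>1 \<le> p \<le> \<infinity>\<close>, with value \<open>\<infinity>\<close> for measurable functions
  that do not belong to \<open>L\<^sup>p\<close>.\<close>

definition Lp_norm :: "real \<Rightarrow> ennreal \<Rightarrow> (real \<Rightarrow> real) \<Rightarrow> ennreal" where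
  "Lp_norm L p f =
    (if p = \<infinity> then esssup (lebesgue_on {-L..L}) (\<lambda>x. ennreal \<bar>f x\<bar>)
     else (let I = \<integral>\<^sup>+ x. ennreal (\<bar>f x\<bar> powr enn2real p) \<partial>lebesgue_on {-L..L}
           in if I = \<infinity> then \<infinity> else ennreal (enn2real I powr (1 / enn2real p))))"

definition periodic :: "real \<Rightarrow> (real \<Rightarrow> real) \<Rightarrow> bool" where
  "periodic T f \<longleftrightarrow> (\<forall>x. f (x + T) = f x)"

definition avg :: "(real \<Rightarrow> real) \<Rightarrow> real \<Rightarrow> real" where
  "avg V x = (\<integral>t. V t \<partial>lebesgue_on {x - 1/2..x + 1/2})"

definition pot_energy :: "real \<Rightarrow> (real \<Rightarrow> real) \<Rightarrow> real \<Rightarrow> (real \<Rightarrow> real) \<Rightarrow> real" where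
  "pot_energy L \<Phi> \<delta> V = (\<integral>x. \<Phi> (avg V x / \<delta>) \<partial>lebesgue_on {-L..L})"

text \<open>The nested almost-everywhere quantifiers express that the relations hold for almost all pairs
  \<open>0 \<le> x \<le> y \<le> L\<close>. Periodicity is imposed everywhere.\<close>

definition profile_cone :: "real \<Rightarrow> (real \<Rightarrow> real) set" where
  "profile_cone L = {V. periodic (2 * L) V
     \<and> V \<in> borel_measurable (lebesgue_on {-L..L})
     \<and> integrable (lebesgue_on {-L..L}) (\<lambda>x. (V x)\<^sup>2)
     \<and> (AE x in lebesgue_on {0..L}. AE y in lebesgue_on {x..L}.
           V (- x) = V x \<and> V x \<ge> V y \<and> V y \<ge> 0)}"

definition is_maximizer :: "real \<Rightarrow> (real \<Rightarrow> real) \<Rightarrow> real \<Rightarrow> (real \<Rightarrow> real) \<Rightarrow> bool" where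
  "is_maximizer L \<Phi> \<delta> V \<longleftrightarrow> V \<in> profile_cone L \<and> Lp_norm L 2 V = 1
     \<and> (\<forall>W \<in> profile_cone L. Lp_norm L 2 W = 1 \<longrightarrow> pot_energy L \<Phi> \<delta> W \<le> pot_energy L \<Phi> \<delta> V)"

definition V0 :: "real \<Rightarrow> real \<Rightarrow> real" where
  "V0 L = indicator (\<Union>k::int. {2 * L * k - 1/2..2 * L * k + 1/2})"

lemma periodic_V0: "periodic (2 * L) (V0 L)"
proof -
  have "(x + 2 * L \<in> (\<Union>k::int. {2 * L * k - 1/2..2 * L * k + 1/2}))
      \<longleftrightarrow> (x \<in> (\<Union>k::int. {2 * L * k - 1/2..2 * L * k + 1/2}))" (is "?l \<longleftrightarrow> ?r") for x
  proof
    assume ?l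
    then obtain k :: int where "x + 2 * L \<in> {2 * L * k - 1/2..2 * L * k + 1/2}" by blast
    then have "x \<in> {2 * L * (k - 1 :: int) - 1/2..2 * L * (k - 1 :: int) + 1/2}"
      by (simp add: algebra_simps)
    then show ?r by blast
  next
    assume ?r
    then obtain k :: int where "x \<in> {2 * L * k - 1/2..2 * L * k + 1/2}" by blast
    then have "x + 2 * L \<in> {2 * L * (k + 1 :: int) - 1/2..2 * L * (k + 1 :: int) + 1/2}"
      by (simp add: algebra_simps)
    then show ?l by blast
  qed
  then show ?thesis by (simp add: periodic_def V0_def indicator_def)
qed

lemma V0_on_period:
  assumes "2 < L" "x \<in> {-L..L}"
  shows "V0 L x = indicator {-1/2..1/2} x"
proof -
  have "k = 0" if "x \<in> {2 * L * k - 1/2..2 * L * k + 1/2}" for k :: int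
  proof (rule ccontr)
    assume "k \<noteq> 0"
    then consider "real_of_int k \<ge> 1" | "real_of_int k \<le> -1" by linarith
    then show False
    proof cases
      case 1
      with assms have "2 * L * k \<ge> 2 * L * 1" by (intro mult_left_mono) auto
      with that assms show False by auto
    next
      case 2
      with assms have "2 * L * k \<le> 2 * L * (-1)" by (intro mult_left_mono) auto
      with that assms show False by auto
    qed
  qed
  then have "x \<in> (\<Union>k::int. {2 * L * k - 1/2..2 * L * k + 1/2}) \<longleftrightarrow> x \<in> {-1/2..1/2}"
    by (force intro: exI[of _ 0])
  then show ?thesis by (simp add: V0_def indicator_def)
qed

definition R0 :: "real \<Rightarrow> real \<Rightarrow> real" where
  "R0 L = avg (V0 L)"

definition V_bar :: "real \<Rightarrow> real \<Rightarrow> real" where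
  "V_bar \<delta> x = (1 + \<delta>) * sinh (1 / (2 * \<delta>)) / (cosh (1 / (2 * \<delta>)) + cosh (x / \<delta>))"

definition R_bar :: "real \<Rightarrow> real \<Rightarrow> real" where
  "R_bar \<delta> x = (\<delta> + \<delta>\<^sup>2) * ln (1 + (sinh (1 / (2 * \<delta>)))\<^sup>2 / (cosh (x / (2 * \<delta>)))\<^sup>2)"

end

theory Submission
  imports Defs "HOL-Real_Asymp.Real_Asymp"
begin

text \<open>
  Why the estimates hold. Write \<open>m = V 0\<close>, \<open>q = - R'\<close> and let \<open>F\<close> be the force \<open>\<Phi>' (R / \<delta>)\<close>, scaled so
  that the wave equation reads \<open>V = avg F\<close>. Since \<open>R\<close> is close to the tent \<open>max 0 (1 - \<bar>x\<bar>)\<close> and the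
  force grows exponentially, \<open>F\<close> is concentrated near \<open>0\<close>: at distance \<open>1/2\<close> it is smaller than every power
  of \<open>\<delta>\<close>. On \<open>[0, 1/2]\<close> the advance-delay equation \<open>R'' = F (x + 1) + F (x - 1) - 2 F x\<close> is
  therefore an ordinary differential equation \<open>q' = 2 F\<close> with a negligible error, and it has the energy
  \<open>q\<^sup>2 / 2 + G\<close>, where \<open>G\<close> is the scaled potential \<open>\<Phi> (R / \<delta>)\<close> (lemma \<open>energy\<close>). The potential and its
  derivative agree to relative order \<open>1/r\<close> (\<open>potential_asymptotics\<close>), so that \<open>G = 2 \<delta> F (1 + O(\<delta>))\<close>.
  Eliminating \<open>F\<close> and \<open>G\<close> leaves the Riccati equation \<open>q' = (m\<^sup>2 - q\<^sup>2) / (2 \<delta>)\<close> up to an error whose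
  integral is \<open>O(\<delta>)\<close> (\<open>riccati\<close>). The detour through the
  energy is taken because \<open>F'\<close> would involve \<open>\<Psi>'\<close>, whose asymptotics are unknown.

  Integrating the Riccati equation gives \<open>\<integral> (m\<^sup>2 - q\<^sup>2) = 2 \<delta> m + O(\<delta>\<^sup>2)\<close>. The norm constraint says
  \<open>1 = m\<^sup>2 - \<integral> (m\<^sup>2 - q\<^sup>2) + O(\<delta>\<^sup>2)\<close>, because \<open>V\<close> is \<open>(m \<mp> q) / 2\<close> on the two sides of \<open>1/2\<close>. Hence
  \<open>m = 1 + \<delta> + O(\<delta>\<^sup>2)\<close> (\<open>amplitude\<close>). The function \<open>(1 + \<delta>) tanh (s / (2 \<delta>))\<close> solves the Riccati
  equation with \<open>m\<close> replaced by \<open>1 + \<delta>\<close>, and its difference to \<open>q\<close> solves a linear equation with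
  damping rate of order \<open>1/\<delta>\<close>. So the difference is \<open>O(\<delta>)\<close> in the sup norm and \<open>O(\<delta>\<^sup>2)\<close> in \<open>L\<^sup>1\<close>
  (\<open>damped_linear_ode_bound\<close>, \<open>front_comparison\<close>). As \<open>V_bar\<close> consists of two such tanh fronts, the same
  bounds hold for \<open>V - V_bar\<close>, and the exact identity \<open>avg V_bar = R_bar\<close> turns the \<open>L\<^sup>1\<close> bound into the
  sup bound \<open>O(\<delta>\<^sup>2)\<close> for \<open>R - R_bar\<close>.

  Norms with \<open>1 \<le> p \<le> \<infinity>\<close> are interpolated between \<open>L\<^sup>1\<close> and \<open>L\<^sup>\<infinity>\<close>. The intermediate terms of the
  two chains need lower bounds: \<open>V\<close> differs from the jump by at least \<open>1/8\<close> on a set of size \<open>\<delta>/2\<close>,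
  and \<open>R\<close> from the tent by at least \<open>\<delta>/4\<close> on \<open>[1/4, 1/2]\<close>. Finally the energy at \<open>0\<close>, where \<open>q = 0\<close>, is
  \<open>G 0 = m\<^sup>2 / 2\<close> up to a negligible error. This determines \<open>lam\<^sup>2\<close> from \<open>\<Phi> (R 0 / \<delta>)\<close>, and
  \<open>R 0 = R_bar 0 + O(\<delta>\<^sup>2) = 1 + \<delta> (1 - 2 ln 2) + O(\<delta>\<^sup>2)\<close> gives the limit \<open>4 exp (1 - 2 ln 2) = exp 1\<close>.
\<close>

section \<open>Continuous functions and almost-everywhere statements\<close>

text \<open>The complement of a null set is dense in an interval of positive length, so a closed property that
  holds almost everywhere holds everywhere.\<close>

lemma AE_lebesgue_on_closed:
  fixes P :: "real \<Rightarrow> bool"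
  assumes "a < b" and AE: "AE x in lebesgue_on {a..b}. P x"
    and closed: "closed {x \<in> {a..b}. P x}"
    and x: "x \<in> {a..b}"
  shows "P x"
proof (rule ccontr)
  assume "\<not> P x"
  define U where "U = - {x \<in> {a..b}. P x}"
  have "open U" "x \<in> U"
    using closed \<open>\<not> P x\<close> by (auto simp: U_def)
  moreover have "x \<in> closure {a<..<b}"
    using x \<open>a < b\<close> by (simp add: closure_greaterThanLessThan)
  ultimately have "{a<..<b} \<inter> U \<noteq> {}"
    using open_Int_closure_eq_empty[of U "{a<..<b}"] by blast
  moreover have "open ({a<..<b} \<inter> U)"
    using \<open>open U\<close> by auto
  ultimately obtain y e where ye: "e > 0" "ball y e \<subseteq> {a<..<b} \<inter> U"
    by (meson all_not_in_conv openE)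
  have "AE x in lebesgue. x \<in> {a..b} \<longrightarrow> P x"
    using AE by (subst (asm) AE_restrict_space_iff) auto
  then have "AE x in lebesgue. x \<notin> ball y e"
    by eventually_elim (use ye in \<open>force simp: U_def\<close>)
  then have "ball y e \<in> null_sets lebesgue"
    by (subst AE_iff_null_sets) (auto simp: null_sets_def)
  then have "negligible (ball y e)"
    by (simp add: negligible_iff_null_sets)
  then show False
    using \<open>e > 0\<close> open_not_negligible[of "ball y e"] by simp
qed

lemma avg_eq_integral:
  assumes "continuous_on UNIV f"
  shows "avg f x = integral {x - 1/2..x + 1/2} f"
  unfolding avg_def
  by (intro lebesgue_integral_eq_integral continuous_imp_integrable_real continuous_on_subset[OF assms]) auto

lemma has_real_derivative_integral_upper:
  fixes f :: "real \<Rightarrow> real"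
  assumes "continuous_on UNIV f" and "a < x"
  shows "((\<lambda>x. integral {a..x} f) has_real_derivative f x) (at x)"
proof -
  have "((\<lambda>x. integral {a..x} f) has_real_derivative f x) (at x within {a..x + 1})"
    using assms by (intro integral_has_real_derivative continuous_on_subset[OF assms(1)]) auto
  then show ?thesis
    using assms(2) at_within_Icc_at[of a x "x + 1"] by simp
qed

lemma avg_has_real_derivative:
  assumes "continuous_on UNIV f"
  shows "(avg f has_real_derivative f (x + 1/2) - f (x - 1/2)) (at x)"
proof -
  let ?I = "\<lambda>y. integral {x - 2..y} f"
  have "((\<lambda>y. ?I (y + 1/2) - ?I (y - 1/2)) has_real_derivative f (x + 1/2) - f (x - 1/2)) (at x)"
  proof (rule DERIV_diff)
    have "(?I has_real_derivative f (x + 1/2)) (at (x + 1/2))" "(?I has_real_derivative f (x - 1/2)) (at (x - 1/2))"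
      by (rule has_real_derivative_integral_upper[OF assms]; simp)+
    then show "((\<lambda>y. ?I (y + 1/2)) has_real_derivative f (x + 1/2)) (at x)"
      "((\<lambda>y. ?I (y - 1/2)) has_real_derivative f (x - 1/2)) (at x)"
      using DERIV_shift[of ?I _ x "1/2"] DERIV_shift[of ?I _ x "- 1/2"] by simp_all
  qed
  then show ?thesis
  proof (rule has_field_derivative_transform_within)
    show "0 < (1::real)" by simp
    fix y :: real
    assume "dist y x < 1"
    then have *: "x - 2 \<le> y - 1/2" "y - 1/2 \<le> y + 1/2"
      by (auto simp: dist_real_def)
    have "f integrable_on {x - 2..y + 1/2}"
      by (intro integrable_continuous_real continuous_on_subset[OF assms]) auto
    from Henstock_Kurzweil_Integration.integral_combine[OF * this]
    show "?I (y + 1/2) - ?I (y - 1/2) = avg f y"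
      by (simp add: avg_eq_integral[OF assms])
  qed simp
qed

lemma continuous_on_avg:
  assumes "continuous_on UNIV f"
  shows "continuous_on UNIV (avg f)"
  using avg_has_real_derivative[OF assms]
  by (auto intro!: continuous_at_imp_continuous_on DERIV_isCont)

lemma continuous_profile_cone:
  assumes "f \<in> profile_cone L" and f: "continuous_on UNIV f" and "L > 0"
  shows "\<bar>x\<bar> \<le> L \<Longrightarrow> f (- x) = f x"
    and "0 \<le> x \<Longrightarrow> x \<le> y \<Longrightarrow> y \<le> L \<Longrightarrow> f y \<le> f x"
proof -
  have AE: "AE x in lebesgue_on {0..L}. AE y in lebesgue_on {x..L}.
      f (- x) = f x \<and> f x \<ge> f y \<and> f y \<ge> 0"
    using assms(1) by (simp add: profile_cone_def)
  have cont: "continuous_on S (\<lambda>x. f (g x))" if "continuous_on S g" for g and S :: "real set"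
    using continuous_on_compose2[OF f that] by simp
  have closed: "closed {y \<in> {a..b}. f (- x) = f x \<and> f x \<ge> f y \<and> f y \<ge> 0}" for a b x
  proof -
    have "{y \<in> {a..b}. f (- x) = f x \<and> f x \<ge> f y \<and> f y \<ge> 0} =
       (if f (- x) = f x then {a..b} \<inter> {y. f y \<le> f x} \<inter> {y. 0 \<le> f y} else {})"
      by auto
    then show ?thesis
      by (auto intro!: closed_Int closed_Collect_le continuous_on_const f)
  qed
  have AE1: "AE x in lebesgue_on {0..L}. x < L \<longrightarrow> (\<forall>y\<in>{x..L}. f (- x) = f x \<and> f x \<ge> f y \<and> f y \<ge> 0)"
    using AE by eventually_elim (use AE_lebesgue_on_closed[OF _ _ closed] in blast)
  have main: "f (- x) = f x \<and> f x \<ge> f y" if x: "0 \<le> x" "x \<le> y" "y \<le> L" and "0 < y" for x y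
  proof (rule AE_lebesgue_on_closed[where P = "\<lambda>x. f (- x) = f x \<and> f x \<ge> f y" and a = 0 and b = y])
    have "AE x in lebesgue. x \<in> {0..L} \<longrightarrow> x < L \<longrightarrow> (\<forall>y\<in>{x..L}. f (- x) = f x \<and> f x \<ge> f y \<and> f y \<ge> 0)"
      using AE1 by (subst (asm) AE_restrict_space_iff) auto
    moreover have "AE x in lebesgue. x \<noteq> L"
      by (rule AE_I[where N = "{L}"]) auto
    ultimately have "AE x in lebesgue. x \<in> {0..y} \<longrightarrow> f (- x) = f x \<and> f x \<ge> f y"
    proof eventually_elim
      case (elim x)
      show ?case
      proof
        assume "x \<in> {0..y}"
        then have "x \<in> {0..L}" "x < L" "y \<in> {x..L}"
          using that elim by auto
        then show "f (- x) = f x \<and> f x \<ge> f y"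
          using elim by blast
      qed
    qed
    then show "AE x in lebesgue_on {0..y}. f (- x) = f x \<and> f x \<ge> f y"
      by (subst AE_restrict_space_iff) auto
    have "{x \<in> {0..y}. f (- x) = f x \<and> f x \<ge> f y} = {0..y} \<inter> {x. f (- x) = f x} \<inter> {x. f y \<le> f x}"
      by auto
    then show "closed {x \<in> {0..y}. f (- x) = f x \<and> f x \<ge> f y}"
      by (auto intro!: closed_Int closed_Collect_le closed_Collect_eq continuous_intros f cont)
  qed (use that in auto)
  show "f y \<le> f x" if "0 \<le> x" "x \<le> y" "y \<le> L"
    using main[OF that] that by (cases "y = 0") auto
  have even: "f (- x) = f x" if "0 \<le> x" "x \<le> L" for x
    using main[of x L] that \<open>L > 0\<close> by auto
  show "f (- x) = f x" if "\<bar>x\<bar> \<le> L"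
    using even[of x] even[of "- x"] that by (cases "x \<ge> 0") auto
qed

section \<open>Lebesgue norms\<close>

lemma Lp_norm_finite_p:
  assumes "1 \<le> p" "p \<noteq> \<infinity>"
  shows "enn2real p \<ge> 1" "enn2real (1 / p) = 1 / enn2real p"
proof -
  show "enn2real p \<ge> 1"
    using enn2real_mono[OF \<open>1 \<le> p\<close>] assms(2) by (simp add: less_top)
  then show "enn2real (1 / p) = 1 / enn2real p"
    using assms(2) by (cases p) (auto simp: divide_ennreal[symmetric] simp flip: ennreal_1)
qed

lemma reciprocal_exponent_le_1:
  assumes "1 \<le> p"
  shows "enn2real (1 / p) \<le> 1"
  using Lp_norm_finite_p[OF assms] by (cases "p = \<infinity>") auto

text \<open>The interpolation \<open>\<bar>f\<bar>\<^sup>p \<le> B\<^bsup>p - 1\<^esup> \<bar>f\<bar>\<close> turns a sup bound and an \<open>L\<^sup>1\<close> bound into an \<open>L\<^sup>p\<close> bound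
  whose constant does not depend on \<open>p\<close>.\<close>

lemma Lp_norm_le:
  assumes [measurable]: "f \<in> borel_measurable (lebesgue_on {-L..L})"
    and B: "\<And>x. x \<in> {-L..L} \<Longrightarrow> \<bar>f x\<bar> \<le> B" and "B > 0" "t > 0"
    and L1: "(\<integral>\<^sup>+x. ennreal \<bar>f x\<bar> \<partial>lebesgue_on {-L..L}) \<le> ennreal (B * t)"
    and p: "1 \<le> p"
  shows "Lp_norm L p f \<le> ennreal (B * t powr enn2real (1 / p))"
proof (cases "p = \<infinity>")
  case True
  have "esssup (lebesgue_on {-L..L}) (\<lambda>x. ennreal \<bar>f x\<bar>) \<le> ennreal B"
    by (rule esssup_I) (use B in \<open>auto intro!: AE_I2 ennreal_leI\<close>)
  then show ?thesis
    using True \<open>t > 0\<close> by (simp add: Lp_norm_def)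
next
  case False
  define r where "r = enn2real p"
  have r: "r \<ge> 1" "enn2real (1 / p) = 1 / r"
    using Lp_norm_finite_p[OF p False] by (auto simp: r_def)
  define I where "I = (\<integral>\<^sup>+ x. ennreal (\<bar>f x\<bar> powr r) \<partial>lebesgue_on {-L..L})"
  have "I \<le> (\<integral>\<^sup>+ x. ennreal (B powr (r - 1)) * ennreal \<bar>f x\<bar> \<partial>lebesgue_on {-L..L})"
    unfolding I_def
  proof (rule nn_integral_mono)
    fix x assume "x \<in> space (lebesgue_on {-L..L})"
    then have le: "\<bar>f x\<bar> \<le> B"
      using B by simp
    have "\<bar>f x\<bar> powr r = \<bar>f x\<bar> powr (r - 1) * \<bar>f x\<bar>"
      by (cases "f x = 0") (auto simp: powr_diff)
    also have "\<dots> \<le> B powr (r - 1) * \<bar>f x\<bar>"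
      using le r by (intro mult_right_mono powr_mono2) auto
    finally show "ennreal (\<bar>f x\<bar> powr r) \<le> ennreal (B powr (r - 1)) * ennreal \<bar>f x\<bar>"
      by (simp add: ennreal_mult'[symmetric])
  qed
  also have "\<dots> = ennreal (B powr (r - 1)) * (\<integral>\<^sup>+x. ennreal \<bar>f x\<bar> \<partial>lebesgue_on {-L..L})"
    by (rule nn_integral_cmult) simp
  also have "\<dots> \<le> ennreal (B powr (r - 1)) * ennreal (B * t)"
    by (rule mult_left_mono[OF L1]) simp
  also have "\<dots> = ennreal (B powr r * t)"
    using \<open>B > 0\<close> \<open>t > 0\<close> by (simp add: ennreal_mult'[symmetric] powr_diff)
  finally have I: "I \<le> ennreal (B powr r * t)" .
  then have "I \<noteq> \<infinity>"
    by (auto simp: top_unique)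
  have "enn2real I \<le> B powr r * t"
    using I \<open>B > 0\<close> \<open>t > 0\<close> by (intro enn2real_leI) auto
  then have "enn2real I powr (1 / r) \<le> (B powr r * t) powr (1 / r)"
    using r by (intro powr_mono2) auto
  also have "\<dots> = B * t powr (1 / r)"
    using r \<open>B > 0\<close> \<open>t > 0\<close> by (simp add: powr_mult powr_powr)
  finally show ?thesis
    using False \<open>I \<noteq> \<infinity>\<close> r by (simp add: Lp_norm_def r_def[symmetric] I_def[symmetric] ennreal_leI)
qed

lemma Lp_norm_ge:
  assumes c: "\<And>x. x \<in> {a..b} \<Longrightarrow> c \<le> \<bar>f x\<bar>" and "c > 0" and ab: "a < b" "{a..b} \<subseteq> {-L..L}"
    and p: "1 \<le> p"
  shows "ennreal (c * (b - a) powr enn2real (1 / p)) \<le> Lp_norm L p f"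
proof (cases "p = \<infinity>")
  case True
  have "AE x in lebesgue_on {-L..L}. ennreal \<bar>f x\<bar> \<le> esssup (lebesgue_on {-L..L}) (\<lambda>x. ennreal \<bar>f x\<bar>)"
    by (rule esssup_AE)
  then have "AE x in lebesgue. x \<in> {-L..L} \<longrightarrow> ennreal \<bar>f x\<bar> \<le> esssup (lebesgue_on {-L..L}) (\<lambda>x. ennreal \<bar>f x\<bar>)"
    by (subst (asm) AE_restrict_space_iff) auto
  then have "AE x in lebesgue. x \<in> {a..b} \<longrightarrow> ennreal c \<le> esssup (lebesgue_on {-L..L}) (\<lambda>x. ennreal \<bar>f x\<bar>)"
    by eventually_elim (use c ab(2) in \<open>blast intro: order_trans[OF ennreal_leI]\<close>)
  then have "AE x in lebesgue_on {a..b}. ennreal c \<le> esssup (lebesgue_on {-L..L}) (\<lambda>x. ennreal \<bar>f x\<bar>)"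
    by (subst AE_restrict_space_iff) auto
  then have "ennreal c \<le> esssup (lebesgue_on {-L..L}) (\<lambda>x. ennreal \<bar>f x\<bar>)"
  proof (rule AE_lebesgue_on_closed[OF \<open>a < b\<close>])
    show "closed {x \<in> {a..b}. ennreal c \<le> esssup (lebesgue_on {-L..L}) (\<lambda>x. ennreal \<bar>f x\<bar>)}"
      by (simp only: Collect_conj_eq Collect_mem_eq) (intro closed_Int closed_Collect_const closed_atLeastAtMost)
    show "a \<in> {a..b}"
      using \<open>a < b\<close> by simp
  qed
  then show ?thesis
    using True \<open>a < b\<close> by (simp add: Lp_norm_def)
next
  case False
  define r where "r = enn2real p"
  have r: "r \<ge> 1" "enn2real (1 / p) = 1 / r"
    using Lp_norm_finite_p[OF p False] by (auto simp: r_def)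
  define I where "I = (\<integral>\<^sup>+ x. ennreal (\<bar>f x\<bar> powr r) \<partial>lebesgue_on {-L..L})"
  have "ennreal (c powr r * (b - a)) = ennreal (c powr r) * emeasure (lebesgue_on {-L..L}) {a..b}"
    using ab by (simp add: emeasure_restrict_space ennreal_mult)
  also have "\<dots> = (\<integral>\<^sup>+ x. ennreal (c powr r) * indicator {a..b} x \<partial>lebesgue_on {-L..L})"
    using ab by (subst nn_integral_cmult_indicator) (auto simp: sets_restrict_space_iff)
  also have "\<dots> \<le> I"
    unfolding I_def using c r \<open>c > 0\<close>
    by (intro nn_integral_mono) (auto simp: indicator_def intro!: ennreal_leI powr_mono2)
  finally have I: "ennreal (c powr r * (b - a)) \<le> I" .
  show ?thesis
  proof (cases "I = \<infinity>")
    case True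
    then show ?thesis
      using False by (simp add: Lp_norm_def r_def[symmetric] I_def[symmetric])
  next
    case I_fin: False
    have "c powr r * (b - a) \<le> enn2real I"
      using enn2real_mono[OF I] I_fin \<open>c > 0\<close> ab by (simp add: less_top)
    then have "(c powr r * (b - a)) powr (1 / r) \<le> enn2real I powr (1 / r)"
      using r \<open>c > 0\<close> ab by (intro powr_mono2) auto
    moreover have "(c powr r * (b - a)) powr (1 / r) = c * (b - a) powr (1 / r)"
      using r \<open>c > 0\<close> ab by (simp add: powr_mult powr_powr)
    ultimately show ?thesis
      using False I_fin r by (simp add: Lp_norm_def r_def[symmetric] I_def[symmetric] ennreal_leI)
  qed
qed

section \<open>Differential inequalities\<close>

lemma derivative_nonpos_imp_le:
  fixes f :: "real \<Rightarrow> real"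
  assumes "a \<le> b"
    and "\<And>x. x \<in> {a..b} \<Longrightarrow> (f has_real_derivative f' x) (at x within {a..b})"
    and "\<And>x. x \<in> {a..b} \<Longrightarrow> f' x \<le> 0"
  shows "f b \<le> f a"
proof (rule DERIV_nonpos_imp_decreasing_open[OF assms(1)])
  show "continuous_on {a..b} f"
    using assms(2) by (rule DERIV_continuous_on)
  fix x assume "a < x" "x < b"
  then show "\<exists>y. (f has_real_derivative y) (at x) \<and> y \<le> 0"
    using assms(2,3)[of x] at_within_Icc_at[of a x b] by auto
qed

lemma derivative_domination:
  fixes f g :: "real \<Rightarrow> real"
  assumes "a \<le> b"
    and f: "\<And>x. x \<in> {a..b} \<Longrightarrow> (f has_real_derivative f' x) (at x within {a..b})"
    and g: "\<And>x. x \<in> {a..b} \<Longrightarrow> (g has_real_derivative g' x) (at x within {a..b})"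
    and le: "\<And>x. x \<in> {a..b} \<Longrightarrow> \<bar>f' x\<bar> \<le> g' x"
  shows "\<bar>f b - f a\<bar> \<le> g b - g a"
proof -
  have "f b - g b \<le> f a - g a"
    using assms(1) DERIV_diff[OF f g]
    by (rule derivative_nonpos_imp_le) (use le in \<open>force simp: abs_le_iff\<close>)+
  moreover have "- f b - g b \<le> - f a - g a"
    using assms(1) DERIV_diff[OF DERIV_minus[OF f] g]
    by (rule derivative_nonpos_imp_le) (use le in \<open>force simp: abs_le_iff\<close>)+
  ultimately show ?thesis
    by linarith
qed

text \<open>A damped linear equation absorbs its source: not only the solution but also the total damping
  is bounded by the total source. Since \<open>\<bar>w\<bar>\<close> need not be differentiable, the estimate is made for
  \<open>sqrt (w\<^sup>2 + e\<^sup>2)\<close>, and then \<open>e\<close> tends to \<open>0\<close>.\<close>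

lemma damped_linear_ode_bound:
  fixes w a g \<Gamma> \<gamma> :: "real \<Rightarrow> real"
  assumes "0 \<le> b"
    and w: "\<And>x. x \<in> {0..b} \<Longrightarrow> (w has_real_derivative g x - a x * w x) (at x within {0..b})"
    and \<Gamma>: "\<And>x. x \<in> {0..b} \<Longrightarrow> (\<Gamma> has_real_derivative \<gamma> x) (at x within {0..b})"
    and g: "\<And>x. x \<in> {0..b} \<Longrightarrow> \<bar>g x\<bar> \<le> \<gamma> x"
    and a: "\<And>x. x \<in> {0..b} \<Longrightarrow> 0 \<le> a x" "continuous_on {0..b} a"
    and "w 0 = 0"
  shows "\<bar>w b\<bar> + integral {0..b} (\<lambda>t. a t * \<bar>w t\<bar>) \<le> \<Gamma> b - \<Gamma> 0"
proof -
  have cw: "continuous_on {0..b} w"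
    using w by (rule DERIV_continuous_on)
  define I where "I = integral {0..b} (\<lambda>t. a t * \<bar>w t\<bar>)"
  define J where "J = integral {0..b} a"
  have eps: "\<bar>w b\<bar> + I \<le> \<Gamma> b - \<Gamma> 0 + e * (1 + J)" if "e > 0" for e
  proof -
    let ?s = "\<lambda>x. sqrt ((w x)\<^sup>2 + e\<^sup>2)"
    let ?P = "\<lambda>x. ?s x - \<Gamma> x + integral {0..x} (\<lambda>t. a t * (\<bar>w t\<bar> - e))"
    have pos: "(w x)\<^sup>2 + e\<^sup>2 > 0" for x
      using that by (simp add: sum_power2_gt_zero_iff)
    have "?P b \<le> ?P 0"
    proof (rule derivative_nonpos_imp_le[OF \<open>0 \<le> b\<close>])
      fix x assume x: "x \<in> {0..b}"
      have I: "((\<lambda>x. integral {0..x} (\<lambda>t. a t * (\<bar>w t\<bar> - e))) has_real_derivative a x * (\<bar>w x\<bar> - e)) (at x within {0..b})"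
        by (rule integral_has_real_derivative) (use x in \<open>auto intro!: continuous_intros cw a\<close>)
      have "((\<lambda>x. (w x)\<^sup>2 + e\<^sup>2) has_real_derivative 2 * (w x * (g x - a x * w x))) (at x within {0..b})"
        using DERIV_add[OF DERIV_power[OF w[OF x], of 2] DERIV_const[of "e\<^sup>2"]] by (simp add: ac_simps)
      then have "(?s has_real_derivative inverse (?s x) / 2 * (2 * (w x * (g x - a x * w x)))) (at x within {0..b})"
        by (rule DERIV_chain2[where f = sqrt and g = "\<lambda>x. (w x)\<^sup>2 + e\<^sup>2", OF DERIV_real_sqrt[OF pos]])
      moreover have "inverse s / 2 * (2 * z) = z / s" for s z :: real
        by (simp add: inverse_eq_divide)
      ultimately have "(?s has_real_derivative w x * (g x - a x * w x) / ?s x) (at x within {0..b})"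
        by (simp only:)
      then show "(?P has_real_derivative
          w x * (g x - a x * w x) / ?s x - \<gamma> x + a x * (\<bar>w x\<bar> - e)) (at x within {0..b})"
        by (intro DERIV_add DERIV_diff \<Gamma>[OF x] I)
      have "w x * g x \<le> \<bar>w x\<bar> * \<gamma> x"
        using mult_left_mono[OF g[OF x] abs_ge_zero[of "w x"]] abs_ge_self[of "w x * g x"]
        unfolding abs_mult by linarith
      also have "\<dots> \<le> ?s x * \<gamma> x"
        using g[OF x] by (intro mult_right_mono real_le_rsqrt) auto
      finally have 1: "w x * g x / ?s x \<le> \<gamma> x"
        using pos[of x] by (simp add: divide_le_eq mult.commute)
      have "(\<bar>w x\<bar> - e) * ?s x \<le> (w x)\<^sup>2"
      proof (cases "\<bar>w x\<bar> \<le> e")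
        case True
        then have "(\<bar>w x\<bar> - e) * ?s x \<le> 0"
          by (intro mult_nonpos_nonneg) auto
        also have "0 \<le> (w x)\<^sup>2"
          by simp
        finally show ?thesis .
      next
        case False
        have "?s x \<le> \<bar>w x\<bar> + e"
          using that by (intro real_le_lsqrt) (auto simp: power2_sum)
        then have "(\<bar>w x\<bar> - e) * ?s x \<le> (\<bar>w x\<bar> - e) * (\<bar>w x\<bar> + e)"
          using False by (intro mult_left_mono) auto
        also have "\<dots> = (w x)\<^sup>2 - e\<^sup>2"
          by (simp add: power2_eq_square algebra_simps)
        finally show ?thesis
          using zero_le_power2[of e] by linarith
      qed
      then have "\<bar>w x\<bar> - e \<le> (w x)\<^sup>2 / ?s x"
        using pos[of x] by (simp add: le_divide_eq)
      then have "a x * (\<bar>w x\<bar> - e) \<le> a x * ((w x)\<^sup>2 / ?s x)"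
        by (intro mult_left_mono a x)
      moreover have "w x * (g x - a x * w x) / ?s x = w x * g x / ?s x - a x * ((w x)\<^sup>2 / ?s x)"
        by (simp add: diff_divide_distrib algebra_simps power2_eq_square)
      ultimately show "w x * (g x - a x * w x) / ?s x - \<gamma> x + a x * (\<bar>w x\<bar> - e) \<le> 0"
        using 1 by linarith
    qed
    moreover have "integral {0..b} (\<lambda>t. a t * (\<bar>w t\<bar> - e)) = I - e * J"
    proof -
      have "integral {0..b} (\<lambda>t. a t * (\<bar>w t\<bar> - e)) = integral {0..b} (\<lambda>t. a t * \<bar>w t\<bar> - e * a t)"
        by (simp add: algebra_simps)
      also have "\<dots> = I - integral {0..b} (\<lambda>t. e * a t)"
        unfolding I_def
        by (intro integral_diff integrable_continuous_real continuous_intros cw a)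
      finally show ?thesis
        by (simp add: J_def)
    qed
    moreover have "\<bar>w b\<bar> \<le> ?s b"
      by (intro real_le_rsqrt) simp
    moreover have "?P 0 = e - \<Gamma> 0"
      using \<open>w 0 = 0\<close> that by simp
    ultimately show ?thesis
      unfolding distrib_left mult_1_right by linarith
  qed
  have "((\<lambda>e. \<Gamma> b - \<Gamma> 0 + e * (1 + J)) \<longlongrightarrow> \<Gamma> b - \<Gamma> 0 + 0 * (1 + J)) (at_right 0)"
    by (intro tendsto_intros)
  moreover have "\<forall>\<^sub>F e in at_right 0. \<bar>w b\<bar> + I \<le> \<Gamma> b - \<Gamma> 0 + e * (1 + J)"
    using eps by (auto simp: eventually_at_filter)
  ultimately show ?thesis
    unfolding I_def by (intro tendsto_lowerbound[of _ _ "at_right (0::real)"]) auto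
qed

section \<open>The force function at infinity\<close>

text \<open>An antiderivative of a function close to \<open>r\<^sup>\<mu> e\<^sup>r\<close> is close to the same function. The deviation
  is dominated by \<open>2 A r\<^bsup>\<mu> - 1\<^esup> e\<^sup>r\<close>, because beyond \<open>r0\<close> the derivative of that function is at least half of its
  size, which covers both the error of the force and the term \<open>\<mu> r\<^bsup>\<mu> - 1\<^esup> e\<^sup>r\<close>. The second estimate
  compares the potential with the force itself; this is what replaces control of \<open>\<Psi>'\<close>.\<close>

lemma potential_asymptotics:
  fixes \<Psi> \<Phi> \<Phi>' :: "real \<Rightarrow> real"
  assumes \<Phi>: "\<And>r. r \<ge> 0 \<Longrightarrow> (\<Phi> has_real_derivative \<Phi>' r) (at r within {0..})"
    and \<Phi>': "\<And>r. r \<ge> 0 \<Longrightarrow> \<Phi>' r = \<Psi> r * exp r"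
    and \<Psi>: "\<And>r. r > 0 \<Longrightarrow> \<bar>\<Psi> r / r powr \<mu> - 1\<bar> \<le> C / r"
    and "C > 0"
  obtains K r0 where "K \<ge> 0" "r0 \<ge> 1"
    "\<And>r. r \<ge> r0 \<Longrightarrow> \<bar>\<Phi> r - \<Phi> 0 - r powr \<mu> * exp r\<bar> \<le> K / r * (r powr \<mu> * exp r)"
    "\<And>r. r \<ge> r0 \<Longrightarrow> \<bar>\<Phi> r - \<Phi> 0 - \<Phi>' r\<bar> \<le> K / r * \<Phi>' r"
proof -
  define p where "p = (\<lambda>r. r powr \<mu> * exp r)"
  define p1 where "p1 = (\<lambda>r. p r / r)"
  define A where "A = C + \<bar>\<mu>\<bar>"
  have "A > 0"
    using \<open>C > 0\<close> by (simp add: A_def)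
  define r0 where "r0 = 2 * C + 2 * \<bar>\<mu> - 1\<bar> + 1"
  have r0: "r0 \<ge> 1" "r0 \<ge> 2 * C" "r0 \<ge> 2 * \<bar>\<mu> - 1\<bar>"
    using \<open>C > 0\<close> by (auto simp: r0_def)
  have p_pos: "p r > 0" "p1 r > 0" if "r > 0" for r
    using that by (auto simp: p_def p1_def)
  have dp: "(p has_real_derivative p r + \<mu> * p1 r) (at r)" if "r > 0" for r
    using that unfolding p_def p1_def
    by (auto intro!: derivative_eq_intros simp: powr_diff field_simps)
  have dp1: "(p1 has_real_derivative p1 r + (\<mu> - 1) / r * p1 r) (at r)" if "r > 0" for r
    unfolding p1_def using that
    by (auto intro!: derivative_eq_intros dp simp: p1_def field_simps)
  have force: "\<bar>\<Phi>' r - p r\<bar> \<le> C * p1 r" if "r > 0" for r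
  proof -
    have "\<Phi>' r - p r = (\<Psi> r / r powr \<mu> - 1) * p r"
      using that by (simp add: \<Phi>' p_def field_simps)
    then have "\<bar>\<Phi>' r - p r\<bar> = \<bar>\<Psi> r / r powr \<mu> - 1\<bar> * p r"
      using p_pos[OF that] by (simp add: abs_mult)
    also have "\<dots> \<le> C / r * p r"
      using p_pos[OF that] by (intro mult_right_mono \<Psi> that) auto
    finally show ?thesis
      by (simp add: p1_def)
  qed
  have p1_deriv: "p1 r / 2 \<le> p1 r + (\<mu> - 1) / r * p1 r" if "r \<ge> r0" for r
  proof -
    have "r > 0"
      using that r0 by linarith
    have "\<bar>\<mu> - 1\<bar> \<le> r / 2"
      using order_trans[OF r0(3) that] by simp
    then have "- r / 2 \<le> \<mu> - 1"
      unfolding abs_le_iff by simp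
    then have "- (1/2) \<le> (\<mu> - 1) / r"
      using \<open>r > 0\<close> by (simp add: le_divide_eq)
    then have "- (1/2) * p1 r \<le> (\<mu> - 1) / r * p1 r"
      using p_pos[OF \<open>r > 0\<close>] by (intro mult_right_mono) auto
    then show ?thesis
      by linarith
  qed
  have \<Phi>at: "(\<Phi> has_real_derivative \<Phi>' r) (at r within S)" if "r > 0" for r S
  proof -
    have "(\<Phi> has_real_derivative \<Phi>' r) (at r)"
      using \<Phi>[of r] that at_within_interior[of r "{0..}"] by simp
    then show ?thesis
      by (rule has_field_derivative_at_within)
  qed
  have diff: "\<bar>(\<Phi> r - p r) - (\<Phi> r0 - p r0)\<bar> \<le> 2 * A * p1 r - 2 * A * p1 r0" if "r \<ge> r0" for r
  proof (rule derivative_domination[OF that])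
    fix x assume "x \<in> {r0..r}"
    then have x: "x \<ge> r0" "x > 0"
      using r0 by auto
    show "((\<lambda>r. \<Phi> r - p r) has_real_derivative \<Phi>' x - (p x + \<mu> * p1 x)) (at x within {r0..r})"
      by (intro DERIV_diff \<Phi>at has_field_derivative_at_within[OF dp] x)
    show "((\<lambda>r. 2 * A * p1 r) has_real_derivative 2 * A * (p1 x + (\<mu> - 1) / x * p1 x)) (at x within {r0..r})"
      by (intro DERIV_cmult has_field_derivative_at_within[OF dp1] x)
    have "\<bar>\<Phi>' x - (p x + \<mu> * p1 x)\<bar> \<le> C * p1 x + \<bar>\<mu> * p1 x\<bar>"
      using force[OF x(2)] by linarith
    also have "\<dots> = 2 * A * (p1 x / 2)"
      using p_pos[OF x(2)] by (simp add: A_def abs_mult algebra_simps)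
    also have "\<dots> \<le> 2 * A * (p1 x + (\<mu> - 1) / x * p1 x)"
      using \<open>A > 0\<close> by (intro mult_left_mono p1_deriv x) auto
    finally show "\<bar>\<Phi>' x - (p x + \<mu> * p1 x)\<bar> \<le> 2 * A * (p1 x + (\<mu> - 1) / x * p1 x)" .
  qed
  have p1_mono: "p1 r0 \<le> p1 r" if "r \<ge> r0" for r
  proof -
    have "(2 * A) * p1 r0 \<le> (2 * A) * p1 r"
      using order_trans[OF abs_ge_zero diff[OF that]] by simp
    then show ?thesis
      using \<open>A > 0\<close> by (subst (asm) mult_le_cancel_left_pos) auto
  qed
  define K1 where "K1 = 2 * A + (\<bar>\<Phi> r0 - p r0\<bar> + \<bar>\<Phi> 0\<bar>) / p1 r0"
  have p1r0: "p1 r0 > 0"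
    using p_pos r0 by simp
  have "K1 \<ge> 0"
    using \<open>A > 0\<close> p1r0 by (auto simp: K1_def)
  have near: "\<bar>\<Phi> r - \<Phi> 0 - p r\<bar> \<le> K1 * p1 r" if "r \<ge> r0" for r
  proof -
    have "\<bar>\<Phi> r - \<Phi> 0 - p r\<bar> \<le> 2 * A * p1 r - 2 * A * p1 r0 + \<bar>\<Phi> r0 - p r0\<bar> + \<bar>\<Phi> 0\<bar>"
      using diff[OF that] by linarith
    also have "\<dots> \<le> 2 * A * p1 r + (\<bar>\<Phi> r0 - p r0\<bar> + \<bar>\<Phi> 0\<bar>)"
      using \<open>A > 0\<close> p1r0 by (simp add: mult_nonneg_nonneg)
    also have "\<bar>\<Phi> r0 - p r0\<bar> + \<bar>\<Phi> 0\<bar> = (\<bar>\<Phi> r0 - p r0\<bar> + \<bar>\<Phi> 0\<bar>) / p1 r0 * p1 r0"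
      using p1r0 by simp
    also have "\<dots> \<le> (\<bar>\<Phi> r0 - p r0\<bar> + \<bar>\<Phi> 0\<bar>) / p1 r0 * p1 r"
      using p1r0 by (intro mult_left_mono p1_mono that) auto
    finally show ?thesis
      by (simp add: K1_def algebra_simps)
  qed
  show ?thesis
  proof (rule that[of "2 * (K1 + C)" r0])
    fix r assume r: "r \<ge> r0"
    then have "r > 0"
      using r0 by linarith
    have 1: "K1 * p1 r \<le> 2 * (K1 + C) * p1 r"
      using \<open>K1 \<ge> 0\<close> \<open>C > 0\<close> p_pos[OF \<open>r > 0\<close>] by (intro mult_right_mono) auto
    then show "\<bar>\<Phi> r - \<Phi> 0 - r powr \<mu> * exp r\<bar> \<le> 2 * (K1 + C) / r * (r powr \<mu> * exp r)"
      using near[OF r] by (simp add: p_def p1_def)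
    have "C * p1 r \<le> p r / 2"
      using r r0 \<open>r > 0\<close> p_pos[OF \<open>r > 0\<close>] by (simp add: p1_def field_simps)
    then have "p r / 2 \<le> \<Phi>' r"
      using force[OF \<open>r > 0\<close>] by linarith
    then have "p1 r \<le> 2 * \<Phi>' r / r"
      using \<open>r > 0\<close> by (simp add: p1_def field_simps)
    then have "(K1 + C) * p1 r \<le> (K1 + C) * (2 * \<Phi>' r / r)"
      using \<open>K1 \<ge> 0\<close> \<open>C > 0\<close> by (intro mult_left_mono) auto
    moreover have "\<bar>\<Phi> r - \<Phi> 0 - \<Phi>' r\<bar> \<le> (K1 + C) * p1 r"
      using near[OF r] force[OF \<open>r > 0\<close>] by (simp add: algebra_simps)
    ultimately show "\<bar>\<Phi> r - \<Phi> 0 - \<Phi>' r\<bar> \<le> 2 * (K1 + C) / r * \<Phi>' r"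
      by (simp add: algebra_simps)
  qed (use \<open>K1 \<ge> 0\<close> \<open>C > 0\<close> r0 in auto)
qed

section \<open>The explicit profiles\<close>

lemma one_minus_tanh_le: "1 - tanh y \<le> 2 * exp (- 2 * y)" for y :: real
proof -
  have "1 - tanh y = 2 * exp (- 2 * y) / (1 + exp (- 2 * y))"
  proof -
    have "1 + exp (- 2 * y) > 0"
      by (simp add: add_pos_pos)
    then show ?thesis
      unfolding tanh_real_altdef by (simp only: field_simps) simp
  qed
  also have "\<dots> \<le> 2 * exp (- 2 * y)"
    by (simp add: divide_le_eq add_pos_pos algebra_simps)
  finally show ?thesis .
qed

text \<open>Two fronts of tanh shape at \<open>\<plusminus>1/2\<close>; up to the factor, this is the profile of a Toda soliton.\<close>

lemma V_bar_tanh: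
  assumes "\<delta> > 0"
  shows "V_bar \<delta> x = (1 + \<delta>) / 2 * (tanh ((x + 1/2) / (2 * \<delta>)) - tanh ((x - 1/2) / (2 * \<delta>)))"
proof -
  define a b where "a = (x + 1/2) / (2 * \<delta>)" and "b = (x - 1/2) / (2 * \<delta>)"
  have ab: "a - b = 1 / (2 * \<delta>)" "a + b = x / \<delta>"
    using assms by (auto simp: a_def b_def field_simps)
  have pos: "cosh a > 0" "cosh b > 0"
    by auto
  have "2 * (cosh a * cosh b) = cosh (a - b) + cosh (a + b)"
    by (simp add: cosh_add cosh_diff)
  then have "V_bar \<delta> x = (1 + \<delta>) * sinh (a - b) / (2 * (cosh a * cosh b))"
    by (simp add: V_bar_def ab)
  also have "\<dots> = (1 + \<delta>) / 2 * (tanh a - tanh b)"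
    using pos by (simp add: tanh_def sinh_diff field_simps)
  finally show ?thesis
    by (simp add: a_def b_def)
qed

lemma V_bar_even: "V_bar \<delta> (- x) = V_bar \<delta> x"
  by (simp add: V_bar_def)

lemma continuous_on_V_bar:
  assumes "\<delta> > 0"
  shows "continuous_on S (V_bar \<delta>)"
proof -
  have "cosh (1 / (2 * \<delta>)) + cosh (x / \<delta>) \<noteq> 0" for x
    using cosh_real_pos[of "1 / (2 * \<delta>)"] cosh_real_pos[of "x / \<delta>"] by linarith
  then show ?thesis
    unfolding V_bar_def[abs_def] using assms by (intro continuous_intros) auto
qed

lemma R_bar_ln_cosh:
  "R_bar \<delta> x = (\<delta> + \<delta>\<^sup>2) * (ln (cosh ((x + 1) / (2 * \<delta>))) + ln (cosh ((x - 1) / (2 * \<delta>))) - 2 * ln (cosh (x / (2 * \<delta>))))"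
proof -
  define y h where "y = x / (2 * \<delta>)" and "h = 1 / (2 * \<delta>)"
  have "ln (cosh (y + h)) + ln (cosh (y - h)) - 2 * ln (cosh y) = ln (cosh (y + h) * cosh (y - h) / (cosh y)\<^sup>2)"
    by (simp add: ln_mult ln_div ln_realpow)
  also have "cosh (y + h) * cosh (y - h) = (cosh y)\<^sup>2 + (sinh h)\<^sup>2"
  proof -
    have "cosh (y + h) * cosh (y - h) = (cosh y)\<^sup>2 * (cosh h)\<^sup>2 - (sinh y)\<^sup>2 * (sinh h)\<^sup>2"
      by (simp add: cosh_add cosh_diff algebra_simps power2_eq_square)
    then show ?thesis
      by (simp add: cosh_square_eq algebra_simps)
  qed
  also have "((cosh y)\<^sup>2 + (sinh h)\<^sup>2) / (cosh y)\<^sup>2 = 1 + (sinh h)\<^sup>2 / (cosh y)\<^sup>2"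
    by (simp add: add_divide_distrib)
  finally show ?thesis
    by (simp add: R_bar_def y_def h_def add_divide_distrib diff_divide_distrib)
qed

text \<open>The primitive of a tanh front is \<open>ln cosh\<close>, so averaging produces the second difference in
  \<open>R_bar_ln_cosh\<close>.\<close>

lemma avg_V_bar:
  assumes "\<delta> > 0"
  shows "avg (V_bar \<delta>) x = R_bar \<delta> x"
proof -
  define H where "H = (\<lambda>x. (1 + \<delta>) * \<delta> * (ln (cosh ((x + 1/2) / (2 * \<delta>))) - ln (cosh ((x - 1/2) / (2 * \<delta>)))))"
  have H: "(H has_real_derivative V_bar \<delta> x) (at x)" for x
    unfolding H_def V_bar_tanh[OF assms] using assms
    by (auto intro!: derivative_eq_intros simp: tanh_def field_simps)
  have "(V_bar \<delta> has_integral H (x + 1/2) - H (x - 1/2)) {x - 1/2..x + 1/2}"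
    by (rule fundamental_theorem_of_calculus)
      (auto simp flip: has_real_derivative_iff_has_vector_derivative intro!: has_field_derivative_at_within H)
  then have "avg (V_bar \<delta>) x = H (x + 1/2) - H (x - 1/2)"
    by (simp add: avg_eq_integral continuous_on_V_bar[OF assms] integral_unique)
  also have "\<dots> = R_bar \<delta> x"
    unfolding R_bar_ln_cosh by (simp add: H_def algebra_simps power2_eq_square)
  finally show ?thesis .
qed

lemma ln_cosh_bounds:
  fixes y :: real
  shows "\<bar>y\<bar> - ln 2 \<le> ln (cosh y)" "ln (cosh y) \<le> \<bar>y\<bar>" "ln (cosh y) \<le> \<bar>y\<bar> - ln 2 + exp (- 2 * \<bar>y\<bar>)"
proof -
  have "cosh y = cosh \<bar>y\<bar>"
    by (simp add: abs_if)
  also have "\<dots> = exp \<bar>y\<bar> / 2 * (1 + exp (- 2 * \<bar>y\<bar>))"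
    by (simp add: cosh_def field_simps flip: exp_add)
  finally have c: "cosh y = exp \<bar>y\<bar> / 2 * (1 + exp (- 2 * \<bar>y\<bar>))" .
  have "1 + exp (- 2 * \<bar>y\<bar>) > 0"
    by (simp add: add_pos_pos)
  then have "ln (cosh y) = ln (exp \<bar>y\<bar> / 2) + ln (1 + exp (- 2 * \<bar>y\<bar>))"
    by (subst c, subst ln_mult) auto
  also have "ln (exp \<bar>y\<bar> / 2) = \<bar>y\<bar> - ln 2"
    by (simp add: ln_div)
  finally have eq: "ln (cosh y) = \<bar>y\<bar> - ln 2 + ln (1 + exp (- 2 * \<bar>y\<bar>))" .
  show "\<bar>y\<bar> - ln 2 \<le> ln (cosh y)"
    unfolding eq by simp
  have "ln (1 + exp (- 2 * \<bar>y\<bar>)) \<le> ln 2"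
    by (subst ln_le_cancel_iff) (auto simp: add_pos_pos)
  then show "ln (cosh y) \<le> \<bar>y\<bar>"
    unfolding eq by simp
  show "ln (cosh y) \<le> \<bar>y\<bar> - ln 2 + exp (- 2 * \<bar>y\<bar>)"
    unfolding eq by (simp add: ln_add_one_self_le_self)
qed

lemma continuous_on_R_bar:
  assumes "\<delta> > 0"
  shows "continuous_on S (R_bar \<delta>)"
proof -
  have "avg (V_bar \<delta>) = R_bar \<delta>"
    by (rule ext) (rule avg_V_bar[OF assms])
  then show ?thesis
    using continuous_on_subset[OF continuous_on_avg[OF continuous_on_V_bar[OF assms]]] by auto
qed

lemma tent_identity: "\<bar>x + 1\<bar> + \<bar>x - 1\<bar> - 2 * \<bar>x\<bar> = 2 * max 0 (1 - \<bar>x\<bar>)" for x :: real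
  by (auto simp: max_def abs_if)

text \<open>In the second difference of \<open>ln cosh\<close>, replacing \<open>ln (cosh y)\<close> by \<open>\<bar>y\<bar>\<close> leaves the tent and costs a
  bounded amount, which carries a prefactor \<open>\<delta>\<close>.\<close>

lemma R_bar_near_tent:
  assumes "0 < \<delta>" "\<delta> \<le> 1/2"
  shows "\<bar>R_bar \<delta> x - max 0 (1 - \<bar>x\<bar>)\<bar> \<le> 6 * \<delta>"
proof -
  define T where "T = max 0 (1 - \<bar>x\<bar>)"
  have T: "0 \<le> T" "T \<le> 1"
    by (auto simp: T_def)
  define E where "E = ln (cosh ((x + 1) / (2 * \<delta>))) + ln (cosh ((x - 1) / (2 * \<delta>))) - 2 * ln (cosh (x / (2 * \<delta>))) - T / \<delta>"
  have ln2: "0 < ln (2 :: real)" "ln (2 :: real) \<le> 1"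
    using ln_2_less_1 by auto
  have "\<bar>x + 1\<bar> / (2 * \<delta>) + \<bar>x - 1\<bar> / (2 * \<delta>) - 2 * (\<bar>x\<bar> / (2 * \<delta>)) = T / \<delta>"
    using tent_identity[of x] assms by (simp add: T_def field_simps)
  moreover have abs: "\<bar>y / (2 * \<delta>)\<bar> = \<bar>y\<bar> / (2 * \<delta>)" for y
    using assms by simp
  ultimately have E: "\<bar>E\<bar> \<le> 2"
    unfolding E_def abs_le_iff
    using ln2 ln_cosh_bounds(1,2)[of "(x + 1) / (2 * \<delta>)"] ln_cosh_bounds(1,2)[of "(x - 1) / (2 * \<delta>)"]
      ln_cosh_bounds(1,2)[of "x / (2 * \<delta>)"] unfolding abs by argo
  have "R_bar \<delta> x - T = (\<delta> + \<delta>\<^sup>2) * (E + T / \<delta>) - T"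
    by (simp add: R_bar_ln_cosh E_def)
  also have "\<dots> = (\<delta> + \<delta>\<^sup>2) * E + \<delta> * T"
    using assms by (simp add: field_simps power2_eq_square)
  finally have "\<bar>R_bar \<delta> x - T\<bar> \<le> (\<delta> + \<delta>\<^sup>2) * \<bar>E\<bar> + \<delta> * T"
    using assms T abs_triangle_ineq[of "(\<delta> + \<delta>\<^sup>2) * E" "\<delta> * T"] by (simp add: abs_mult)
  also have "\<dots> \<le> (2 * \<delta>) * 2 + \<delta> * 1"
    using assms T E power_decreasing[of 1 2 \<delta>] by (intro add_mono mult_mono) auto
  finally show ?thesis
    using assms by (simp add: T_def)
qed

text \<open>Away from the corners of the tent the constants \<open>ln 2\<close> cancel in the second difference. What remains
  is the amplitude factor \<open>1 + \<delta>\<close>, which keeps \<open>R_bar\<close> above the tent by an amount of order \<open>\<delta>\<close>.\<close>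

lemma R_bar_above_tent:
  assumes "0 < \<delta>" "\<delta> \<le> 1/2" and x: "1/4 \<le> x" "x \<le> 1/2"
  shows "R_bar \<delta> x \<ge> (1 + \<delta>) * (1 - x) - 3 * \<delta> * exp (- 1 / (4 * \<delta>))"
proof -
  define E where "E = ln (cosh ((x + 1) / (2 * \<delta>))) + ln (cosh ((x - 1) / (2 * \<delta>))) - 2 * ln (cosh (x / (2 * \<delta>)))"
  have abs: "\<bar>(x + 1) / (2 * \<delta>)\<bar> = (1 + x) / (2 * \<delta>)" "\<bar>(x - 1) / (2 * \<delta>)\<bar> = (1 - x) / (2 * \<delta>)" "\<bar>x / (2 * \<delta>)\<bar> = x / (2 * \<delta>)"
    using assms by auto
  have "(1 + x) / (2 * \<delta>) + (1 - x) / (2 * \<delta>) - 2 * (x / (2 * \<delta>)) = (1 - x) / \<delta>"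
    using assms by (simp add: field_simps)
  moreover have "exp (- 2 * (x / (2 * \<delta>))) \<le> exp (- 1 / (4 * \<delta>))"
    using assms by (simp add: field_simps)
  ultimately have E: "(1 - x) / \<delta> - 2 * exp (- 1 / (4 * \<delta>)) \<le> E"
    using ln_cosh_bounds(1)[of "(x + 1) / (2 * \<delta>)"] ln_cosh_bounds(1)[of "(x - 1) / (2 * \<delta>)"]
      ln_cosh_bounds(3)[of "x / (2 * \<delta>)"] unfolding abs E_def by argo
  have "(1 + \<delta>) * (1 - x) - 3 * \<delta> * exp (- 1 / (4 * \<delta>)) \<le> (1 + \<delta>) * (1 - x) - 2 * (1 + \<delta>) * \<delta> * exp (- 1 / (4 * \<delta>))"
    using assms by (intro diff_left_mono mult_right_mono) auto
  also have "\<dots> = (\<delta> + \<delta>\<^sup>2) * ((1 - x) / \<delta> - 2 * exp (- 1 / (4 * \<delta>)))"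
    using assms by (simp add: field_simps power2_eq_square)
  also have "\<dots> \<le> (\<delta> + \<delta>\<^sup>2) * E"
    using E assms by (intro mult_left_mono) auto
  finally show ?thesis
    by (simp add: R_bar_ln_cosh E_def)
qed

section \<open>Estimates for a single concentrated wave\<close>

text \<open>The constants of the estimates below are functions of \<open>L\<close> and \<open>c\<close> only, which makes the bounds uniform
  in \<open>\<delta>\<close>.\<close>

definition amp_const :: "real \<Rightarrow> real \<Rightarrow> real" where
  "amp_const L c = 29 + 7 * c + 2 * L"

definition front_const :: "real \<Rightarrow> real \<Rightarrow> real" where
  "front_const L c = 16 + 5 * c + 2 * amp_const L c"

definition wave_const :: "real \<Rightarrow> real \<Rightarrow> real" where
  "wave_const L c = 4 + 2 * L + 2 * amp_const L c + 36 * front_const L c"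

text \<open>A wave for one value of \<open>\<delta>\<close>. The function \<open>R\<close> enters only through \<open>R' = V (x + 1/2) - V (x - 1/2)\<close> in
  the derivative of the scaled potential \<open>G\<close>. The two ingredients with content are the smallness of the
  force outside \<open>[-1/2, 1/2]\<close> and the relation between \<open>G\<close> and the force \<open>F\<close> inside.\<close>

locale concentrated_wave =
  fixes L \<delta> c :: real and F V G :: "real \<Rightarrow> real"
  assumes L: "2 < L" and \<delta>: "0 < \<delta>" "\<delta> \<le> 1/2" and c: "0 \<le> c"
    and exp_small: "2 * exp (- 1 / (2 * \<delta>)) \<le> \<delta>\<^sup>2"
    and F_cont: "continuous_on UNIV F"
    and F_nonneg: "\<And>x. 0 \<le> F x"
    and F_even: "\<And>x. \<bar>x\<bar> \<le> 2 \<Longrightarrow> F (- x) = F x"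
    and F_decr: "\<And>x y. 0 \<le> x \<Longrightarrow> x \<le> y \<Longrightarrow> y \<le> 2 \<Longrightarrow> F y \<le> F x"
    and F_half: "F (1/2) \<le> \<delta> ^ 3"
    and V_eq: "V = avg F"
    and V_even: "\<And>x. \<bar>x\<bar> \<le> L \<Longrightarrow> V (- x) = V x"
    and V_decr: "\<And>x y. 0 \<le> x \<Longrightarrow> x \<le> y \<Longrightarrow> y \<le> L \<Longrightarrow> V y \<le> V x"
    and V0_bounds: "1/2 \<le> V 0" "V 0 \<le> 5"
    and V_norm: "integral {-L..L} (\<lambda>x. (V x)\<^sup>2) = 1"
    and G_deriv: "\<And>x. 0 \<le> x \<Longrightarrow> x \<le> 1/2 \<Longrightarrow>
        (G has_real_derivative 2 * F x * (V (x + 1/2) - V (x - 1/2))) (at x)"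
    and G_close: "\<And>x. 0 \<le> x \<Longrightarrow> x \<le> 1/2 \<Longrightarrow> \<bar>G x - 2 * \<delta> * F x\<bar> \<le> c * \<delta>\<^sup>2 * F x"
begin

definition m :: real where "m = V 0"

definition q :: "real \<Rightarrow> real" where "q s = V (s - 1/2) - V (s + 1/2)"

definition q' :: "real \<Rightarrow> real" where "q' s = 2 * F s - F (s - 1) - F (s + 1)"

definition qbar :: "real \<Rightarrow> real" where "qbar s = (1 + \<delta>) * tanh (s / (2 * \<delta>))"

lemma d3_le: "\<delta> ^ 3 \<le> \<delta>\<^sup>2" "\<delta>\<^sup>2 \<le> \<delta>" "\<delta> ^ 3 \<le> 1" "\<delta>\<^sup>2 \<le> 1"
proof -
  show "\<delta> ^ 3 \<le> \<delta>\<^sup>2"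
    using \<delta> by (intro power_decreasing) auto
  show "\<delta>\<^sup>2 \<le> \<delta>"
    using \<delta> power_decreasing[of 1 2 \<delta>] by simp
  show "\<delta> ^ 3 \<le> 1" "\<delta>\<^sup>2 \<le> 1"
    using \<delta> by (intro power_le_one; simp)+
qed

lemma m_bounds: "1/2 \<le> m" "m \<le> 5"
  using V0_bounds by (auto simp: m_def)

text \<open>Pairing the points \<open>1/2 - s\<close> and \<open>1/2 + s\<close>, because the two sides of a front are described by the
  same function of \<open>s\<close>.\<close>

lemma integral_fold_fronts: "integral {-L..L} f = 2 * (integral {0..1/2} (\<lambda>s. f (1/2 - s) + f (1/2 + s)) + integral {1..L} f)"
  if f: "continuous_on {-L..L} f" and even: "\<And>x. \<bar>x\<bar> \<le> L \<Longrightarrow> f (- x) = f x" for f :: "real \<Rightarrow> real"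
proof -
  have int: "f integrable_on {a..b}" if "{a..b} \<subseteq> {-L..L}" for a b
    by (intro integrable_continuous_real continuous_on_subset[OF f that])
  have 1: "integral {-L..0} f = integral {0..L} f"
  proof -
    have "integral {-L..-0} f = integral {-L..-0} (\<lambda>x. f (- x))"
      by (rule integral_cong) (use even in \<open>auto simp: even\<close>)
    then show ?thesis
      using Henstock_Kurzweil_Integration.integral_reflect_real[of L 0 f] by simp
  qed
  have 2: "integral {-L..0} f + integral {0..L} f = integral {-L..L} f"
    using L by (intro Henstock_Kurzweil_Integration.integral_combine int) auto
  have 3: "integral {0..1/2} f + integral {1/2..1} f = integral {0..1} f"
    using L by (intro Henstock_Kurzweil_Integration.integral_combine int) auto
  have 4: "integral {0..1} f + integral {1..L} f = integral {0..L} f"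
    using L by (intro Henstock_Kurzweil_Integration.integral_combine int) auto
  have 5: "integral {1/2..1} f = integral {0..1/2} (\<lambda>s. f (1/2 + s))"
    using integral_shift_real_ivl[of "1/2" "1/2" 1 f] by (simp add: add.commute)
  have 6: "integral {0..1/2} f = integral {0..1/2} (\<lambda>s. f (1/2 - s))"
  proof -
    have "integral {0..1/2} (\<lambda>s. f (1/2 - s)) = integral {-1/2..-0} (\<lambda>s. f (1/2 + s))"
      using Henstock_Kurzweil_Integration.integral_reflect_real[of "1/2" 0 "\<lambda>s. f (1/2 - s)"] by simp
    also have "\<dots> = integral {0..1/2} f"
      using integral_shift_real_ivl[of 0 "1/2" "1/2" f] by (simp add: add.commute)
    finally show ?thesis ..
  qed
  have 7: "integral {0..1/2} (\<lambda>s. f (1/2 - s) + f (1/2 + s))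
      = integral {0..1/2} (\<lambda>s. f (1/2 - s)) + integral {0..1/2} (\<lambda>s. f (1/2 + s))"
    using L by (intro integral_add integrable_continuous_real continuous_on_compose2[OF f] continuous_intros) auto
  show ?thesis
    using 1 2 3 4 5 6 7 by simp
qed

lemma V_deriv: "(V has_real_derivative F (x + 1/2) - F (x - 1/2)) (at x within S)"
  unfolding V_eq by (rule has_field_derivative_at_within[OF avg_has_real_derivative[OF F_cont]])

lemma V_cont: "continuous_on S V"
  using V_deriv by (rule DERIV_continuous_on)

lemma V_nonneg: "0 \<le> V x"
  unfolding V_eq avg_eq_integral[OF F_cont]
  by (intro integral_nonneg integrable_continuous_real continuous_on_subset[OF F_cont] F_nonneg) auto

lemma F_small:
  assumes "1/2 \<le> \<bar>x\<bar>" "\<bar>x\<bar> \<le> 2"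
  shows "F x \<le> \<delta> ^ 3"
proof -
  have "F x = F \<bar>x\<bar>"
    using F_even[of x] assms by (auto simp: abs_if)
  also have "\<dots> \<le> F (1/2)"
    using assms by (intro F_decr) auto
  finally show ?thesis
    using F_half by simp
qed

lemma V_tail:
  assumes "1 \<le> x" "x \<le> L"
  shows "V x \<le> \<delta> ^ 3"
proof -
  have "V x \<le> V 1"
    using assms by (intro V_decr) auto
  also have "V 1 = integral {1/2..3/2} F"
    unfolding V_eq avg_eq_integral[OF F_cont] by simp
  also have "\<dots> \<le> integral {1/2..3/2::real} (\<lambda>_. \<delta> ^ 3)"
    by (intro integral_le integrable_continuous_real continuous_on_subset[OF F_cont] continuous_intros F_small) auto
  finally show ?thesis
    by simp
qed

lemma V_le_m: "\<bar>x\<bar> \<le> L \<Longrightarrow> V x \<le> m"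
  using V_decr[of 0 "\<bar>x\<bar>"] V_even[of x] by (auto simp: m_def abs_if split: if_splits)

lemma q_deriv: "(q has_real_derivative q' s) (at s within S)"
proof -
  have "((\<lambda>s. V (s - 1/2)) has_real_derivative F (s - 1/2 + 1/2) - F (s - 1/2 - 1/2)) (at s)"
    using DERIV_shift[of V _ s "- 1/2"] V_deriv[of "s - 1/2" UNIV] by simp
  moreover have "((\<lambda>s. V (s + 1/2)) has_real_derivative F (s + 1/2 + 1/2) - F (s + 1/2 - 1/2)) (at s)"
    using DERIV_shift[of V _ s "1/2"] V_deriv[of "s + 1/2" UNIV] by simp
  ultimately have "((\<lambda>s. V (s - 1/2) - V (s + 1/2)) has_real_derivative
      (F (s - 1/2 + 1/2) - F (s - 1/2 - 1/2)) - (F (s + 1/2 + 1/2) - F (s + 1/2 - 1/2))) (at s)"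
    by (rule DERIV_diff)
  then have "(q has_real_derivative q' s) (at s)"
    by (simp add: q_def[abs_def] q'_def algebra_simps)
  then show ?thesis
    by (rule has_field_derivative_at_within)
qed

lemma q_cont: "continuous_on S q"
  using q_deriv by (rule DERIV_continuous_on)

lemma q_bounds:
  assumes "0 \<le> s" "s \<le> 1/2"
  shows "0 \<le> q s" "q s \<le> m"
proof -
  have "V (s - 1/2) = V (1/2 - s)"
    using V_even[of "1/2 - s"] assms L by simp
  then show "0 \<le> q s"
    unfolding q_def using V_decr[of "1/2 - s" "s + 1/2"] assms L by simp
  show "q s \<le> m"
    unfolding q_def using V_le_m[of "s - 1/2"] V_nonneg[of "s + 1/2"] assms L by simp
qed

lemma q_half: "m - \<delta> ^ 3 \<le> q (1/2)" "q (1/2) \<le> m"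
  using V_tail[of 1] L q_bounds[of "1/2"] by (auto simp: q_def m_def)

lemma q_0: "q 0 = 0"
  using V_even[of "1/2"] L by (simp add: q_def)

lemma far_force:
  assumes "0 \<le> s" "s \<le> 1/2"
  shows "0 \<le> 2 * F s - q' s" "2 * F s - q' s \<le> 2 * \<delta> ^ 3"
  using F_nonneg[of "s - 1"] F_nonneg[of "s + 1"] F_small[of "s - 1"] F_small[of "s + 1"] assms
  by (auto simp: q'_def)

text \<open>The difference of the values of \<open>V\<close> at \<open>s - 1/2\<close> and \<open>s + 1/2\<close> is \<open>q s\<close>. Their sum has the derivative
  \<open>F (s + 1) - F (s - 1)\<close>, which only sees the far force, so it stays at its value for \<open>s = 1/2\<close>, which is
  nearly \<open>m\<close>.\<close>

lemma V_front:
  assumes "0 \<le> s" "s \<le> 1/2"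
  shows "\<bar>V (1/2 + s) - (m - q s) / 2\<bar> \<le> \<delta> ^ 3" "\<bar>V (1/2 - s) - (m + q s) / 2\<bar> \<le> \<delta> ^ 3"
proof -
  let ?H = "\<lambda>s. V (s + 1/2) + V (s - 1/2)"
  have 1: "\<bar>?H (1/2) - ?H s\<bar> \<le> \<delta> ^ 3 * (1/2) - \<delta> ^ 3 * s"
  proof (rule derivative_domination[OF assms(2)])
    fix x assume "x \<in> {s..1/2}"
    then have x: "0 \<le> x" "x \<le> 1/2"
      using assms by auto
    have "((\<lambda>s. V (s - 1/2)) has_real_derivative F (x - 1/2 + 1/2) - F (x - 1/2 - 1/2)) (at x)"
      using DERIV_shift[of V _ x "- 1/2"] V_deriv[of "x - 1/2" UNIV] by simp
    moreover have "((\<lambda>s. V (s + 1/2)) has_real_derivative F (x + 1/2 + 1/2) - F (x + 1/2 - 1/2)) (at x)"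
      using DERIV_shift[of V _ x "1/2"] V_deriv[of "x + 1/2" UNIV] by simp
    ultimately have "(?H has_real_derivative
      (F (x + 1/2 + 1/2) - F (x + 1/2 - 1/2)) + (F (x - 1/2 + 1/2) - F (x - 1/2 - 1/2))) (at x)"
      by (intro DERIV_add)
    then have "(?H has_real_derivative F (x + 1) - F (x - 1)) (at x)"
      by (simp add: algebra_simps)
    then show "(?H has_real_derivative F (x + 1) - F (x - 1)) (at x within {s..1/2})"
      by (rule has_field_derivative_at_within)
    show "\<bar>F (x + 1) - F (x - 1)\<bar> \<le> \<delta> ^ 3"
      using F_nonneg[of "x - 1"] F_nonneg[of "x + 1"] F_small[of "x - 1"] F_small[of "x + 1"] x
      by (auto simp: abs_le_iff)
  qed (auto intro!: derivative_eq_intros)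
  have "?H (1/2) = V 1 + m"
    by (simp add: m_def)
  moreover have "0 \<le> V 1" "V 1 \<le> \<delta> ^ 3"
    using V_tail[of 1] L V_nonneg by auto
  moreover have "0 \<le> \<delta> ^ 3 * s"
    using assms \<delta> by simp
  ultimately have H: "\<bar>?H s - m\<bar> \<le> 2 * \<delta> ^ 3"
    using 1 \<delta> unfolding abs_le_iff by auto
  show "\<bar>V (1/2 + s) - (m - q s) / 2\<bar> \<le> \<delta> ^ 3"
    using H by (simp add: q_def add.commute abs_le_iff field_simps)
  have "V (1/2 - s) = V (s - 1/2)"
    using V_even[of "1/2 - s"] assms L by simp
  then show "\<bar>V (1/2 - s) - (m + q s) / 2\<bar> \<le> \<delta> ^ 3"
    using H by (simp add: q_def add.commute abs_le_iff field_simps)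
qed

section \<open>Energy, Riccati equation and amplitude\<close>

text \<open>The energy \<open>q\<^sup>2/2 + G\<close> has the derivative \<open>q (q' - 2 F)\<close>, which is governed by the far force, and at
  \<open>1/2\<close> it equals \<open>m\<^sup>2/2\<close> up to the same order.\<close>

lemma energy:
  assumes "0 \<le> s" "s \<le> 1/2"
  shows "\<bar>(m\<^sup>2 - (q s)\<^sup>2) / 2 - G s\<bar> \<le> (12 + c) * \<delta> ^ 3"
proof -
  let ?E = "\<lambda>x. (q x)\<^sup>2 / 2 + G x"
  have 1: "\<bar>?E (1/2) - ?E s\<bar> \<le> 10 * \<delta> ^ 3 * (1/2) - 10 * \<delta> ^ 3 * s"
  proof (rule derivative_domination[OF assms(2)])
    fix x assume "x \<in> {s..1/2}"
    then have x: "0 \<le> x" "x \<le> 1/2"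
      using assms by auto
    have "(G has_real_derivative - (2 * F x * q x)) (at x within {s..1/2})"
      using has_field_derivative_at_within[OF G_deriv[OF x]] by (simp add: q_def algebra_simps)
    then show "(?E has_real_derivative q x * (q' x - 2 * F x)) (at x within {s..1/2})"
      by (auto intro!: derivative_eq_intros q_deriv simp: algebra_simps)
    have "\<bar>q x * (q' x - 2 * F x)\<bar> = q x * (2 * F x - q' x)"
      using q_bounds[OF x] far_force[OF x] by (simp add: abs_mult)
    also have "\<dots> \<le> 5 * (2 * \<delta> ^ 3)"
      using q_bounds[OF x] far_force[OF x] m_bounds by (intro mult_mono) auto
    finally show "\<bar>q x * (q' x - 2 * F x)\<bar> \<le> 10 * \<delta> ^ 3"
      by simp
  qed (auto intro!: derivative_eq_intros)
  have 2: "\<bar>m\<^sup>2 - (q (1/2))\<^sup>2\<bar> \<le> 10 * \<delta> ^ 3"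
  proof -
    have "m\<^sup>2 - (q (1/2))\<^sup>2 = (m - q (1/2)) * (m + q (1/2))"
      by (simp add: power2_eq_square algebra_simps)
    moreover have "0 \<le> (m - q (1/2)) * (m + q (1/2))"
      using q_half m_bounds q_bounds[of "1/2"] by simp
    moreover have "(m - q (1/2)) * (m + q (1/2)) \<le> \<delta> ^ 3 * 10"
      using q_half m_bounds q_bounds[of "1/2"] \<delta> by (intro mult_mono) auto
    ultimately show ?thesis
      by simp
  qed
  have 3: "\<bar>G (1/2)\<bar> \<le> (1 + c) * \<delta> ^ 3"
  proof -
    have "\<bar>G (1/2)\<bar> \<le> 2 * \<delta> * F (1/2) + c * \<delta>\<^sup>2 * F (1/2)"
    proof -
      have "0 \<le> 2 * \<delta> * F (1/2)"
        using F_nonneg[of "1/2"] \<delta> by simp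
      moreover have "\<bar>G (1/2) - 2 * \<delta> * F (1/2)\<bar> \<le> c * \<delta>\<^sup>2 * F (1/2)"
        by (rule G_close) auto
      ultimately show ?thesis
        unfolding abs_le_iff by linarith
    qed
    also have "\<dots> = (2 * \<delta> + c * \<delta>\<^sup>2) * F (1/2)"
      by (simp add: algebra_simps)
    also have "\<dots> \<le> (1 + c) * \<delta> ^ 3"
      using \<delta> c d3_le F_half F_nonneg[of "1/2"] by (intro mult_mono add_mono) (auto intro: mult_left_le)
    finally show ?thesis .
  qed
  have "0 \<le> 10 * \<delta> ^ 3 * s" "0 \<le> \<delta> ^ 3"
    using assms \<delta> by auto
  then show ?thesis
    using 1 2 3 by (auto simp: abs_le_iff field_simps)
qed

text \<open>The error is measured by \<open>q'\<close> instead of the force, so that its integral can be read off: \<open>q\<close> is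
  bounded by \<open>m\<close>.\<close>

lemma riccati:
  assumes "0 \<le> s" "s \<le> 1/2"
  shows "\<bar>q' s - (m\<^sup>2 - (q s)\<^sup>2) / (2 * \<delta>)\<bar> \<le> c * \<delta> / 2 * q' s + (14 + 2 * c) * \<delta>\<^sup>2"
proof -
  have f: "0 \<le> 2 * F s - q' s" "2 * F s - q' s \<le> 2 * \<delta> ^ 3"
    using far_force[OF assms] by auto
  have g: "\<bar>2 * F s - G s / \<delta>\<bar> \<le> c * \<delta> * F s"
  proof -
    have "2 * F s - G s / \<delta> = - ((G s - 2 * \<delta> * F s) / \<delta>)"
      using \<delta> by (simp add: field_simps)
    then have "\<bar>2 * F s - G s / \<delta>\<bar> = \<bar>G s - 2 * \<delta> * F s\<bar> / \<delta>"
      using \<delta> by simp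
    also have "\<dots> \<le> c * \<delta>\<^sup>2 * F s / \<delta>"
      using G_close[OF assms] \<delta> by (intro divide_right_mono) auto
    finally show ?thesis
      using \<delta> by (simp add: power2_eq_square)
  qed
  have e: "\<bar>G s / \<delta> - (m\<^sup>2 - (q s)\<^sup>2) / (2 * \<delta>)\<bar> \<le> (12 + c) * \<delta>\<^sup>2"
  proof -
    have "G s / \<delta> - (m\<^sup>2 - (q s)\<^sup>2) / (2 * \<delta>) = - (((m\<^sup>2 - (q s)\<^sup>2) / 2 - G s) / \<delta>)"
      using \<delta> by (simp add: field_simps)
    then have "\<bar>G s / \<delta> - (m\<^sup>2 - (q s)\<^sup>2) / (2 * \<delta>)\<bar> = \<bar>(m\<^sup>2 - (q s)\<^sup>2) / 2 - G s\<bar> / \<delta>"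
      using \<delta> by simp
    also have "\<dots> \<le> (12 + c) * \<delta> ^ 3 / \<delta>"
      using energy[OF assms] \<delta> by (intro divide_right_mono) auto
    finally show ?thesis
      using \<delta> by (simp add: power2_eq_square power3_eq_cube)
  qed
  have h: "c * \<delta> * F s \<le> c * \<delta> / 2 * q' s + c * \<delta>\<^sup>2"
  proof -
    have "F s \<le> q' s / 2 + \<delta> ^ 3"
      using f by simp
    then have "c * \<delta> * F s \<le> c * \<delta> * (q' s / 2 + \<delta> ^ 3)"
      using c \<delta> by (intro mult_left_mono) auto
    also have "\<dots> = c * \<delta> / 2 * q' s + c * (\<delta> * \<delta> ^ 3)"
      by (simp add: algebra_simps)
    also have "\<delta> * \<delta> ^ 3 \<le> 1 * \<delta>\<^sup>2"
      using \<delta> d3_le by (intro mult_mono) auto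
    finally show ?thesis
      using c by (simp add: mult_left_mono)
  qed
  show ?thesis
    using f g e h d3_le unfolding abs_le_iff by (auto simp: algebra_simps)
qed

text \<open>The Riccati equation, multiplied by \<open>2 \<delta>\<close> and integrated from \<open>q 0 = 0\<close> to \<open>q (1/2) \<approx> m\<close>.\<close>

lemma front_width: "\<bar>integral {0..1/2} (\<lambda>s. m\<^sup>2 - (q s)\<^sup>2) - 2 * \<delta> * m\<bar> \<le> (16 + 7 * c) * \<delta>\<^sup>2"
proof -
  let ?X = "\<lambda>s. 2 * \<delta> * q s - integral {0..s} (\<lambda>s. m\<^sup>2 - (q s)\<^sup>2)"
  let ?Y = "\<lambda>s. c * \<delta>\<^sup>2 * q s + 2 * (14 + 2 * c) * \<delta> ^ 3 * s"
  have X: "\<bar>?X (1/2) - ?X 0\<bar> \<le> ?Y (1/2) - ?Y 0"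
  proof (rule derivative_domination)
    fix s :: real assume s: "s \<in> {0..1/2}"
    have "((\<lambda>s. integral {0..s} (\<lambda>s. m\<^sup>2 - (q s)\<^sup>2)) has_real_derivative m\<^sup>2 - (q s)\<^sup>2) (at s within {0..1/2})"
      by (intro integral_has_real_derivative continuous_intros q_cont s)
    then show "(?X has_real_derivative 2 * \<delta> * q' s - (m\<^sup>2 - (q s)\<^sup>2)) (at s within {0..1/2})"
      by (intro DERIV_diff DERIV_cmult q_deriv)
    show "(?Y has_real_derivative c * \<delta>\<^sup>2 * q' s + 2 * (14 + 2 * c) * \<delta> ^ 3) (at s within {0..1/2})"
      by (auto intro!: derivative_eq_intros q_deriv)
    have "2 * \<delta> * q' s - (m\<^sup>2 - (q s)\<^sup>2) = 2 * \<delta> * (q' s - (m\<^sup>2 - (q s)\<^sup>2) / (2 * \<delta>))"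
      using \<delta> by (simp add: field_simps)
    then have "\<bar>2 * \<delta> * q' s - (m\<^sup>2 - (q s)\<^sup>2)\<bar> = 2 * \<delta> * \<bar>q' s - (m\<^sup>2 - (q s)\<^sup>2) / (2 * \<delta>)\<bar>"
      using \<delta> by (simp add: abs_mult)
    also have "\<dots> \<le> 2 * \<delta> * (c * \<delta> / 2 * q' s + (14 + 2 * c) * \<delta>\<^sup>2)"
      using \<delta> s by (intro mult_left_mono riccati) auto
    finally show "\<bar>2 * \<delta> * q' s - (m\<^sup>2 - (q s)\<^sup>2)\<bar> \<le> c * \<delta>\<^sup>2 * q' s + 2 * (14 + 2 * c) * \<delta> ^ 3"
      by (simp add: algebra_simps power2_eq_square power3_eq_cube)
  qed simp
  have "c * \<delta>\<^sup>2 * q (1/2) \<le> c * \<delta>\<^sup>2 * 5"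
    using c q_bounds[of "1/2"] m_bounds by (intro mult_left_mono) auto
  moreover have "(14 + 2 * c) * \<delta> ^ 3 \<le> (14 + 2 * c) * \<delta>\<^sup>2"
    using c d3_le by (intro mult_left_mono) auto
  moreover have "\<bar>2 * \<delta> * q (1/2) - 2 * \<delta> * m\<bar> \<le> 1 * \<delta> ^ 3"
  proof -
    have "\<bar>2 * \<delta> * q (1/2) - 2 * \<delta> * m\<bar> = (2 * \<delta>) * (m - q (1/2))"
      using q_half \<delta> by (simp add: abs_mult flip: right_diff_distrib)
    also have "\<dots> \<le> 1 * \<delta> ^ 3"
      using q_half \<delta> by (intro mult_mono) auto
    finally show ?thesis .
  qed
  ultimately show ?thesis
    using X d3_le by (auto simp: q_0 abs_le_iff algebra_simps)
qed

text \<open>The norm constraint becomes \<open>(m - \<delta>)\<^sup>2 = 1 + O(\<delta>\<^sup>2)\<close> after insertion of \<open>front_width\<close>.\<close>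

lemma amplitude: "\<bar>m - 1 - \<delta>\<bar> \<le> amp_const L c * \<delta>\<^sup>2"
proof -
  define J where "J = integral {0..1/2} (\<lambda>s. m\<^sup>2 - (q s)\<^sup>2)"
  define I where "I = integral {0..1/2} (\<lambda>s. (V (1/2 - s))\<^sup>2 + (V (1/2 + s))\<^sup>2)"
  define T where "T = integral {1..L} (\<lambda>x. (V x)\<^sup>2)"
  have one: "1 = 2 * (I + T)"
    using V_norm integral_fold_fronts[of "\<lambda>x. (V x)\<^sup>2"] by (simp add: I_def T_def V_even V_cont continuous_intros)
  have T: "0 \<le> T" "T \<le> L * \<delta>\<^sup>2"
  proof -
    show "0 \<le> T"
      unfolding T_def by (intro integral_nonneg integrable_continuous_real continuous_intros V_cont) auto
    have "T \<le> integral {1..L} (\<lambda>_. \<delta>\<^sup>2)"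
      unfolding T_def
    proof (intro integral_le integrable_continuous_real continuous_intros V_cont)
      fix x assume "x \<in> {1..L}"
      then have "V x \<le> \<delta> ^ 3"
        by (intro V_tail) auto
      then have "V x \<le> \<delta>"
        using d3_le by linarith
      then show "(V x)\<^sup>2 \<le> \<delta>\<^sup>2"
        using V_nonneg by (intro power_mono) auto
    qed
    also have "\<dots> = (L - 1) * \<delta>\<^sup>2"
      using L by simp
    also have "\<dots> \<le> L * \<delta>\<^sup>2"
      by (intro mult_right_mono) auto
    finally show "T \<le> L * \<delta>\<^sup>2" .
  qed
  have cV: "continuous_on {0..1/2} (\<lambda>s. (V (1/2 - s))\<^sup>2 + (V (1/2 + s))\<^sup>2)"
    by (intro continuous_intros continuous_on_compose2[OF V_cont[of UNIV]]) auto
  have I: "\<bar>I - (m\<^sup>2 - J) / 2\<bar> \<le> 6 * \<delta> ^ 3"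
  proof -
    have "integral {0..1/2} (\<lambda>s. m\<^sup>2 - (m\<^sup>2 - (q s)\<^sup>2) / 2) = integral {0..1/2::real} (\<lambda>s. m\<^sup>2) - integral {0..1/2} (\<lambda>s. (m\<^sup>2 - (q s)\<^sup>2) / 2)"
      by (intro integral_diff integrable_continuous_real continuous_intros q_cont) auto
    also have "\<dots> = m\<^sup>2 / 2 - J / 2"
      unfolding J_def integral_divide by simp
    also have "\<dots> = (m\<^sup>2 - J) / 2"
      by (simp only: diff_divide_distrib)
    finally have "I - (m\<^sup>2 - J) / 2 = integral {0..1/2} (\<lambda>s. ((V (1/2 - s))\<^sup>2 + (V (1/2 + s))\<^sup>2) - (m\<^sup>2 - (m\<^sup>2 - (q s)\<^sup>2) / 2))"
      unfolding I_def
      by (subst integral_diff) (auto intro!: integrable_continuous_real cV continuous_intros q_cont)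
    also have "norm \<dots> \<le> integral {0..1/2::real} (\<lambda>_. 12 * \<delta> ^ 3)"
    proof (intro integral_norm_bound_integral integrable_continuous_real cV continuous_intros q_cont; simp?)
      fix s :: real assume s: "0 \<le> s \<and> s * 2 \<le> 1"
      then have s': "0 \<le> s" "s \<le> 1/2"
        by auto
      obtain t1 where t1: "V (1/2 - s) = (m + q s) / 2 + t1" "\<bar>t1\<bar> \<le> \<delta> ^ 3"
        using V_front[OF s'] that by (metis add_diff_cancel_left' diff_add_cancel add.commute)
      obtain t2 where t2: "V (1/2 + s) = (m - q s) / 2 + t2" "\<bar>t2\<bar> \<le> \<delta> ^ 3"
        using V_front[OF s'] that by (metis add_diff_cancel_left' diff_add_cancel add.commute)
      have "\<bar>t1\<^sup>2\<bar> \<le> \<delta> ^ 3" if "\<bar>t1\<bar> \<le> \<delta> ^ 3" for t1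
      proof -
        have "\<bar>t1\<^sup>2\<bar> = \<bar>t1\<bar> * \<bar>t1\<bar>"
          by (simp add: power2_eq_square)
        also have "\<dots> \<le> 1 * \<delta> ^ 3"
          using that d3_le by (intro mult_mono) auto
        finally show ?thesis
          by simp
      qed
      note sq = this[OF t1(2)] this[OF t2(2)]
      have mq: "\<bar>(m + q s) * t1\<bar> \<le> (m + q s) * \<delta> ^ 3" "\<bar>(m - q s) * t2\<bar> \<le> (m - q s) * \<delta> ^ 3"
        using q_bounds[OF s'] m_bounds t1 t2 by (auto simp: abs_mult intro!: mult_left_mono)
      have m5: "m * \<delta> ^ 3 \<le> 5 * \<delta> ^ 3"
        using m_bounds \<delta> by (intro mult_right_mono) auto
      have "((V (1/2 - s))\<^sup>2 + (V (1/2 + s))\<^sup>2) - (m\<^sup>2 - (m\<^sup>2 - (q s)\<^sup>2) / 2) = (m + q s) * t1 + (m - q s) * t2 + t1\<^sup>2 + t2\<^sup>2"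
        unfolding t1 t2 by (simp add: power2_eq_square field_simps)
      then show "\<bar>(V (1/2 - s))\<^sup>2 + (V (1/2 + s))\<^sup>2 - (m\<^sup>2 - (m\<^sup>2 - (q s)\<^sup>2) / 2)\<bar> \<le> 12 * \<delta> ^ 3"
        using sq mq m5 unfolding abs_le_iff by (auto simp: algebra_simps)
    qed
    finally show ?thesis
      by simp
  qed
  have "\<bar>m\<^sup>2 - 2 * \<delta> * m - 1\<bar> \<le> (28 + 7 * c + 2 * L) * \<delta>\<^sup>2"
  proof -
    have e: "(16 + 7 * c) * \<delta>\<^sup>2 = 16 * \<delta>\<^sup>2 + 7 * (c * \<delta>\<^sup>2)"
      "(28 + 7 * c + 2 * L) * \<delta>\<^sup>2 = 28 * \<delta>\<^sup>2 + 7 * (c * \<delta>\<^sup>2) + 2 * (L * \<delta>\<^sup>2)"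
      by (simp_all add: algebra_simps)
    define X Y Z where "X = \<delta> * m" and "Y = \<delta>\<^sup>2" and "Z = c * \<delta>\<^sup>2"
    have "J - 2 * X \<le> 16 * Y + 7 * Z" "2 * X - J \<le> 16 * Y + 7 * Z"
      using front_width[folded J_def, unfolded e] by (auto simp: X_def Y_def Z_def abs_le_iff algebra_simps)
    moreover have "2 * I - (m\<^sup>2 - J) \<le> 12 * Y" "m\<^sup>2 - J - 2 * I \<le> 12 * Y"
      using I d3_le(1) unfolding Y_def abs_le_iff by argo+
    ultimately have "m\<^sup>2 - 2 * X - 1 \<le> 28 * Y + 7 * Z + 2 * (L * Y)" "- (m\<^sup>2 - 2 * X - 1) \<le> 28 * Y + 7 * Z + 2 * (L * Y)"
      using T one unfolding Y_def[symmetric] by argo+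
    then show ?thesis
      unfolding e by (auto simp: X_def Y_def Z_def abs_le_iff algebra_simps)
  qed
  then have "\<bar>m\<^sup>2 - 2 * \<delta> * m - 1 + \<delta>\<^sup>2\<bar> \<le> (28 + 7 * c + 2 * L) * \<delta>\<^sup>2 + \<delta>\<^sup>2"
    by (intro order_trans[OF abs_triangle_ineq] add_mono) simp_all
  moreover have "(m - \<delta> - 1) * (m - \<delta> + 1) = m\<^sup>2 - 2 * \<delta> * m - 1 + \<delta>\<^sup>2"
    by (simp add: power2_eq_square algebra_simps)
  moreover have "(28 + 7 * c + 2 * L) * \<delta>\<^sup>2 + \<delta>\<^sup>2 = amp_const L c * \<delta>\<^sup>2"
    by (simp add: amp_const_def algebra_simps)
  ultimately have main: "\<bar>(m - \<delta> - 1) * (m - \<delta> + 1)\<bar> \<le> amp_const L c * \<delta>\<^sup>2"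
    by simp
  have "\<bar>m - 1 - \<delta>\<bar> = \<bar>m - \<delta> - 1\<bar> * 1"
    by (simp add: diff_diff_eq add.commute)
  also have "\<dots> \<le> \<bar>m - \<delta> - 1\<bar> * \<bar>m - \<delta> + 1\<bar>"
    using m_bounds \<delta> by (intro mult_left_mono) auto
  also have "\<dots> = \<bar>(m - \<delta> - 1) * (m - \<delta> + 1)\<bar>"
    by (simp only: abs_mult)
  finally show ?thesis
    using main by (rule order_trans)
qed

section \<open>Comparison with the explicit front\<close>

lemma qbar_deriv: "(qbar has_real_derivative ((1 + \<delta>)\<^sup>2 - (qbar s)\<^sup>2) / (2 * \<delta> * (1 + \<delta>))) (at s within S)"
proof -
  have "cosh (s / (2 * \<delta>)) \<noteq> 0"
    using cosh_real_pos[of "s / (2 * \<delta>)"] by linarith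
  then have "(qbar has_real_derivative (1 + \<delta>) * ((1 - (tanh (s / (2 * \<delta>)))\<^sup>2) * (1 / (2 * \<delta>)))) (at s within S)"
    unfolding qbar_def[abs_def] using \<delta> by (auto intro!: derivative_eq_intros)
  moreover have "(1 + \<delta>) * ((1 - (tanh (s / (2 * \<delta>)))\<^sup>2) * (1 / (2 * \<delta>))) = ((1 + \<delta>)\<^sup>2 - (qbar s)\<^sup>2) / (2 * \<delta> * (1 + \<delta>))"
  proof -
    have "(1 + \<delta>)\<^sup>2 - (qbar s)\<^sup>2 = (1 + \<delta>) * ((1 + \<delta>) * (1 - (tanh (s / (2 * \<delta>)))\<^sup>2))"
      by (simp add: qbar_def power2_eq_square algebra_simps)
    then show ?thesis
      using \<delta> by simp
  qed
  ultimately show ?thesis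
    by simp
qed

lemma qbar_cont: "continuous_on S qbar"
  using qbar_deriv by (rule DERIV_continuous_on)

lemma qbar_bounds:
  assumes "0 \<le> s"
  shows "0 \<le> qbar s" "qbar s \<le> 1 + \<delta>"
proof -
  have "0 \<le> tanh (s / (2 * \<delta>))" "tanh (s / (2 * \<delta>)) \<le> 1"
    using assms \<delta> tanh_real_lt_1[of "s / (2 * \<delta>)"] by auto
  then show "0 \<le> qbar s" "qbar s \<le> 1 + \<delta>"
    using \<delta> by (auto simp: qbar_def intro: mult_left_le)
qed

lemma consts_nonneg: "0 \<le> amp_const L c" "0 \<le> front_const L c"
  using L c by (auto simp: amp_const_def front_const_def)

lemma tanh_half: "1/4 \<le> tanh (1/2 :: real)" "tanh (1/2 :: real) \<le> 1/2"
proof -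
  have e: "2 \<le> exp (1::real)" "exp (1::real) \<le> 3"
    using exp_ge_add_one_self[of 1] exp_le by auto
  have "tanh (1/2 :: real) = (1 - 1 / exp 1) / (1 + 1 / exp 1)"
    by (simp add: tanh_real_altdef exp_minus inverse_eq_divide)
  also have "\<dots> = (exp 1 - 1) / (exp 1 + 1)"
    by (simp add: divide_simps)
  finally have "tanh (1/2 :: real) = (exp 1 - 1) / (exp 1 + 1)" .
  moreover have "1/4 \<le> (x - 1) / (x + 1) \<and> (x - 1) / (x + 1) \<le> 1/2" if "2 \<le> x" "x \<le> 3" for x :: real
    using that by (simp add: divide_simps)
  ultimately show "1/4 \<le> tanh (1/2 :: real)" "tanh (1/2 :: real) \<le> 1/2"
    using e by auto
qed

text \<open>Subtracting the Riccati equations of \<open>q\<close> and \<open>qbar\<close> gives a linear equation with the rate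
  \<open>(q + qbar) / (2 \<delta>)\<close>. Its source has three parts: the error in \<open>riccati\<close>, the mismatch \<open>O(\<delta>\<^sup>2)\<close> of the
  squared amplitudes divided by \<open>2 \<delta>\<close>, and the term \<open>\<delta> qbar'\<close>, which is due to \<open>qbar\<close> having the time
  scale \<open>2 \<delta>\<close> rather than \<open>2 \<delta> / (1 + \<delta>)\<close>. Each part has an integral of order \<open>\<delta>\<close>.\<close>

lemma front_comparison:
  assumes "0 \<le> s" "s \<le> 1/2"
  shows "\<bar>q s - qbar s\<bar> + integral {0..s} (\<lambda>t. (q t + qbar t) / (2 * \<delta>) * \<bar>q t - qbar t\<bar>) \<le> front_const L c * \<delta>"
proof -
  define n where "n = 1 + \<delta>"
  define D where "D = amp_const L c"
  have n: "1 \<le> n" "n \<le> 3/2"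
    using \<delta> by (auto simp: n_def)
  have "D \<ge> 0"
    using consts_nonneg by (simp add: D_def)
  let ?r = "\<lambda>x. (n\<^sup>2 - (qbar x)\<^sup>2) / (2 * \<delta> * n)"
  let ?g = "\<lambda>x. q' x - ?r x + (q x + qbar x) / (2 * \<delta>) * (q x - qbar x)"
  let ?\<Gamma> = "\<lambda>x. c * \<delta> / 2 * q x + ((14 + 2 * c) * \<delta>\<^sup>2 + 4 * D * \<delta>) * x + \<delta> * qbar x"
  have sub: "{0..s} \<subseteq> {0..1/2}"
    using assms by auto
  have "\<bar>q s - qbar s\<bar> + integral {0..s} (\<lambda>t. (q t + qbar t) / (2 * \<delta>) * \<bar>q t - qbar t\<bar>) \<le> ?\<Gamma> s - ?\<Gamma> 0"
  proof (rule damped_linear_ode_bound[where g = ?g])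
    fix x assume x: "x \<in> {0..s}"
    then have x': "0 \<le> x" "x \<le> 1/2"
      using assms by auto
    have "((\<lambda>s. q s - qbar s) has_real_derivative q' x - ?r x) (at x within {0..s})"
      unfolding n_def by (intro DERIV_diff q_deriv qbar_deriv)
    then show "((\<lambda>s. q s - qbar s) has_real_derivative ?g x - (q x + qbar x) / (2 * \<delta>) * (q x - qbar x)) (at x within {0..s})"
      by simp
    show "(?\<Gamma> has_real_derivative c * \<delta> / 2 * q' x + ((14 + 2 * c) * \<delta>\<^sup>2 + 4 * D * \<delta>) * 1 + \<delta> * ?r x) (at x within {0..s})"
      unfolding n_def by (intro DERIV_add DERIV_cmult q_deriv qbar_deriv DERIV_ident)
    show "0 \<le> (q x + qbar x) / (2 * \<delta>)"
      using q_bounds[OF x'] qbar_bounds[OF x'(1)] \<delta> by simp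
    have 1: "?g x = (q' x - (m\<^sup>2 - (q x)\<^sup>2) / (2 * \<delta>)) + (m\<^sup>2 - n\<^sup>2) / (2 * \<delta>) + \<delta> * ?r x"
    proof -
      have "n * ?r x = (n\<^sup>2 - (qbar x)\<^sup>2) / (2 * \<delta>)"
        using \<delta> n by simp
      moreover have "\<delta> * ?r x = n * ?r x - ?r x"
        unfolding n_def distrib_right by simp
      moreover have "(q x + qbar x) / (2 * \<delta>) * (q x - qbar x) = ((q x)\<^sup>2 - (qbar x)\<^sup>2) / (2 * \<delta>)"
        by (simp add: power2_eq_square algebra_simps)
      ultimately show ?thesis
        unfolding diff_divide_distrib[where c = "2 * \<delta>"] by linarith
    qed
    have 2: "\<bar>(m\<^sup>2 - n\<^sup>2) / (2 * \<delta>)\<bar> \<le> 4 * D * \<delta>"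
    proof -
      have "(m\<^sup>2 - n\<^sup>2) = (m - n) * (m + n)"
        by (simp add: power2_eq_square algebra_simps)
      then have "\<bar>m\<^sup>2 - n\<^sup>2\<bar> = \<bar>m - n\<bar> * (m + n)"
        using m_bounds n by (simp add: abs_mult)
      also have "\<dots> \<le> (D * \<delta>\<^sup>2) * 8"
        using m_bounds n amplitude \<open>D \<ge> 0\<close> by (intro mult_mono) (auto simp: n_def D_def algebra_simps)
      finally have "\<bar>m\<^sup>2 - n\<^sup>2\<bar> / (2 * \<delta>) \<le> (D * \<delta>\<^sup>2) * 8 / (2 * \<delta>)"
        using \<delta> by (intro divide_right_mono) auto
      then show ?thesis
        using \<delta> by (simp add: power2_eq_square)
    qed
    have 3: "0 \<le> \<delta> * ?r x"
      using qbar_bounds[OF x'(1)] \<delta> n by (intro mult_nonneg_nonneg divide_nonneg_nonneg) (auto simp: n_def intro!: power_mono)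
    show "\<bar>?g x\<bar> \<le> c * \<delta> / 2 * q' x + ((14 + 2 * c) * \<delta>\<^sup>2 + 4 * D * \<delta>) * 1 + \<delta> * ?r x"
    proof -
      have "\<bar>A + B + C\<bar> \<le> a + b + C" if "\<bar>A\<bar> \<le> a" "\<bar>B\<bar> \<le> b" "0 \<le> C" for A B C a b :: real
        using that by linarith
      from this[OF riccati[OF x'] 2 3] show ?thesis
        unfolding 1 by (simp only: mult_1_right add.assoc)
    qed
  next
    show "q 0 - qbar 0 = 0"
      by (simp add: q_0 qbar_def)
  qed (use assms \<delta> in \<open>auto intro!: continuous_intros q_cont qbar_cont\<close>)
  also have "\<dots> \<le> front_const L c * \<delta>"
  proof -
    have "c * \<delta> / 2 * q s \<le> c * \<delta> / 2 * 5"
      using c \<delta> q_bounds[OF assms] m_bounds by (intro mult_left_mono) auto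
    moreover have "((14 + 2 * c) * \<delta>\<^sup>2 + 4 * D * \<delta>) * s \<le> ((14 + 2 * c) * \<delta> + 4 * D * \<delta>) * (1/2)"
      using c \<delta> \<open>D \<ge> 0\<close> assms d3_le by (intro mult_mono add_mono) auto
    moreover have "\<delta> * qbar s \<le> \<delta> * 2"
      using \<delta> qbar_bounds[of s] assms by (intro mult_left_mono) auto
    moreover have "0 \<le> c * \<delta>"
      using c \<delta> by simp
    moreover have "?\<Gamma> 0 = 0"
      by (simp add: q_0 qbar_def)
    ultimately have "?\<Gamma> s - ?\<Gamma> 0 \<le> c * \<delta> / 2 * 5 + ((14 + 2 * c) * \<delta> + 4 * D * \<delta>) * (1/2) + \<delta> * 2"
      by linarith
    also have "\<dots> \<le> front_const L c * \<delta>"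
      using \<open>0 \<le> c * \<delta>\<close> \<delta> by (simp add: front_const_def D_def[symmetric] algebra_simps)
    finally show ?thesis .
  qed
  finally show ?thesis .
qed

lemma front_error_sup:
  assumes "0 \<le> s" "s \<le> 1/2"
  shows "\<bar>q s - qbar s\<bar> \<le> front_const L c * \<delta>"
proof -
  have "0 \<le> integral {0..s} (\<lambda>t. (q t + qbar t) / (2 * \<delta>) * \<bar>q t - qbar t\<bar>)"
  proof (intro integral_nonneg integrable_continuous_real continuous_intros q_cont qbar_cont)
    fix t assume "t \<in> {0..s}"
    then show "0 \<le> (q t + qbar t) / (2 * \<delta>) * \<bar>q t - qbar t\<bar>"
      using q_bounds[of t] qbar_bounds[of t] assms \<delta> by simp
  qed (use \<delta> in auto)
  then show ?thesis
    using front_comparison[OF assms] by linarith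
qed

text \<open>Outside \<open>[0, \<delta>]\<close> the damping rate is at least of order \<open>1/\<delta>\<close>, which gains a factor \<open>\<delta>\<close>.\<close>

lemma front_error_L1: "integral {0..1/2} (\<lambda>s. \<bar>q s - qbar s\<bar>) \<le> 9 * front_const L c * \<delta>\<^sup>2"
proof -
  let ?w = "\<lambda>s. \<bar>q s - qbar s\<bar>"
  let ?a = "\<lambda>t. (q t + qbar t) / (2 * \<delta>)"
  have cw: "continuous_on S ?w" for S
    by (intro continuous_intros q_cont qbar_cont)
  have ca: "continuous_on S (\<lambda>t. ?a t * ?w t)" for S
    using \<delta> by (intro continuous_intros q_cont qbar_cont) auto
  have a_nonneg: "0 \<le> ?a t * ?w t" if "0 \<le> t" "t \<le> 1/2" for t
    using q_bounds[OF that] qbar_bounds[of t] that \<delta> by simp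
  have "integral {0..\<delta>} ?w \<le> integral {0..\<delta>} (\<lambda>_. front_const L c * \<delta>)"
    using \<delta> by (intro integral_le integrable_continuous_real cw continuous_intros front_error_sup) auto
  then have 1: "integral {0..\<delta>} ?w \<le> front_const L c * \<delta>\<^sup>2"
    using \<delta> by (simp add: power2_eq_square mult_ac)
  have "integral {\<delta>..1/2} ?w \<le> integral {\<delta>..1/2} (\<lambda>t. 8 * \<delta> * (?a t * ?w t))"
  proof (intro integral_le integrable_continuous_real cw continuous_intros ca)
    fix t assume "t \<in> {\<delta>..1/2}"
    then have t: "\<delta> \<le> t" "0 \<le> t" "t \<le> 1/2"
      using \<delta> by auto
    have "tanh (1/2) \<le> tanh (t / (2 * \<delta>))"
      using t \<delta> by (simp add: field_simps)
    then have "1/4 \<le> tanh (t / (2 * \<delta>))"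
      using tanh_half by linarith
    moreover have "tanh (t / (2 * \<delta>)) \<le> qbar t"
      using \<delta> t by (simp add: qbar_def algebra_simps)
    ultimately have "1/4 \<le> q t + qbar t"
      using q_bounds[OF t(2,3)] by linarith
    then have "1 * ?w t \<le> (8 * \<delta> * ?a t) * ?w t"
      using \<delta> by (intro mult_right_mono) auto
    then show "?w t \<le> 8 * \<delta> * (?a t * ?w t)"
      by (simp only: mult.assoc mult_1_left)
  qed (use \<delta> q_cont qbar_cont in auto)
  also have "\<dots> = 8 * \<delta> * integral {\<delta>..1/2} (\<lambda>t. ?a t * ?w t)"
    by simp
  also have "\<dots> \<le> 8 * \<delta> * integral {0..1/2} (\<lambda>t. ?a t * ?w t)"
    using \<delta> a_nonneg
    by (intro mult_left_mono integral_subset_le integrable_continuous_real ca) auto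
  also have "\<dots> \<le> 8 * \<delta> * (front_const L c * \<delta>)"
  proof -
    have "0 \<le> ?w (1/2)"
      by simp
    then have "integral {0..1/2} (\<lambda>t. ?a t * ?w t) \<le> front_const L c * \<delta>"
      using front_comparison[of "1/2"] by linarith
    then show ?thesis
      using \<delta> by (intro mult_left_mono) auto
  qed
  finally have "integral {\<delta>..1/2} ?w \<le> 8 * front_const L c * \<delta>\<^sup>2"
    by (simp add: power2_eq_square mult_ac)
  moreover have "integral {0..\<delta>} ?w + integral {\<delta>..1/2} ?w = integral {0..1/2} ?w"
    using \<delta> by (intro Henstock_Kurzweil_Integration.integral_combine integrable_continuous_real cw) auto
  ultimately show ?thesis
    using 1 by simp
qed

lemma tanh_near_1:
  assumes "1/2 \<le> y"
  shows "0 \<le> 1 - tanh (y / (2 * \<delta>))" "1 - tanh (y / (2 * \<delta>)) \<le> \<delta>\<^sup>2"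
proof -
  show "0 \<le> 1 - tanh (y / (2 * \<delta>))"
    using tanh_real_lt_1[of "y / (2 * \<delta>)"] by simp
  have "1 - tanh (y / (2 * \<delta>)) \<le> 2 * exp (- 2 * (y / (2 * \<delta>)))"
    by (rule one_minus_tanh_le)
  also have "\<dots> \<le> 2 * exp (- 1 / (2 * \<delta>))"
    using assms \<delta> by (simp add: field_simps)
  finally show "1 - tanh (y / (2 * \<delta>)) \<le> \<delta>\<^sup>2"
    using exp_small by linarith
qed

lemma V_bar_front:
  assumes "0 \<le> s" "s \<le> 1/2"
  shows "\<bar>V_bar \<delta> (1/2 + s) - (1 + \<delta> - qbar s) / 2\<bar> \<le> \<delta>\<^sup>2"
    "\<bar>V_bar \<delta> (1/2 - s) - (1 + \<delta> + qbar s) / 2\<bar> \<le> \<delta>\<^sup>2"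
proof -
  have small: "\<bar>(1 + \<delta>) / 2 * (1 - tanh (y / (2 * \<delta>)))\<bar> \<le> \<delta>\<^sup>2" if "1/2 \<le> y" for y
  proof -
    have "\<bar>(1 + \<delta>) / 2 * (1 - tanh (y / (2 * \<delta>)))\<bar> = (1 + \<delta>) / 2 * (1 - tanh (y / (2 * \<delta>)))"
      using tanh_near_1[OF that] \<delta> by simp
    also have "\<dots> \<le> 1 * \<delta>\<^sup>2"
      using tanh_near_1[OF that] \<delta> by (intro mult_mono) auto
    finally show ?thesis
      by simp
  qed
  have 1: "V_bar \<delta> (1/2 + s) - (1 + \<delta> - qbar s) / 2 = - ((1 + \<delta>) / 2 * (1 - tanh ((1 + s) / (2 * \<delta>))))"
  proof -
    have "1/2 + s + 1/2 = 1 + s" "1/2 + s - 1/2 = s"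
      by auto
    then show ?thesis
      unfolding V_bar_tanh[OF \<delta>(1)] qbar_def by (simp only:) (simp add: diff_divide_distrib add_divide_distrib algebra_simps)
  qed
  have 2: "V_bar \<delta> (1/2 - s) - (1 + \<delta> + qbar s) / 2 = - ((1 + \<delta>) / 2 * (1 - tanh ((1 - s) / (2 * \<delta>))))"
  proof -
    have "1/2 - s + 1/2 = 1 - s" "1/2 - s - 1/2 = - s" "tanh (- s / (2 * \<delta>)) = - tanh (s / (2 * \<delta>))"
      by auto
    moreover have "(1 + \<delta>) / 2 * (t - - u) - (1 + \<delta> + (1 + \<delta>) * u) / 2 = - ((1 + \<delta>) / 2 * (1 - t))" for t u
      by (simp add: field_simps)
    ultimately show ?thesis
      unfolding V_bar_tanh[OF \<delta>(1)] qbar_def by (simp only:)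
  qed
  show "\<bar>V_bar \<delta> (1/2 + s) - (1 + \<delta> - qbar s) / 2\<bar> \<le> \<delta>\<^sup>2"
    unfolding 1 abs_minus_cancel using assms by (intro small) auto
  show "\<bar>V_bar \<delta> (1/2 - s) - (1 + \<delta> + qbar s) / 2\<bar> \<le> \<delta>\<^sup>2"
    unfolding 2 abs_minus_cancel using assms by (intro small) auto
qed

lemma V_bar_nonneg: "0 \<le> V_bar \<delta> x"
  using \<delta> by (simp add: V_bar_def)

lemma V_bar_tail:
  assumes "1 \<le> \<bar>x\<bar>"
  shows "V_bar \<delta> x \<le> \<delta>\<^sup>2"
proof -
  have "V_bar \<delta> x = V_bar \<delta> \<bar>x\<bar>"
    by (simp add: abs_if V_bar_even)
  also have "\<dots> \<le> (1 + \<delta>) / 2 * (1 - tanh ((\<bar>x\<bar> - 1/2) / (2 * \<delta>)))"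
    unfolding V_bar_tanh[OF \<delta>(1)] using \<delta> tanh_real_lt_1[of "(\<bar>x\<bar> + 1/2) / (2 * \<delta>)"]
    by (intro mult_left_mono) auto
  also have "\<dots> \<le> 1 * \<delta>\<^sup>2"
    using \<delta> assms tanh_near_1[of "\<bar>x\<bar> - 1/2"] by (intro mult_mono) auto
  finally show ?thesis
    by simp
qed

lemma V_error_front:
  assumes "0 \<le> s" "s \<le> 1/2"
  shows "\<bar>V (1/2 + s) - V_bar \<delta> (1/2 + s)\<bar> \<le> (amp_const L c + 2) * \<delta>\<^sup>2 + \<bar>q s - qbar s\<bar>"
    "\<bar>V (1/2 - s) - V_bar \<delta> (1/2 - s)\<bar> \<le> (amp_const L c + 2) * \<delta>\<^sup>2 + \<bar>q s - qbar s\<bar>"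
proof -
  have *: "\<bar>x - y\<bar> \<le> (amp_const L c + 2) * \<delta>\<^sup>2 + \<bar>q s - qbar s\<bar>"
    if x: "\<bar>x - a\<bar> \<le> \<delta> ^ 3" and y: "\<bar>y - b\<bar> \<le> \<delta>\<^sup>2"
      and ab: "a - b = (m - 1 - \<delta>) / 2 - (q s - qbar s) / 2 \<or> a - b = (m - 1 - \<delta>) / 2 + (q s - qbar s) / 2"
    for x y a b
  proof -
    have "\<bar>x - y\<bar> \<le> \<bar>x - a\<bar> + \<bar>y - b\<bar> + \<bar>a - b\<bar>"
      by linarith
    also have "\<dots> \<le> \<delta> ^ 3 + \<delta>\<^sup>2 + (\<bar>m - 1 - \<delta>\<bar> + \<bar>q s - qbar s\<bar>)"
    proof -
      have "\<bar>u / 2 - v / 2\<bar> \<le> \<bar>u\<bar> + \<bar>v\<bar>" "\<bar>u / 2 + v / 2\<bar> \<le> \<bar>u\<bar> + \<bar>v\<bar>" for u v :: real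
        by linarith+
      then have "\<bar>a - b\<bar> \<le> \<bar>m - 1 - \<delta>\<bar> + \<bar>q s - qbar s\<bar>"
        using ab by metis
      then show ?thesis
        by (intro add_mono x y)
    qed
    also have "\<dots> \<le> \<delta>\<^sup>2 + \<delta>\<^sup>2 + (amp_const L c * \<delta>\<^sup>2 + \<bar>q s - qbar s\<bar>)"
      using d3_le amplitude by (intro add_mono) auto
    finally show ?thesis
      by (simp add: algebra_simps)
  qed
  show "\<bar>V (1/2 + s) - V_bar \<delta> (1/2 + s)\<bar> \<le> (amp_const L c + 2) * \<delta>\<^sup>2 + \<bar>q s - qbar s\<bar>"
    by (rule *[OF V_front(1)[OF assms] V_bar_front(1)[OF assms]]) (simp add: field_simps)
  show "\<bar>V (1/2 - s) - V_bar \<delta> (1/2 - s)\<bar> \<le> (amp_const L c + 2) * \<delta>\<^sup>2 + \<bar>q s - qbar s\<bar>"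
    by (rule *[OF V_front(2)[OF assms] V_bar_front(2)[OF assms]]) (simp add: field_simps)
qed

lemma V_error_tail:
  assumes "1 \<le> x" "x \<le> L"
  shows "\<bar>V x - V_bar \<delta> x\<bar> \<le> \<delta>\<^sup>2"
  using V_tail[OF assms] V_nonneg[of x] V_bar_nonneg[of x] V_bar_tail[of x] assms d3_le
  unfolding abs_le_iff by simp

lemma by_region:
  assumes "\<bar>x\<bar> \<le> L" and even: "P (- x) \<Longrightarrow> P x"
    and "\<And>s. 0 \<le> s \<Longrightarrow> s \<le> 1/2 \<Longrightarrow> \<bar>x\<bar> = 1/2 + s \<Longrightarrow> P (1/2 + s)"
    and "\<And>s. 0 \<le> s \<Longrightarrow> s \<le> 1/2 \<Longrightarrow> \<bar>x\<bar> = 1/2 - s \<Longrightarrow> P (1/2 - s)"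
    and "1 \<le> \<bar>x\<bar> \<Longrightarrow> P \<bar>x\<bar>"
  shows "P x"
proof -
  have "P \<bar>x\<bar>"
  proof (cases "1 \<le> \<bar>x\<bar>")
    case False
    then show ?thesis
      using assms(3)[of "\<bar>x\<bar> - 1/2"] assms(4)[of "1/2 - \<bar>x\<bar>"] by (cases "1/2 \<le> \<bar>x\<bar>") auto
  qed (use assms in auto)
  then show ?thesis
    using even by (auto simp: abs_if split: if_splits)
qed

lemma V_error_sup:
  assumes x: "\<bar>x\<bar> \<le> L"
  shows "\<bar>V x - V_bar \<delta> x\<bar> \<le> wave_const L c * \<delta>"
proof -
  have le: "(amp_const L c + 2) * \<delta>\<^sup>2 + front_const L c * \<delta> \<le> wave_const L c * \<delta>"
  proof -
    have "(amp_const L c + 2) * \<delta>\<^sup>2 \<le> (amp_const L c + 2) * \<delta>"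
      using consts_nonneg d3_le by (intro mult_left_mono) auto
    moreover have "0 \<le> amp_const L c * \<delta>" "0 \<le> front_const L c * \<delta>" "0 \<le> L * \<delta>"
      using consts_nonneg L \<delta> by auto
    ultimately show ?thesis
      unfolding wave_const_def distrib_right using \<delta> by linarith
  qed
  show ?thesis
  proof (rule by_region[OF x])
    assume "1 \<le> \<bar>x\<bar>"
    then have "\<bar>V \<bar>x\<bar> - V_bar \<delta> \<bar>x\<bar>\<bar> \<le> \<delta>\<^sup>2"
      using x by (intro V_error_tail)
    also have "\<dots> \<le> (amp_const L c + 2) * \<delta>\<^sup>2 + front_const L c * \<delta>"
      using consts_nonneg \<delta> by (simp add: algebra_simps)
    finally show "\<bar>V \<bar>x\<bar> - V_bar \<delta> \<bar>x\<bar>\<bar> \<le> wave_const L c * \<delta>"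
      using le by linarith
  next
    fix s :: real assume s: "0 \<le> s" "s \<le> 1/2"
    show "\<bar>V (1/2 + s) - V_bar \<delta> (1/2 + s)\<bar> \<le> wave_const L c * \<delta>"
      "\<bar>V (1/2 - s) - V_bar \<delta> (1/2 - s)\<bar> \<le> wave_const L c * \<delta>"
      using V_error_front[OF s] front_error_sup[OF s] le by linarith+
  qed (use V_even[OF x] V_bar_even[of \<delta> x] in simp)
qed

lemma V_error_cont: "continuous_on S (\<lambda>x. \<bar>V x - V_bar \<delta> x\<bar>)"
  by (intro continuous_intros V_cont continuous_on_V_bar \<delta>)

lemma V_error_L1: "integral {-L..L} (\<lambda>x. \<bar>V x - V_bar \<delta> x\<bar>) \<le> wave_const L c * \<delta>\<^sup>2"
proof -
  let ?e = "\<lambda>x. \<bar>V x - V_bar \<delta> x\<bar>"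
  have ce: "continuous_on S (\<lambda>s. ?e (1/2 - s) + ?e (1/2 + s))" for S
    by (intro continuous_intros continuous_on_compose2[OF V_cont[of UNIV]] continuous_on_compose2[OF continuous_on_V_bar[OF \<delta>(1), of UNIV]]) auto
  have "integral {0..1/2} (\<lambda>s. ?e (1/2 - s) + ?e (1/2 + s))
      \<le> integral {0..1/2} (\<lambda>s. 2 * (amp_const L c + 2) * \<delta>\<^sup>2 + 2 * \<bar>q s - qbar s\<bar>)"
  proof (intro integral_le integrable_continuous_real ce continuous_intros q_cont qbar_cont)
    fix s :: real assume "s \<in> {0..1/2}"
    then have "?e (1/2 - s) + ?e (1/2 + s) \<le> ((amp_const L c + 2) * \<delta>\<^sup>2 + \<bar>q s - qbar s\<bar>) + ((amp_const L c + 2) * \<delta>\<^sup>2 + \<bar>q s - qbar s\<bar>)"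
      by (intro add_mono V_error_front) auto
    then show "?e (1/2 - s) + ?e (1/2 + s) \<le> 2 * (amp_const L c + 2) * \<delta>\<^sup>2 + 2 * \<bar>q s - qbar s\<bar>"
      by (simp only: mult_2 distrib_right add_ac)
  qed
  also have "\<dots> = (amp_const L c + 2) * \<delta>\<^sup>2 + 2 * integral {0..1/2} (\<lambda>s. \<bar>q s - qbar s\<bar>)"
    by (subst integral_add) (auto intro!: integrable_continuous_real continuous_intros q_cont qbar_cont)
  also have "\<dots> \<le> (amp_const L c + 2) * \<delta>\<^sup>2 + 18 * front_const L c * \<delta>\<^sup>2"
    using front_error_L1 by simp
  finally have 1: "integral {0..1/2} (\<lambda>s. ?e (1/2 - s) + ?e (1/2 + s)) \<le> (amp_const L c + 2) * \<delta>\<^sup>2 + 18 * front_const L c * \<delta>\<^sup>2" .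
  have "integral {1..L} ?e \<le> integral {1..L} (\<lambda>_. \<delta>\<^sup>2)"
    by (intro integral_le integrable_continuous_real V_error_cont continuous_intros V_error_tail) auto
  also have "\<dots> \<le> L * \<delta>\<^sup>2"
    using L by (simp add: mult_right_mono)
  finally have 2: "integral {1..L} ?e \<le> L * \<delta>\<^sup>2" .
  have "integral {-L..L} ?e = 2 * (integral {0..1/2} (\<lambda>s. ?e (1/2 - s) + ?e (1/2 + s)) + integral {1..L} ?e)"
    by (rule integral_fold_fronts) (auto simp: V_even V_bar_even intro: V_error_cont)
  also have "\<dots> \<le> 2 * (((amp_const L c + 2) * \<delta>\<^sup>2 + 18 * front_const L c * \<delta>\<^sup>2) + L * \<delta>\<^sup>2)"
    using 1 2 by (intro mult_left_mono add_mono) auto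
  also have "\<dots> = wave_const L c * \<delta>\<^sup>2"
    by (simp add: wave_const_def algebra_simps)
  finally show ?thesis .
qed

end

section \<open>The limit profiles\<close>

lemma V0_eq:
  assumes "2 < L" "\<bar>x\<bar> \<le> L + 1/2"
  shows "V0 L x = indicator {-1/2..1/2} x"
proof -
  have per: "V0 L (y + 2 * L) = V0 L y" for y
    using periodic_V0[of L] by (simp add: periodic_def)
  consider "\<bar>x\<bar> \<le> L" | "L < x" | "x < - L"
    by linarith
  then show ?thesis
  proof cases
    case 1
    then show ?thesis
      using assms by (intro V0_on_period) auto
  next
    case 2
    have "V0 L x = V0 L (x - 2 * L)"
      using per[of "x - 2 * L"] by simp
    also have "\<dots> = indicator {-1/2..1/2} (x - 2 * L)"
      using assms 2 by (intro V0_on_period) auto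
    finally show ?thesis
      using assms 2 by (auto simp: indicator_def)
  next
    case 3
    have "V0 L x = V0 L (x + 2 * L)"
      using per[of x] by simp
    also have "\<dots> = indicator {-1/2..1/2} (x + 2 * L)"
      using assms 3 by (intro V0_on_period) auto
    finally show ?thesis
      using assms 3 by (auto simp: indicator_def)
  qed
qed

lemma R0_eq:
  assumes "2 < L" "\<bar>x\<bar> \<le> L"
  shows "R0 L x = max 0 (1 - \<bar>x\<bar>)"
proof -
  let ?S = "{x - 1/2..x + 1/2}"
  have "R0 L x = (\<integral>t. V0 L t \<partial>lebesgue_on ?S)"
    by (simp add: R0_def avg_def)
  also have "\<dots> = (\<integral>t. indicator {-1/2..1/2} t \<partial>lebesgue_on ?S)"
    by (rule Bochner_Integration.integral_cong[OF refl], rule V0_eq) (use assms in \<open>auto simp: abs_le_iff\<close>)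
  also have "\<dots> = measure (lebesgue_on ?S) ({-1/2..1/2} \<inter> ?S)"
    by simp
  also have "\<dots> = measure lebesgue ({-1/2..1/2} \<inter> ?S)"
    by (rule measure_restrict_space) auto
  also have "{-1/2..1/2} \<inter> ?S = {max (-1/2) (x - 1/2)..min (1/2) (x + 1/2)}"
    by auto
  also have "measure lebesgue \<dots> = max 0 (1 - \<bar>x\<bar>)"
    by (auto simp: max_def min_def abs_if)
  finally show ?thesis .
qed

lemma V0_measurable: "V0 L \<in> borel_measurable (lebesgue_on S)"
proof -
  have "V0 L \<in> borel_measurable borel"
    unfolding V0_def by (rule borel_measurable_indicator) (auto intro!: sets.countable_UN')
  then show ?thesis
    by (intro measurable_restrict_space1 measurable_completion) simp
qed

lemma continuous_on_UNIV_measurable: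
  fixes f :: "real \<Rightarrow> real"
  assumes "continuous_on UNIV f"
  shows "f \<in> borel_measurable (lebesgue_on S)"
  using borel_measurable_continuous_onI[OF assms]
  by (intro measurable_restrict_space1 measurable_completion) simp

lemma R0_measurable:
  assumes "2 < L"
  shows "R0 L \<in> borel_measurable (lebesgue_on {-L..L})"
proof -
  have "(\<lambda>x. max 0 (1 - \<bar>x\<bar>)) \<in> borel_measurable (lebesgue_on {-L..L})"
    by (intro continuous_on_UNIV_measurable continuous_intros)
  then show ?thesis
    using assms by (subst measurable_cong[where g = "\<lambda>x. max 0 (1 - \<bar>x\<bar>)"]) (auto intro!: R0_eq)
qed

lemma nn_integral_le_integral:
  fixes f D :: "real \<Rightarrow> real"
  assumes D: "continuous_on {-L..L} D" and le: "\<And>x. \<bar>x\<bar> \<le> L \<Longrightarrow> \<bar>f x\<bar> \<le> D x"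
  shows "(\<integral>\<^sup>+x. ennreal \<bar>f x\<bar> \<partial>lebesgue_on {-L..L}) \<le> ennreal (integral {-L..L} D)"
proof -
  have int: "integrable (lebesgue_on {-L..L}) D"
    by (rule continuous_imp_integrable_real[OF D])
  have "(\<integral>\<^sup>+x. ennreal \<bar>f x\<bar> \<partial>lebesgue_on {-L..L}) \<le> (\<integral>\<^sup>+x. ennreal (D x) \<partial>lebesgue_on {-L..L})"
    using le by (intro nn_integral_mono ennreal_leI) (auto simp: abs_le_iff)
  also have "\<dots> = ennreal (\<integral>x. D x \<partial>lebesgue_on {-L..L})"
  proof (rule nn_integral_eq_integral[OF int], rule AE_I2)
    fix x assume "x \<in> space (lebesgue_on {-L..L})"
    then have "\<bar>f x\<bar> \<le> D x"
      using le[of x] by auto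
    then show "0 \<le> D x"
      by linarith
  qed
  also have "(\<integral>x. D x \<partial>lebesgue_on {-L..L}) = integral {-L..L} D"
    by (rule lebesgue_integral_eq_integral[OF int]) simp
  finally show ?thesis .
qed

lemma Lp_norm_infinity_pointwise:
  assumes "0 < L" and norm: "Lp_norm L \<infinity> f < ennreal e" and "0 < e"
    and g: "continuous_on {-L..L} g" and fg: "\<And>x. \<bar>x\<bar> \<le> L \<Longrightarrow> f x = g x" and x: "\<bar>x\<bar> \<le> L"
  shows "\<bar>f x\<bar> \<le> e"
proof -
  have "AE x in lebesgue_on {-L..L}. ennreal \<bar>f x\<bar> \<le> esssup (lebesgue_on {-L..L}) (\<lambda>x. ennreal \<bar>f x\<bar>)"
    by (rule esssup_AE)
  then have AE: "AE x in lebesgue_on {-L..L}. \<bar>f x\<bar> \<le> e"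
  proof eventually_elim
    case (elim x)
    then have "ennreal \<bar>f x\<bar> \<le> ennreal e"
      using norm by (simp add: Lp_norm_def)
    then show ?case
      using \<open>0 < e\<close> by (simp add: ennreal_le_iff)
  qed
  have "{x \<in> {-L..L}. \<bar>f x\<bar> \<le> e} = {x \<in> {-L..L}. \<bar>g x\<bar> \<le> e}"
    using fg by (auto simp: abs_le_iff)
  moreover have "closed {x \<in> {-L..L}. \<bar>g x\<bar> \<le> e}"
  proof -
    have "closed ({-L..L} \<inter> (\<lambda>x. \<bar>g x\<bar>) -` {..e})"
      by (intro continuous_closed_preimage continuous_intros g)
    moreover have "{-L..L} \<inter> (\<lambda>x. \<bar>g x\<bar>) -` {..e} = {x \<in> {-L..L}. \<bar>g x\<bar> \<le> e}"
      by auto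
    ultimately show ?thesis
      by simp
  qed
  ultimately have closed: "closed {x \<in> {-L..L}. \<bar>f x\<bar> \<le> e}"
    by (simp only:)
  have "x \<in> {-L..L}" "-L < L"
    using x \<open>0 < L\<close> by (auto simp: abs_le_iff)
  then show ?thesis
    using AE_lebesgue_on_closed[OF _ AE closed] by blast
qed

lemma Lp_norm_2_eq_1:
  assumes V: "continuous_on UNIV V" and norm: "Lp_norm L 2 V = 1"
  shows "integral {-L..L} (\<lambda>x. (V x)\<^sup>2) = 1"
proof -
  let ?J = "integral {-L..L} (\<lambda>x. (V x)\<^sup>2)"
  have c: "continuous_on {-L..L} (\<lambda>x. (V x)\<^sup>2)"
    by (intro continuous_intros continuous_on_subset[OF V]) auto
  have J: "0 \<le> ?J"
    by (intro integral_nonneg integrable_continuous_real c) auto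
  have "(\<integral>\<^sup>+ x. ennreal (\<bar>V x\<bar> powr enn2real 2) \<partial>lebesgue_on {-L..L}) = (\<integral>\<^sup>+ x. ennreal ((V x)\<^sup>2) \<partial>lebesgue_on {-L..L})"
    by (intro nn_integral_cong) simp
  also have "\<dots> = ennreal (\<integral>x. (V x)\<^sup>2 \<partial>lebesgue_on {-L..L})"
    by (rule nn_integral_eq_integral[OF continuous_imp_integrable_real[OF c]]) auto
  also have "(\<integral>x. (V x)\<^sup>2 \<partial>lebesgue_on {-L..L}) = ?J"
    by (rule lebesgue_integral_eq_integral[OF continuous_imp_integrable_real[OF c]]) simp
  finally have "ennreal (?J powr (1/2)) = 1"
    using norm J by (simp add: Lp_norm_def)
  then have "sqrt ?J = 1"
    using J by (simp add: powr_half_sqrt)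
  then show ?thesis
    by simp
qed

section \<open>Distance to the limit profiles\<close>

definition limit_const :: "real \<Rightarrow> real \<Rightarrow> real" where
  "limit_const L c = wave_const L c + 10 + 8 * L"

context concentrated_wave
begin

lemma wave_const_ge: "4 \<le> wave_const L c"
  using consts_nonneg L unfolding wave_const_def by simp

lemma T_bounds: "0 \<le> s \<Longrightarrow> 0 \<le> 1 - tanh (s / (2 * \<delta>))" "0 \<le> s \<Longrightarrow> 1 - tanh (s / (2 * \<delta>)) \<le> 1"
  using \<delta> tanh_real_lt_1[of "s / (2 * \<delta>)"] by auto

lemma V_bar_near_V0:
  assumes x: "\<bar>x\<bar> \<le> L"
  shows "\<bar>V_bar \<delta> x - V0 L x\<bar> \<le> (1 - tanh (\<bar>\<bar>x\<bar> - 1/2\<bar> / (2 * \<delta>))) + 2 * \<delta>"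
proof -
  have V0: "V0 L x = indicator {-1/2..1/2} x"
    using L x by (intro V0_eq) auto
  have half: "\<bar>(1 + \<delta> - qbar s) / 2\<bar> \<le> (1 - tanh (s / (2 * \<delta>)))" "\<bar>(1 + \<delta> + qbar s) / 2 - 1\<bar> \<le> (1 - tanh (s / (2 * \<delta>))) + \<delta>"
    if "0 \<le> s" for s
  proof -
    define t where "t = 1 - tanh (s / (2 * \<delta>))"
    have "0 \<le> t" "t \<le> 1"
      using T_bounds[OF that] by (auto simp: t_def)
    have "qbar s = (1 + \<delta>) * (1 - t)"
      by (simp add: qbar_def t_def)
    then have e: "(1 + \<delta> - qbar s) / 2 = (1 + \<delta>) / 2 * t" "(1 + \<delta> + qbar s) / 2 - 1 = \<delta> - (1 + \<delta>) / 2 * t"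
      by (auto simp: field_simps)
    have "0 \<le> (1 + \<delta>) / 2 * t" "(1 + \<delta>) / 2 * t \<le> 1 * t"
      using \<open>0 \<le> t\<close> \<delta> by (intro mult_nonneg_nonneg mult_right_mono; simp)+
    then show "\<bar>(1 + \<delta> - qbar s) / 2\<bar> \<le> (1 - tanh (s / (2 * \<delta>)))" "\<bar>(1 + \<delta> + qbar s) / 2 - 1\<bar> \<le> (1 - tanh (s / (2 * \<delta>))) + \<delta>"
      unfolding e t_def[symmetric] using \<delta> by linarith+
  qed
  show ?thesis
    unfolding V0
  proof (rule by_region[OF x, where P = "\<lambda>x. \<bar>V_bar \<delta> x - indicator {-1/2..1/2} x\<bar> \<le> (1 - tanh (\<bar>\<bar>x\<bar> - 1/2\<bar> / (2 * \<delta>))) + 2 * \<delta>"])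
    fix s :: real assume s: "0 \<le> s" "s \<le> 1/2"
    have "\<bar>V_bar \<delta> (1/2 - s) - 1\<bar> \<le> (1 - tanh (s / (2 * \<delta>))) + \<delta> + \<delta>\<^sup>2"
      using half(2)[OF s(1)] V_bar_front(2)[OF s] by linarith
    then show "\<bar>V_bar \<delta> (1/2 - s) - indicator {-1/2..1/2} (1/2 - s)\<bar> \<le> (1 - tanh (\<bar>\<bar>1/2 - s\<bar> - 1/2\<bar> / (2 * \<delta>))) + 2 * \<delta>"
      using s d3_le by simp
    show "\<bar>V_bar \<delta> (1/2 + s) - indicator {-1/2..1/2} (1/2 + s)\<bar> \<le> (1 - tanh (\<bar>\<bar>1/2 + s\<bar> - 1/2\<bar> / (2 * \<delta>))) + 2 * \<delta>"
    proof (cases "s = 0")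
      case True
      have "\<bar>V_bar \<delta> (1/2) - 1\<bar> \<le> 1 + \<delta> + \<delta>\<^sup>2"
      proof -
        have "\<bar>V_bar \<delta> (1/2) - (1 + \<delta>) / 2\<bar> \<le> \<delta>\<^sup>2"
          using V_bar_front(2)[of 0] by (simp add: qbar_def)
        moreover have "\<bar>(1 + \<delta>) / 2 - 1\<bar> \<le> 1 + \<delta>"
          using \<delta> by (simp add: abs_le_iff field_simps)
        ultimately show ?thesis
          by linarith
      qed
      then show ?thesis
        using True d3_le by simp
    next
      case False
      have "\<bar>V_bar \<delta> (1/2 + s)\<bar> \<le> (1 - tanh (s / (2 * \<delta>))) + \<delta>\<^sup>2"
        using half(1)[OF s(1)] V_bar_front(1)[OF s] by linarith
      then show ?thesis
        using s False d3_le \<delta> by simp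
    qed
  next
    assume "1 \<le> \<bar>x\<bar>"
    then have "V_bar \<delta> \<bar>x\<bar> \<le> \<delta>\<^sup>2"
      using V_bar_tail[of "\<bar>x\<bar>"] by simp
    then show "\<bar>V_bar \<delta> \<bar>x\<bar> - indicator {-1/2..1/2} \<bar>x\<bar>\<bar> \<le> (1 - tanh (\<bar>\<bar>\<bar>x\<bar>\<bar> - 1/2\<bar> / (2 * \<delta>))) + 2 * \<delta>"
      using \<open>1 \<le> \<bar>x\<bar>\<close> V_bar_nonneg[of "\<bar>x\<bar>"] T_bounds(1)[of "\<bar>\<bar>x\<bar> - 1/2\<bar>"] d3_le \<delta> by simp
  qed (auto simp: V_bar_even indicator_def)
qed

lemma front_mass: "integral {0..1/2} (\<lambda>s. 1 - tanh (s / (2 * \<delta>))) \<le> 2 * \<delta>"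
proof -
  have "((\<lambda>s. 2 * \<delta> * tanh (s / (2 * \<delta>))) has_real_derivative 1 - (tanh (s / (2 * \<delta>)))\<^sup>2) (at s within {0..1/2})" for s
    using \<delta> cosh_real_pos[of "s / (2 * \<delta>)"] by (auto intro!: derivative_eq_intros)
  then have I: "((\<lambda>s. 1 - (tanh (s / (2 * \<delta>)))\<^sup>2) has_integral 2 * \<delta> * tanh (1/2 / (2 * \<delta>)) - 2 * \<delta> * tanh (0 / (2 * \<delta>))) {0..1/2}"
    by (intro fundamental_theorem_of_calculus) (auto simp flip: has_real_derivative_iff_has_vector_derivative)
  have "integral {0..1/2} (\<lambda>s. 1 - tanh (s / (2 * \<delta>))) \<le> integral {0..1/2} (\<lambda>s. 1 - (tanh (s / (2 * \<delta>)))\<^sup>2)"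
  proof (rule integral_le)
    show "(\<lambda>s. 1 - tanh (s / (2 * \<delta>))) integrable_on {0..1/2}"
      using \<delta> cosh_real_pos by (intro integrable_continuous_real continuous_intros) (auto simp: less_imp_neq[THEN not_sym])
    show "(\<lambda>s. 1 - (tanh (s / (2 * \<delta>)))\<^sup>2) integrable_on {0..1/2}"
      using I by (rule has_integral_integrable)
    fix s :: real assume "s \<in> {0..1/2}"
    then have "0 \<le> tanh (s / (2 * \<delta>))" "tanh (s / (2 * \<delta>)) \<le> 1"
      using \<delta> tanh_real_lt_1[of "s / (2 * \<delta>)"] by auto
    then show "1 - tanh (s / (2 * \<delta>)) \<le> 1 - (tanh (s / (2 * \<delta>)))\<^sup>2"
      using power_decreasing[of 1 2 "tanh (s / (2 * \<delta>))"] by simp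
  qed
  also have "\<dots> = 2 * \<delta> * tanh (1/2 / (2 * \<delta>))"
    using integral_unique[OF I] by simp
  also have "\<dots> \<le> 2 * \<delta> * 1"
    using \<delta> tanh_real_lt_1[of "1/2 / (2 * \<delta>)"] by simp
  finally show ?thesis
    by simp
qed

text \<open>The jump of \<open>V0\<close> is dominated by a continuous function, for which the even folding of integrals is
  available.\<close>

lemma V_near_V0_L1: "(\<integral>\<^sup>+x. ennreal \<bar>V x - V0 L x\<bar> \<partial>lebesgue_on {-L..L}) \<le> ennreal (limit_const L c * \<delta>)"
proof -
  let ?t = "\<lambda>x. 1 - tanh (\<bar>\<bar>x\<bar> - 1/2\<bar> / (2 * \<delta>))"
  let ?D = "\<lambda>x. \<bar>V x - V_bar \<delta> x\<bar> + (?t x + 2 * \<delta>)"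
  have ct: "continuous_on S ?t" for S
    using \<delta> cosh_real_pos by (intro continuous_intros) (auto simp: less_imp_neq[THEN not_sym])
  have "(\<integral>\<^sup>+x. ennreal \<bar>V x - V0 L x\<bar> \<partial>lebesgue_on {-L..L}) \<le> ennreal (integral {-L..L} ?D)"
  proof (rule nn_integral_le_integral)
    show "continuous_on {-L..L} ?D"
      by (intro continuous_on_add V_error_cont ct continuous_on_const)
    show "\<bar>V x - V0 L x\<bar> \<le> ?D x" if "\<bar>x\<bar> \<le> L" for x
      using V_bar_near_V0[OF that] by linarith
  qed
  moreover have "integral {-L..L} ?D \<le> limit_const L c * \<delta>"
  proof -
    have "integral {-L..L} ?D = integral {-L..L} (\<lambda>x. \<bar>V x - V_bar \<delta> x\<bar>) + integral {-L..L} (\<lambda>x. ?t x + 2 * \<delta>)"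
      by (intro integral_add integrable_continuous_real V_error_cont continuous_on_add ct continuous_on_const)
    also have "integral {-L..L} (\<lambda>x. ?t x + 2 * \<delta>) = integral {-L..L} ?t + 4 * L * \<delta>"
      using L by (subst integral_add) (auto intro!: integrable_continuous_real ct)
    also have "integral {-L..L} ?t = 2 * (integral {0..1/2} (\<lambda>s. ?t (1/2 - s) + ?t (1/2 + s)) + integral {1..L} ?t)"
      by (rule integral_fold_fronts) (auto intro: ct)
    also have "integral {0..1/2} (\<lambda>s. ?t (1/2 - s) + ?t (1/2 + s)) = integral {0..1/2} (\<lambda>s. 2 * (1 - tanh (s / (2 * \<delta>))))"
      by (rule integral_cong) auto
    also have "\<dots> = 2 * integral {0..1/2} (\<lambda>s. 1 - tanh (s / (2 * \<delta>)))"
      by (rule integral_mult_right)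
    finally have eq: "integral {-L..L} ?D = integral {-L..L} (\<lambda>x. \<bar>V x - V_bar \<delta> x\<bar>)
        + (2 * (2 * integral {0..1/2} (\<lambda>s. 1 - tanh (s / (2 * \<delta>))) + integral {1..L} ?t) + 4 * L * \<delta>)" .
    have "integral {1..L} ?t \<le> integral {1..L} (\<lambda>_. \<delta>\<^sup>2)"
      by (intro integral_le integrable_continuous_real ct continuous_on_const tanh_near_1(2)) auto
    also have "\<dots> \<le> L * \<delta>"
      using L d3_le by (simp add: mult_mono)
    finally have t: "integral {1..L} ?t \<le> L * \<delta>" .
    have "wave_const L c * \<delta>\<^sup>2 \<le> wave_const L c * \<delta>"
      using wave_const_ge d3_le by (intro mult_left_mono) auto
    then have "integral {-L..L} ?D \<le> wave_const L c * \<delta> + (2 * (2 * (2 * \<delta>) + L * \<delta>) + 4 * L * \<delta>)"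
      unfolding eq using V_error_L1 front_mass t L by (intro add_mono mult_left_mono) auto
    also have "\<dots> \<le> limit_const L c * \<delta>"
      using L \<delta> by (simp add: limit_const_def algebra_simps)
    finally show ?thesis .
  qed
  ultimately show ?thesis
    by (meson ennreal_leI order_trans)
qed

lemma V_near_V0_sup:
  assumes "\<bar>x\<bar> \<le> L"
  shows "\<bar>V x - V0 L x\<bar> \<le> limit_const L c"
proof -
  have "\<bar>V x - V0 L x\<bar> \<le> 6"
    using V_nonneg[of x] V_le_m[OF assms] m_bounds by (auto simp: V0_def indicator_def)
  then show ?thesis
    using wave_const_ge L by (simp add: limit_const_def)
qed

text \<open>The front has the width \<open>\<delta>\<close>, so at distance \<open>\<delta>\<close> behind the jump it has not yet decayed:
  \<open>tanh (1/2) \<le> 1/2\<close> leaves the value \<open>1/4\<close> up to \<open>O(\<delta>)\<close>.\<close>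

lemma V_away_from_V0:
  assumes small: "(wave_const L c + 1) * \<delta> \<le> 1/8" and x: "x \<in> {1/2 + \<delta>/2..1/2 + \<delta>}"
  shows "1/8 \<le> \<bar>V x - V0 L x\<bar>"
proof -
  define s where "s = x - 1/2"
  have s: "0 < s" "s \<le> \<delta>" "s \<le> 1/2" "x = 1/2 + s"
    using x \<delta> by (auto simp: s_def)
  have "\<bar>x\<bar> \<le> L"
    using s L by simp
  have "V0 L x = 0"
    using V0_eq[of L x] L s by (simp add: indicator_def)
  have "tanh (s / (2 * \<delta>)) \<le> tanh (1/2)"
    using s \<delta> by (simp add: field_simps)
  then have "tanh (s / (2 * \<delta>)) \<le> 1/2"
    using tanh_half by linarith
  then have "qbar s \<le> (1 + \<delta>) * (1/2)"
    unfolding qbar_def using \<delta> by (intro mult_left_mono) auto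
  then have "1/4 \<le> (1 + \<delta> - qbar s) / 2"
    using \<delta> by simp
  then have "1/4 - \<delta>\<^sup>2 \<le> V_bar \<delta> x"
    using V_bar_front(1)[OF less_imp_le[OF s(1)] s(3)] unfolding s(4) abs_le_iff by linarith
  moreover have "\<bar>V x - V_bar \<delta> x\<bar> \<le> wave_const L c * \<delta>"
    by (rule V_error_sup) fact
  moreover have "wave_const L c * \<delta> + \<delta> \<le> 1/8"
    using small by (simp add: distrib_right)
  ultimately show ?thesis
    using \<open>V0 L x = 0\<close> d3_le by linarith
qed

text \<open>For \<open>\<bar>x\<bar> \<le> 3/2\<close> the averaging interval lies in \<open>[-L, L]\<close> and the \<open>L\<^sup>1\<close> bound applies. Farther out, where
  the interval may leave \<open>[-L, L]\<close>, both functions are small: \<open>R\<close> by monotonicity, \<open>R_bar\<close> as an average of the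
  tail of \<open>V_bar\<close>.\<close>

lemma R_error:
  assumes R: "R = avg V" and even: "\<And>x. \<bar>x\<bar> \<le> L \<Longrightarrow> R (- x) = R x"
    and decr: "\<And>x y. 0 \<le> x \<Longrightarrow> x \<le> y \<Longrightarrow> y \<le> L \<Longrightarrow> R y \<le> R x" and x: "\<bar>x\<bar> \<le> L"
  shows "\<bar>R x - R_bar \<delta> x\<bar> \<le> wave_const L c * \<delta>\<^sup>2"
proof (cases "\<bar>x\<bar> \<le> 3/2")
  case True
  let ?S = "{x - 1/2..x + 1/2}"
  have sub: "?S \<subseteq> {-L..L}"
    using True L by auto
  have Rx: "R x = integral ?S V" "R_bar \<delta> x = integral ?S (V_bar \<delta>)"
    unfolding R avg_V_bar[OF \<delta>(1), symmetric] by (auto intro!: avg_eq_integral V_cont continuous_on_V_bar \<delta>)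
  have "R x - R_bar \<delta> x = integral ?S (\<lambda>y. V y - V_bar \<delta> y)"
    unfolding Rx by (intro integral_diff[symmetric] integrable_continuous_real V_cont continuous_on_V_bar \<delta>)
  also have "norm \<dots> \<le> integral ?S (\<lambda>y. \<bar>V y - V_bar \<delta> y\<bar>)"
    by (intro integral_norm_bound_integral integrable_continuous_real V_error_cont continuous_on_diff V_cont continuous_on_V_bar \<delta>) auto
  also have "\<dots> \<le> integral {-L..L} (\<lambda>y. \<bar>V y - V_bar \<delta> y\<bar>)"
    by (intro integral_subset_le sub integrable_continuous_real V_error_cont) auto
  finally show ?thesis
    using V_error_L1 by simp
next
  case False
  let ?y = "\<bar>x\<bar>"
  have "R x = R ?y"
    using even[OF x] by (auto simp: abs_if)
  have "R_bar \<delta> x = R_bar \<delta> ?y"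
    by (simp add: R_bar_def abs_if)
  have "R ?y \<le> R (3/2)"
    using False x by (intro decr) auto
  also have "R (3/2) = integral {1..2} V"
    by (simp add: R avg_eq_integral V_cont)
  also have "\<dots> \<le> integral {1..2::real} (\<lambda>_. \<delta> ^ 3)"
    using L by (intro integral_le integrable_continuous_real V_cont continuous_on_const V_tail) auto
  finally have 1: "R ?y \<le> \<delta>\<^sup>2"
    using d3_le by simp
  have 2: "0 \<le> R ?y"
    unfolding R avg_eq_integral[OF V_cont] by (intro integral_nonneg integrable_continuous_real V_cont V_nonneg)
  have Rb: "R_bar \<delta> ?y = integral {?y - 1/2..?y + 1/2} (V_bar \<delta>)"
    unfolding avg_V_bar[OF \<delta>(1), symmetric] by (intro avg_eq_integral continuous_on_V_bar \<delta>)
  have 3: "0 \<le> R_bar \<delta> ?y"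
    unfolding Rb by (intro integral_nonneg integrable_continuous_real continuous_on_V_bar \<delta> V_bar_nonneg)
  have "R_bar \<delta> ?y \<le> integral {?y - 1/2..?y + 1/2} (\<lambda>_. \<delta>\<^sup>2)"
    unfolding Rb using False
    by (intro integral_le integrable_continuous_real continuous_on_V_bar \<delta> continuous_on_const V_bar_tail) auto
  then have 4: "R_bar \<delta> ?y \<le> \<delta>\<^sup>2"
    by simp
  have "1 * \<delta>\<^sup>2 \<le> wave_const L c * \<delta>\<^sup>2"
    using wave_const_ge by (intro mult_right_mono) auto
  then show ?thesis
    using 1 2 3 4 unfolding \<open>R x = R ?y\<close> \<open>R_bar \<delta> x = R_bar \<delta> ?y\<close> by linarith
qed

lemma R_bar_away_from_R0:
  assumes x: "x \<in> {1/4..1/2}"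
  shows "\<delta> / 2 - 3 * \<delta>\<^sup>2 \<le> R_bar \<delta> x - R0 L x"
proof -
  have "(exp (- 1 / (4 * \<delta>)))\<^sup>2 = exp (- 1 / (2 * \<delta>))"
    by (simp add: power2_eq_square flip: exp_add)
  also have "\<dots> \<le> \<delta>\<^sup>2"
    using exp_small exp_gt_zero[of "- 1 / (2 * \<delta>)"] by linarith
  finally have "exp (- 1 / (4 * \<delta>)) \<le> \<delta>"
    using \<delta> by (simp add: power2_le_iff_abs_le)
  then have "3 * \<delta> * exp (- 1 / (4 * \<delta>)) \<le> 3 * \<delta> * \<delta>"
    using \<delta> by (intro mult_left_mono) auto
  moreover have "\<delta> * (1/2) \<le> \<delta> * (1 - x)"
    using x \<delta> by (intro mult_left_mono) auto
  moreover have "R0 L x = 1 - x"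
    using x L by (subst R0_eq) auto
  moreover have "(1 + \<delta>) * (1 - x) - 3 * \<delta> * exp (- 1 / (4 * \<delta>)) \<le> R_bar \<delta> x"
    using x by (intro R_bar_above_tent \<delta>) auto
  moreover have "(1 + \<delta>) * (1 - x) = (1 - x) + \<delta> * (1 - x)"
    by (simp add: distrib_right)
  ultimately show ?thesis
    unfolding power2_eq_square by linarith
qed

lemma energy_at_0: "\<bar>(V 0)\<^sup>2 / 2 - G 0\<bar> \<le> (12 + c) * \<delta> ^ 3"
  using energy[of 0] by (simp add: q_0 m_def)

lemma amplitude_at_0: "\<bar>V 0 - 1 - \<delta>\<bar> \<le> amp_const L c * \<delta>\<^sup>2"
  using amplitude by (simp add: m_def)

end

section \<open>The family of high-energy waves\<close>

locale high_energy_waves =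
  fixes L \<mu> C :: real
    and \<Psi> \<Psi>' \<Phi> \<Phi>' :: "real \<Rightarrow> real"
    and V R :: "real \<Rightarrow> real \<Rightarrow> real"
    and lam :: "real \<Rightarrow> real"
  assumes L: "2 < L"
    and \<Psi>_nonneg: "\<And>r. r \<ge> 0 \<Longrightarrow> \<Psi> r \<ge> 0"
    and \<Psi>_deriv: "\<And>r. r \<ge> 0 \<Longrightarrow> (\<Psi> has_real_derivative \<Psi>' r) (at r within {0..})"
    and C: "C > 0"
    and \<Psi>_mono: "\<And>r. r > 0 \<Longrightarrow> \<Psi>' r + \<Psi> r \<ge> 0"
    and \<Psi>_asymp: "\<And>r. r > 0 \<Longrightarrow> \<bar>\<Psi> r / r powr \<mu> - 1\<bar> \<le> C / r"
    and \<Phi>'_eq: "\<And>r. r \<ge> 0 \<Longrightarrow> \<Phi>' r = \<Psi> r * exp r"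
    and \<Phi>_deriv: "\<And>r. r \<ge> 0 \<Longrightarrow> (\<Phi> has_real_derivative \<Phi>' r) (at r within {0..})"
    and V_max: "\<And>\<delta>. \<delta> > 0 \<Longrightarrow> is_maximizer L \<Phi> \<delta> (V \<delta>)"
    and V_cont: "\<And>\<delta>. \<delta> > 0 \<Longrightarrow> continuous_on UNIV (V \<delta>)"
    and R_eq: "\<And>\<delta>. \<delta> > 0 \<Longrightarrow> R \<delta> = avg (V \<delta>)"
    and lam_pos: "\<And>\<delta>. \<delta> > 0 \<Longrightarrow> lam \<delta> > 0"
    and wave_eq: "\<And>\<delta> x. \<delta> > 0 \<Longrightarrow>
           (lam \<delta>)\<^sup>2 * V \<delta> x = 1 / \<delta> * avg (\<lambda>y. \<Phi>' (avg (V \<delta>) y / \<delta>)) x"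
    and R_cone: "\<And>\<delta>. \<delta> > 0 \<Longrightarrow> R \<delta> \<in> profile_cone L"
    and R_pos: "\<And>\<delta> x. \<delta> > 0 \<Longrightarrow> R \<delta> x > 0"
    and R_conv: "((\<lambda>\<delta>. Lp_norm L \<infinity> (\<lambda>x. R \<delta> x - R0 L x)) \<longlongrightarrow> 0) (at_right 0)"
begin

definition F :: "real \<Rightarrow> real \<Rightarrow> real" where
  "F \<delta> x = \<Phi>' (R \<delta> x / \<delta>) / ((lam \<delta>)\<^sup>2 * \<delta>)"

definition G :: "real \<Rightarrow> real \<Rightarrow> real" where
  "G \<delta> x = 2 / (lam \<delta>)\<^sup>2 * (\<Phi> (R \<delta> x / \<delta>) - \<Phi> 0)"

lemma \<Psi>_cont: "continuous_on {0..} \<Psi>"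
  using \<Psi>_deriv by (intro DERIV_continuous_on) auto

lemma \<Phi>'_cont: "continuous_on {0..} \<Phi>'"
proof -
  have "continuous_on {0..} (\<lambda>r. \<Psi> r * exp r)"
    by (intro continuous_intros \<Psi>_cont)
  then show ?thesis
    by (rule continuous_on_eq) (simp add: \<Phi>'_eq)
qed

lemma \<Phi>'_nonneg: "0 \<le> r \<Longrightarrow> 0 \<le> \<Phi>' r"
  by (simp add: \<Phi>'_eq \<Psi>_nonneg)

lemma \<Phi>'_mono:
  assumes "0 \<le> r" "r \<le> s"
  shows "\<Phi>' r \<le> \<Phi>' s"
proof (rule DERIV_nonneg_imp_increasing_open[OF assms(2)])
  show "continuous_on {r..s} \<Phi>'"
    using assms by (intro continuous_on_subset[OF \<Phi>'_cont]) auto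
  fix x assume "r < x" "x < s"
  then have x: "0 < x"
    using assms by simp
  have "(\<Psi> has_real_derivative \<Psi>' x) (at x)"
    using \<Psi>_deriv[of x] x at_within_interior[of x "{0..}"] by simp
  then have "((\<lambda>r. \<Psi> r * exp r) has_real_derivative (\<Psi>' x + \<Psi> x) * exp x) (at x)"
    by (auto intro!: derivative_eq_intros simp: algebra_simps)
  then have "(\<Phi>' has_real_derivative (\<Psi>' x + \<Psi> x) * exp x) (at x)"
    by (rule has_field_derivative_transform_within_open[where S = "{0<..}"]) (use x in \<open>auto simp: \<Phi>'_eq\<close>)
  moreover have "0 \<le> (\<Psi>' x + \<Psi> x) * exp x"
    using \<Psi>_mono[OF x] by simp
  ultimately show "\<exists>y. (\<Phi>' has_real_derivative y) (at x) \<and> 0 \<le> y"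
    by blast
qed

text \<open>The quotient of the forces is of order \<open>exp (- 1 / (20 \<delta>))\<close>, since \<open>17/20 - 4/5 = 1/20\<close> and the powers
  contribute a constant factor.\<close>

lemma force_gap: "\<forall>\<^sub>F \<delta> in at_right 0. \<Phi>' (4/5 / \<delta>) \<le> \<delta> ^ 3 / 20 * \<Phi>' (17/20 / \<delta>)"
proof -
  define k where "k = 60 * (16/17) powr \<mu>"
  have "((\<lambda>\<delta>::real. exp (- 1 / (20 * \<delta>)) / \<delta> ^ 3) \<longlongrightarrow> 0) (at_right 0)"
    by real_asymp
  then have "((\<lambda>\<delta>::real. k * (exp (- 1 / (20 * \<delta>)) / \<delta> ^ 3)) \<longlongrightarrow> k * 0) (at_right 0)"
    by (intro tendsto_intros)
  then have "\<forall>\<^sub>F \<delta>::real in at_right 0. k * (exp (- 1 / (20 * \<delta>)) / \<delta> ^ 3) < 1"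
    by (rule order_tendstoD(2)) simp
  moreover have "\<forall>\<^sub>F \<delta>::real in at_right 0. \<delta> < 2/5 / C"
    using C by (intro eventually_at_rightI[of 0 "2/5 / C"]) auto
  moreover have "\<forall>\<^sub>F \<delta>::real in at_right 0. \<delta> > 0"
    by (simp add: eventually_at_filter)
  ultimately show ?thesis
  proof eventually_elim
    case (elim \<delta>)
    have near: "r powr \<mu> / 2 \<le> \<Psi> r" "\<Psi> r \<le> 3/2 * r powr \<mu>" if "r \<ge> 2 * C" for r
    proof -
      have "r > 0"
        using that C by linarith
      have "C / r \<le> 1/2"
        using that \<open>r > 0\<close> by (simp add: field_simps)
      then have "\<bar>\<Psi> r / r powr \<mu> - 1\<bar> \<le> 1/2"
        using \<Psi>_asymp[OF \<open>r > 0\<close>] by linarith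
      then have "1/2 \<le> \<Psi> r / r powr \<mu>" "\<Psi> r / r powr \<mu> \<le> 3/2"
        by linarith+
      then show "r powr \<mu> / 2 \<le> \<Psi> r" "\<Psi> r \<le> 3/2 * r powr \<mu>"
        using \<open>r > 0\<close> by (simp_all add: field_simps)
    qed
    define a b where "a = 4/5 / \<delta>" and "b = 17/20 / \<delta>"
    have "2 * C \<le> a"
      using elim C by (simp add: a_def field_simps)
    moreover have "a \<le> b"
      using elim by (simp add: a_def b_def field_simps)
    ultimately have ab: "2 * C \<le> a" "2 * C \<le> b" "0 < a" "0 < b"
      using C by auto
    have pw: "a powr \<mu> = (16/17) powr \<mu> * b powr \<mu>"
      using ab by (subst powr_mult[symmetric]) (auto simp: a_def b_def)
    have ex: "exp a = exp (- 1 / (20 * \<delta>)) * exp b"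
      using elim by (simp add: a_def b_def field_simps flip: exp_add)
    have "k * exp (- 1 / (20 * \<delta>)) \<le> \<delta> ^ 3"
      using elim by (simp add: field_simps)
    then have small: "3/2 * ((16/17) powr \<mu> * exp (- 1 / (20 * \<delta>))) \<le> \<delta> ^ 3 / 20 / 2"
      by (simp add: k_def mult_ac)
    have "\<Phi>' a \<le> 3/2 * a powr \<mu> * exp a"
      using near(2)[OF ab(1)] ab by (simp add: \<Phi>'_eq)
    also have "\<dots> = 3/2 * ((16/17) powr \<mu> * exp (- 1 / (20 * \<delta>))) * (b powr \<mu> * exp b)"
      by (simp add: pw ex)
    also have "\<dots> \<le> \<delta> ^ 3 / 20 / 2 * (b powr \<mu> * exp b)"
      using ab by (intro mult_right_mono small) auto
    also have "\<dots> = \<delta> ^ 3 / 20 * (b powr \<mu> / 2 * exp b)"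
      by simp
    also have "\<dots> \<le> \<delta> ^ 3 / 20 * \<Phi>' b"
      using near(1)[OF ab(2)] ab elim by (intro mult_left_mono) (auto simp: \<Phi>'_eq)
    finally show ?case
      by (simp add: a_def b_def)
  qed
qed

lemma R_cont: "\<delta> > 0 \<Longrightarrow> continuous_on UNIV (R \<delta>)"
  by (simp add: R_eq continuous_on_avg V_cont)

lemma V_cone: "\<delta> > 0 \<Longrightarrow> V \<delta> \<in> profile_cone L"
  using V_max by (auto simp: is_maximizer_def)

lemma R_symm:
  assumes "\<delta> > 0"
  shows "\<bar>x\<bar> \<le> L \<Longrightarrow> R \<delta> (- x) = R \<delta> x" "0 \<le> x \<Longrightarrow> x \<le> y \<Longrightarrow> y \<le> L \<Longrightarrow> R \<delta> y \<le> R \<delta> x"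
  using continuous_profile_cone[OF R_cone R_cont] assms L by auto

lemma V_symm:
  assumes "\<delta> > 0"
  shows "\<bar>x\<bar> \<le> L \<Longrightarrow> V \<delta> (- x) = V \<delta> x" "0 \<le> x \<Longrightarrow> x \<le> y \<Longrightarrow> y \<le> L \<Longrightarrow> V \<delta> y \<le> V \<delta> x"
  using continuous_profile_cone[OF V_cone V_cont] assms L by auto

lemma R_deriv: "\<delta> > 0 \<Longrightarrow> (R \<delta> has_real_derivative V \<delta> (x + 1/2) - V \<delta> (x - 1/2)) (at x)"
  using avg_has_real_derivative[OF V_cont] by (simp add: R_eq)

lemma F_cont:
  assumes "\<delta> > 0"
  shows "continuous_on UNIV (F \<delta>)"
proof -
  have "continuous_on UNIV (\<lambda>x. \<Phi>' (R \<delta> x / \<delta>))"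
    using assms less_imp_le[OF R_pos[OF assms]]
    by (intro continuous_on_compose2[OF \<Phi>'_cont] continuous_intros R_cont) auto
  then show ?thesis
    unfolding F_def[abs_def] using assms lam_pos[OF assms] by (intro continuous_intros) auto
qed

lemma V_avg_F: "\<delta> > 0 \<Longrightarrow> V \<delta> = avg (F \<delta>)"
proof
  fix x
  assume \<delta>: "\<delta> > 0"
  have "avg (F \<delta>) x = avg (\<lambda>y. \<Phi>' (avg (V \<delta>) y / \<delta>)) x / ((lam \<delta>)\<^sup>2 * \<delta>)"
    using \<delta> by (simp add: avg_def F_def[abs_def] R_eq)
  also have "\<dots> = V \<delta> x"
    using wave_eq[OF \<delta>, of x] \<delta> lam_pos[OF \<delta>] by (simp add: field_simps)
  finally show "V \<delta> x = avg (F \<delta>) x" ..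
qed

lemma R_near_tent: "\<forall>\<^sub>F \<delta> in at_right 0. \<forall>x. \<bar>x\<bar> \<le> L \<longrightarrow> \<bar>R \<delta> x - max 0 (1 - \<bar>x\<bar>)\<bar> \<le> 1/40"
proof -
  have "\<forall>\<^sub>F \<delta> in at_right 0. Lp_norm L \<infinity> (\<lambda>x. R \<delta> x - R0 L x) < ennreal (1/40)"
    using R_conv by (rule order_tendstoD(2)) simp
  moreover have "\<forall>\<^sub>F \<delta>::real in at_right 0. \<delta> > 0"
    by (simp add: eventually_at_filter)
  ultimately show ?thesis
  proof eventually_elim
    case (elim \<delta>)
    show ?case
    proof (intro allI impI)
      fix x assume x: "\<bar>x\<bar> \<le> L"
      have "\<bar>R \<delta> x - R0 L x\<bar> \<le> 1/40"
      proof (rule Lp_norm_infinity_pointwise[OF _ elim(1) _ _ _ x])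
        show "continuous_on {-L..L} (\<lambda>x. R \<delta> x - max 0 (1 - \<bar>x\<bar>))"
          by (intro continuous_intros continuous_on_subset[OF R_cont[OF elim(2)]]) auto
      qed (use L R0_eq[of L] in auto)
      then show "\<bar>R \<delta> x - max 0 (1 - \<bar>x\<bar>)\<bar> \<le> 1/40"
        using R0_eq[OF L x] by simp
    qed
  qed
qed

text \<open>The bound on \<open>V 0\<close>, the total mass of the force on \<open>[-1/2, 1/2]\<close>, comes from \<open>R 0\<close>, an average of \<open>V\<close>:
  the force beyond \<open>1/4\<close> is negligible compared with the mass, so \<open>V 0\<close> cannot exceed \<open>V (1/4)\<close> by much,
  and \<open>V (1/4) \<le> 2 R 0\<close> by monotonicity. The levels \<open>4/5\<close> and \<open>17/20\<close> lie above \<open>R (1/4)\<close> and below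
  \<open>R (1/8)\<close>, respectively.\<close>

lemma concentrated:
  assumes \<delta>: "0 < \<delta>" "\<delta> \<le> 1/2" and exp_small: "2 * exp (- 1 / (2 * \<delta>)) \<le> \<delta>\<^sup>2"
    and gap: "\<Phi>' (4/5 / \<delta>) \<le> \<delta> ^ 3 / 20 * \<Phi>' (17/20 / \<delta>)"
    and tent: "\<forall>x. \<bar>x\<bar> \<le> L \<longrightarrow> \<bar>R \<delta> x - max 0 (1 - \<bar>x\<bar>)\<bar> \<le> 1/40"
    and K: "0 \<le> K" "\<And>r. r \<ge> r0 \<Longrightarrow> \<bar>\<Phi> r - \<Phi> 0 - \<Phi>' r\<bar> \<le> K / r * \<Phi>' r" and r0: "r0 \<le> 1 / (4 * \<delta>)"
  shows "concentrated_wave L \<delta> (8 * K) (F \<delta>) (V \<delta>) (G \<delta>)"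
proof
  let ?F = "F \<delta>" and ?V = "V \<delta>"
  have lam: "0 < (lam \<delta>)\<^sup>2 * \<delta>"
    using \<delta> lam_pos[of \<delta>] by simp
  have R_nonneg: "0 \<le> R \<delta> x / \<delta>" for x
    using \<delta> R_pos[of \<delta> x] by simp
  show F_nonneg: "0 \<le> ?F x" for x
    unfolding F_def using less_imp_le[OF lam] \<Phi>'_nonneg[OF R_nonneg] by (rule divide_nonneg_nonneg[rotated])
  show F_even: "?F (- x) = ?F x" if "\<bar>x\<bar> \<le> 2" for x
    using that L \<delta> by (simp add: F_def R_symm)
  have F_le: "?F y \<le> ?F x" if "R \<delta> y \<le> R \<delta> x" for x y
    unfolding F_def using lam R_nonneg that \<delta> by (intro divide_right_mono \<Phi>'_mono) auto
  show F_decr: "?F y \<le> ?F x" if "0 \<le> x" "x \<le> y" "y \<le> 2" for x y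
    using that L \<delta> by (intro F_le R_symm) auto
  have R_at: "\<bar>R \<delta> x - (1 - x)\<bar> \<le> 1/40" if "0 \<le> x" "x \<le> 1" for x
    using tent[rule_format, of x] that L by simp
  have V_eq: "?V x = integral {x - 1/2..x + 1/2} ?F" for x
    using V_avg_F avg_eq_integral[OF F_cont] \<delta> by metis
  have F_int: "?F integrable_on {a..b}" for a b
    by (intro integrable_continuous_real continuous_on_subset[OF F_cont] \<delta>) auto
  have V_int: "?V integrable_on {a..b}" for a b
    by (intro integrable_continuous_real continuous_on_subset[OF V_cont] \<delta>) auto
  have V_nonneg: "0 \<le> ?V x" for x
    unfolding V_eq by (intro integral_nonneg F_int F_nonneg)
  have R_0: "R \<delta> 0 = integral {-1/2..1/2} ?V"
    using avg_eq_integral[OF V_cont, of \<delta> 0] \<delta> by (simp add: R_eq)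
  have F_quarter: "?F (1/4) \<le> \<delta> ^ 3 / 5 * ?V 0"
  proof -
    have R: "R \<delta> (1/4) \<le> 4/5" "17/20 \<le> R \<delta> (1/8)"
      using R_at[of "1/4"] R_at[of "1/8"] unfolding abs_le_iff by argo+
    have "?F (1/4) \<le> \<Phi>' (4/5 / \<delta>) / ((lam \<delta>)\<^sup>2 * \<delta>)"
      unfolding F_def using R lam \<delta> R_nonneg by (intro divide_right_mono \<Phi>'_mono) auto
    also have "\<dots> \<le> (\<delta> ^ 3 / 20 * \<Phi>' (17/20 / \<delta>)) / ((lam \<delta>)\<^sup>2 * \<delta>)"
      using gap lam by (intro divide_right_mono) auto
    also have "\<dots> = \<delta> ^ 3 / 20 * (\<Phi>' (17/20 / \<delta>) / ((lam \<delta>)\<^sup>2 * \<delta>))"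
      by simp
    also have "\<dots> \<le> \<delta> ^ 3 / 20 * ?F (1/8)"
      unfolding F_def using R lam \<delta> by (intro mult_left_mono divide_right_mono \<Phi>'_mono) auto
    also have "\<dots> \<le> \<delta> ^ 3 / 20 * (4 * ?V 0)"
    proof -
      have "?F (1/8) / 4 = integral {-1/8..1/8::real} (\<lambda>_. ?F (1/8))"
        by simp
      also have "\<dots> \<le> integral {-1/8..1/8} ?F"
      proof (intro integral_le F_int integrable_continuous_real continuous_on_const)
        fix x :: real assume x: "x \<in> {-1/8..1/8}"
        show "?F (1/8) \<le> ?F x"
          using F_decr[of "\<bar>x\<bar>" "1/8"] F_even[of x] x by (cases "0 \<le> x") auto
      qed
      also have "\<dots> \<le> integral {-1/2..1/2} ?F"
        using F_nonneg by (intro integral_subset_le F_int) auto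
      also have "\<dots> = ?V 0"
        by (simp add: V_eq)
      finally show ?thesis
        using \<delta> by (intro mult_left_mono) auto
    qed
    finally show ?thesis
      by (simp add: mult_ac)
  qed
  have d3: "\<delta> ^ 3 \<le> 1"
    using \<delta> by (intro power_le_one) auto
  have V0_V: "?V 0 \<le> ?V (1/4) + ?F (1/4)"
  proof -
    have "?V 0 \<le> integral {-1/2..3/4} ?F"
      unfolding V_eq[of 0] using F_nonneg by (intro integral_subset_le F_int) auto
    also have "\<dots> = integral {-1/2..-1/4} ?F + integral {-1/4..3/4} ?F"
      by (rule Henstock_Kurzweil_Integration.integral_combine[symmetric]) (auto intro: F_int)
    also have "integral {-1/4..3/4} ?F = ?V (1/4)"
      by (simp add: V_eq)
    also have "integral {-1/2..-1/4} ?F \<le> integral {-1/2..-1/4::real} (\<lambda>_. ?F (1/4))"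
    proof (intro integral_le F_int integrable_continuous_real continuous_on_const)
      fix x :: real assume x: "x \<in> {-1/2..-1/4}"
      show "?F x \<le> ?F (1/4)"
        using F_decr[of "1/4" "- x"] F_even[of x] x by auto
    qed
    finally show ?thesis
      using F_nonneg[of "1/4"] by simp
  qed
  have "?V (1/4) / 2 \<le> R \<delta> 0"
  proof -
    have "?V (1/4) / 2 = integral {-1/4..1/4::real} (\<lambda>_. ?V (1/4))"
      by simp
    also have "\<dots> \<le> integral {-1/4..1/4} ?V"
    proof (intro integral_le V_int integrable_continuous_real continuous_on_const)
      fix x :: real assume x: "x \<in> {-1/4..1/4}"
      show "?V (1/4) \<le> ?V x"
        using V_symm(2)[of \<delta> "\<bar>x\<bar>" "1/4"] V_symm(1)[of \<delta> x] x L \<delta> by (cases "0 \<le> x") auto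
    qed
    also have "\<dots> \<le> R \<delta> 0"
      unfolding R_0 using V_nonneg by (intro integral_subset_le V_int) auto
    finally show ?thesis .
  qed
  moreover have "\<delta> ^ 3 / 5 * ?V 0 \<le> 1 / 5 * ?V 0"
    using d3 V_nonneg[of 0] by (intro mult_right_mono) auto
  ultimately show V0_le: "?V 0 \<le> 5"
    using V0_V F_quarter R_at[of 0] unfolding abs_le_iff by argo
  show "1/2 \<le> ?V 0"
  proof -
    have "R \<delta> 0 \<le> integral {-1/2..1/2::real} (\<lambda>_. ?V 0)"
      unfolding R_0
    proof (intro integral_le V_int integrable_continuous_real continuous_on_const)
      fix x :: real assume x: "x \<in> {-1/2..1/2}"
      show "?V x \<le> ?V 0"
        using V_symm(2)[of \<delta> 0 "\<bar>x\<bar>"] V_symm(1)[of \<delta> x] x L \<delta> by (cases "0 \<le> x") auto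
    qed
    then show ?thesis
      using R_at[of 0] unfolding abs_le_iff by simp
  qed
  have "\<delta> ^ 3 / 5 * ?V 0 \<le> \<delta> ^ 3 / 5 * 5"
    using V0_le \<delta> by (intro mult_left_mono) auto
  then show "?F (1/2) \<le> \<delta> ^ 3"
    using F_decr[of "1/4" "1/2"] F_quarter by simp
  show "integral {-L..L} (\<lambda>x. (?V x)\<^sup>2) = 1"
    using V_max[OF \<delta>(1)] by (intro Lp_norm_2_eq_1 V_cont \<delta>) (auto simp: is_maximizer_def)
  fix x :: real assume x: "0 \<le> x" "x \<le> 1/2"
  define r where "r = R \<delta> x / \<delta>"
  have "1/4 \<le> R \<delta> x"
    using R_at[of x] x unfolding abs_le_iff by argo
  then have "1/4 / \<delta> \<le> r"
    unfolding r_def using \<delta> by (intro divide_right_mono) auto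
  then have r_ge: "1 / (4 * \<delta>) \<le> r" "0 < r"
    using R_pos[of \<delta> x] \<delta> by (auto simp: r_def)
  show "(G \<delta> has_real_derivative 2 * ?F x * (?V (x + 1/2) - ?V (x - 1/2))) (at x)"
  proof -
    have "(\<Phi> has_real_derivative \<Phi>' r) (at r)"
      using \<Phi>_deriv[of r] r_ge at_within_interior[of r "{0..}"] by simp
    then have "((\<lambda>x. \<Phi> (R \<delta> x / \<delta>)) has_real_derivative \<Phi>' r * ((?V (x + 1/2) - ?V (x - 1/2)) / \<delta>)) (at x)"
      unfolding r_def by (rule DERIV_chain2[where g = "\<lambda>x. R \<delta> x / \<delta>"]) (intro DERIV_cdivide R_deriv \<delta>)
    then have "(G \<delta> has_real_derivative 2 / (lam \<delta>)\<^sup>2 * (\<Phi>' r * ((?V (x + 1/2) - ?V (x - 1/2)) / \<delta>) - 0)) (at x)"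
      unfolding G_def[abs_def] by (intro DERIV_cmult DERIV_diff DERIV_const)
    moreover have "2 / (lam \<delta>)\<^sup>2 * (\<Phi>' r * ((?V (x + 1/2) - ?V (x - 1/2)) / \<delta>) - 0) = 2 * ?F x * (?V (x + 1/2) - ?V (x - 1/2))"
      by (simp add: F_def r_def)
    ultimately show ?thesis
      by simp
  qed
  show "\<bar>G \<delta> x - 2 * \<delta> * ?F x\<bar> \<le> 8 * K * \<delta>\<^sup>2 * ?F x"
  proof -
    have "G \<delta> x - 2 * \<delta> * ?F x = 2 / (lam \<delta>)\<^sup>2 * (\<Phi> r - \<Phi> 0 - \<Phi>' r)"
      using \<delta> lam_pos[of \<delta>] by (simp add: G_def F_def r_def field_simps)
    then have "\<bar>G \<delta> x - 2 * \<delta> * ?F x\<bar> = 2 / (lam \<delta>)\<^sup>2 * \<bar>\<Phi> r - \<Phi> 0 - \<Phi>' r\<bar>"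
      by (simp only: abs_mult) simp
    also have "\<dots> \<le> 2 / (lam \<delta>)\<^sup>2 * (K / r * \<Phi>' r)"
      using r_ge r0 by (intro mult_left_mono K) auto
    also have "\<dots> \<le> 2 / (lam \<delta>)\<^sup>2 * ((4 * K * \<delta>) * \<Phi>' r)"
    proof (intro mult_left_mono mult_right_mono)
      have "K / r \<le> K / (1 / (4 * \<delta>))"
        using K r_ge \<delta> by (intro divide_left_mono) auto
      then show "K / r \<le> 4 * K * \<delta>"
        by (simp add: mult_ac)
    qed (use r_ge \<Phi>'_nonneg in auto)
    also have "\<dots> = 8 * K * \<delta>\<^sup>2 * ?F x"
      using \<delta> by (simp add: F_def r_def power2_eq_square)
    finally show ?thesis .
  qed
qed (use L \<delta> exp_small K V_symm F_cont V_avg_F in auto)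

lemma eventually_concentrated:
  obtains c where "c \<ge> 0" "\<forall>\<^sub>F \<delta> in at_right 0. concentrated_wave L \<delta> c (F \<delta>) (V \<delta>) (G \<delta>)"
    "((\<lambda>r. (\<Phi> r - \<Phi> 0) / (r powr \<mu> * exp r)) \<longlongrightarrow> 1) at_top"
proof -
  obtain K r0 where K: "K \<ge> 0" and "r0 \<ge> 1"
    and K1: "\<And>r. r \<ge> r0 \<Longrightarrow> \<bar>\<Phi> r - \<Phi> 0 - r powr \<mu> * exp r\<bar> \<le> K / r * (r powr \<mu> * exp r)"
    and K2: "\<And>r. r \<ge> r0 \<Longrightarrow> \<bar>\<Phi> r - \<Phi> 0 - \<Phi>' r\<bar> \<le> K / r * \<Phi>' r"
    using potential_asymptotics[OF \<Phi>_deriv \<Phi>'_eq \<Psi>_asymp C] by blast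
  show ?thesis
  proof (rule that)
    show "8 * K \<ge> 0"
      using K by simp
    have "\<forall>\<^sub>F \<delta>::real in at_right 0. 0 < \<delta>" "\<forall>\<^sub>F \<delta>::real in at_right 0. \<delta> \<le> 1/2"
      "\<forall>\<^sub>F \<delta>::real in at_right 0. 2 * exp (- 1 / (2 * \<delta>)) \<le> \<delta>\<^sup>2"
      by real_asymp+
    moreover have "\<forall>\<^sub>F \<delta>::real in at_right 0. r0 \<le> 1 / (4 * \<delta>)"
      by real_asymp
    ultimately show "\<forall>\<^sub>F \<delta> in at_right 0. concentrated_wave L \<delta> (8 * K) (F \<delta>) (V \<delta>) (G \<delta>)"
      using force_gap R_near_tent
    proof eventually_elim
      case (elim \<delta>)
      show ?case
        by (rule concentrated[OF elim(1-3,5,6) K K2 elim(4)])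
    qed
    have "((\<lambda>r. (\<Phi> r - \<Phi> 0) / (r powr \<mu> * exp r) - 1) \<longlongrightarrow> 0) at_top"
    proof (rule Lim_null_comparison)
      show "((\<lambda>r. K / r) \<longlongrightarrow> 0) at_top"
        by real_asymp
      show "\<forall>\<^sub>F r in at_top. norm ((\<Phi> r - \<Phi> 0) / (r powr \<mu> * exp r) - 1) \<le> K / r"
        using eventually_ge_at_top[of r0]
      proof eventually_elim
        case (elim r)
        have "r > 0"
          using elim \<open>r0 \<ge> 1\<close> by simp
        then have p: "0 < r powr \<mu> * exp r"
          by simp
        have "(\<Phi> r - \<Phi> 0) / (r powr \<mu> * exp r) - 1 = (\<Phi> r - \<Phi> 0 - r powr \<mu> * exp r) / (r powr \<mu> * exp r)"
          using p by (simp only: diff_divide_distrib[where c = "r powr \<mu> * exp r"] divide_self[OF less_imp_neq[OF p, symmetric]])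
        then have "norm ((\<Phi> r - \<Phi> 0) / (r powr \<mu> * exp r) - 1) = \<bar>\<Phi> r - \<Phi> 0 - r powr \<mu> * exp r\<bar> / (r powr \<mu> * exp r)"
          using p by (simp add: abs_mult)
        also have "\<dots> \<le> K / r"
          using K1[OF elim] p by (subst pos_divide_le_eq) auto
        finally show ?case .
      qed
    qed
    then show "((\<lambda>r. (\<Phi> r - \<Phi> 0) / (r powr \<mu> * exp r)) \<longlongrightarrow> 1) at_top"
      by (rule LIM_zero_cancel)
  qed
qed

end

section \<open>The limit of the speeds and the norm estimates\<close>

lemma tendsto_by_bound:
  fixes f b :: "real \<Rightarrow> real"
  assumes "\<forall>\<^sub>F x in Fl. \<bar>f x - l\<bar> \<le> b x" "(b \<longlongrightarrow> 0) Fl"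
  shows "(f \<longlongrightarrow> l) Fl"
  by (rule LIM_zero_cancel, rule Lim_null_comparison) (use assms in auto)

context high_energy_waves
begin

lemma wave_R_error:
  assumes "concentrated_wave L \<delta> c (F \<delta>) (V \<delta>) (G \<delta>)" "\<bar>x\<bar> \<le> L"
  shows "\<bar>R \<delta> x - R_bar \<delta> x\<bar> \<le> wave_const L c * \<delta>\<^sup>2"
proof -
  have \<delta>: "\<delta> > 0"
    using concentrated_wave.\<delta>(1)[OF assms(1)] .
  show ?thesis
    using R_symm[OF \<delta>] by (intro concentrated_wave.R_error[OF assms(1) R_eq[OF \<delta>]] assms(2)) auto
qed

text \<open>By definition of \<open>G\<close>, the number \<open>lam\<^sup>2\<close> is \<open>2 (\<Phi> r - \<Phi> 0) / G 0\<close> with \<open>r = R 0 / \<delta>\<close>. The powers of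
  \<open>\<delta>\<close> cancel against \<open>r\<^sup>\<mu>\<close>, and the exponent \<open>r - 1/\<delta>\<close> converges because \<open>R 0\<close> is known up to \<open>o(\<delta>)\<close>.\<close>

lemma speed_limit: "((\<lambda>\<delta>. (lam \<delta>)\<^sup>2 * \<delta> powr \<mu> * exp (- 1 / \<delta>)) \<longlongrightarrow> exp 1) (at_right 0)"
proof -
  obtain c where "c \<ge> 0" and ev: "\<forall>\<^sub>F \<delta> in at_right 0. concentrated_wave L \<delta> c (F \<delta>) (V \<delta>) (G \<delta>)"
    and Q: "((\<lambda>r. (\<Phi> r - \<Phi> 0) / (r powr \<mu> * exp r)) \<longlongrightarrow> 1) at_top"
    by (rule eventually_concentrated)
  let ?M = "wave_const L c"
  have V0: "((\<lambda>\<delta>. V \<delta> 0) \<longlongrightarrow> 1) (at_right 0)"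
  proof (rule tendsto_by_bound)
    show "\<forall>\<^sub>F \<delta> in at_right 0. \<bar>V \<delta> 0 - 1\<bar> \<le> \<delta> + amp_const L c * \<delta>\<^sup>2"
      using ev
    proof eventually_elim
      case (elim \<delta>)
      show ?case
        using concentrated_wave.amplitude_at_0[OF elim] concentrated_wave.\<delta>(1)[OF elim] by linarith
    qed
    have "((\<lambda>\<delta>. \<delta> + amp_const L c * \<delta>\<^sup>2) \<longlongrightarrow> 0 + amp_const L c * 0\<^sup>2) (at_right 0)"
      by (intro tendsto_intros)
    then show "((\<lambda>\<delta>. \<delta> + amp_const L c * \<delta>\<^sup>2) \<longlongrightarrow> 0) (at_right 0)"
      by simp
  qed
  have "((\<lambda>\<delta>. G \<delta> 0 - (V \<delta> 0)\<^sup>2 / 2) \<longlongrightarrow> 0) (at_right 0)"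
  proof (rule tendsto_by_bound)
    show "\<forall>\<^sub>F \<delta> in at_right 0. \<bar>G \<delta> 0 - (V \<delta> 0)\<^sup>2 / 2 - 0\<bar> \<le> (12 + c) * \<delta> ^ 3"
      using ev by eventually_elim (use concentrated_wave.energy_at_0 in \<open>force simp: abs_minus_commute\<close>)
    have "((\<lambda>\<delta>. (12 + c) * \<delta> ^ 3) \<longlongrightarrow> (12 + c) * 0 ^ 3) (at_right 0)"
      by (intro tendsto_intros)
    then show "((\<lambda>\<delta>. (12 + c) * \<delta> ^ 3) \<longlongrightarrow> 0) (at_right 0)"
      by simp
  qed
  then have "((\<lambda>\<delta>. (G \<delta> 0 - (V \<delta> 0)\<^sup>2 / 2) + (V \<delta> 0)\<^sup>2 / 2) \<longlongrightarrow> 0 + 1\<^sup>2 / 2) (at_right 0)"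
    by (intro tendsto_intros V0) auto
  then have G0: "((\<lambda>\<delta>. G \<delta> 0) \<longlongrightarrow> 1/2) (at_right 0)"
    by simp
  have "((\<lambda>\<delta>. (R \<delta> 0 - R_bar \<delta> 0) / \<delta>) \<longlongrightarrow> 0) (at_right 0)"
  proof (rule tendsto_by_bound)
    show "\<forall>\<^sub>F \<delta> in at_right 0. \<bar>(R \<delta> 0 - R_bar \<delta> 0) / \<delta> - 0\<bar> \<le> ?M * \<delta>"
      using ev
    proof eventually_elim
      case (elim \<delta>)
      have "0 < \<delta>"
        using concentrated_wave.\<delta>(1)[OF elim] .
      moreover have "\<bar>R \<delta> 0 - R_bar \<delta> 0\<bar> \<le> ?M * \<delta>\<^sup>2"
        using L by (intro wave_R_error[OF elim]) auto
      ultimately show ?case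
        by (simp add: pos_divide_le_eq power2_eq_square mult.assoc)
    qed
    have "((\<lambda>\<delta>. ?M * \<delta>) \<longlongrightarrow> ?M * 0) (at_right 0)"
      by (intro tendsto_intros)
    then show "((\<lambda>\<delta>. ?M * \<delta>) \<longlongrightarrow> 0) (at_right 0)"
      by simp
  qed
  moreover have "((\<lambda>\<delta>. (R_bar \<delta> 0 - 1) / \<delta>) \<longlongrightarrow> 1 - 2 * ln 2) (at_right 0)"
  proof -
    have "((\<lambda>\<delta>. (R_bar \<delta> 0 - 1) / \<delta>) \<longlongrightarrow> 1 + 2 * ln (1/2)) (at_right 0)"
      unfolding R_bar_ln_cosh cosh_def by simp real_asymp
    then show ?thesis
      by (simp add: ln_div)
  qed
  ultimately have "((\<lambda>\<delta>. (R \<delta> 0 - R_bar \<delta> 0) / \<delta> + (R_bar \<delta> 0 - 1) / \<delta>) \<longlongrightarrow> 0 + (1 - 2 * ln 2)) (at_right 0)"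
    by (intro tendsto_intros)
  then have R1: "((\<lambda>\<delta>. (R \<delta> 0 - 1) / \<delta>) \<longlongrightarrow> 1 - 2 * ln 2) (at_right 0)"
    by (simp flip: add_divide_distrib)
  have pos: "\<forall>\<^sub>F \<delta>::real in at_right 0. \<delta> > 0"
    by (simp add: eventually_at_filter)
  have "((\<lambda>\<delta>. 1 + \<delta> * ((R \<delta> 0 - 1) / \<delta>)) \<longlongrightarrow> 1 + 0 * (1 - 2 * ln 2)) (at_right 0)"
    by (intro tendsto_intros R1)
  then have "((\<lambda>\<delta>. 1 + \<delta> * ((R \<delta> 0 - 1) / \<delta>)) \<longlongrightarrow> 1) (at_right 0)"
    by simp
  then have R0: "((\<lambda>\<delta>. R \<delta> 0) \<longlongrightarrow> 1) (at_right 0)"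
  proof (rule Lim_transform_eventually)
    show "\<forall>\<^sub>F \<delta> in at_right 0. 1 + \<delta> * ((R \<delta> 0 - 1) / \<delta>) = R \<delta> 0"
      using pos by eventually_elim simp
  qed
  have "filterlim (\<lambda>\<delta>::real. 1 / \<delta>) at_top (at_right 0)"
    by real_asymp
  then have "filterlim (\<lambda>\<delta>. R \<delta> 0 * (1 / \<delta>)) at_top (at_right 0)"
    by (rule filterlim_tendsto_pos_mult_at_top[OF R0, rotated]) simp
  then have r: "filterlim (\<lambda>\<delta>. R \<delta> 0 / \<delta>) at_top (at_right 0)"
    by simp
  let ?Q = "\<lambda>r. (\<Phi> r - \<Phi> 0) / (r powr \<mu> * exp r)"
  have Qr: "((\<lambda>\<delta>. ?Q (R \<delta> 0 / \<delta>)) \<longlongrightarrow> 1) (at_right 0)"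
    by (rule filterlim_compose[OF Q r])
  have "((\<lambda>\<delta>. 2 / G \<delta> 0 * ?Q (R \<delta> 0 / \<delta>) * (R \<delta> 0) powr \<mu> * exp ((R \<delta> 0 - 1) / \<delta>))
      \<longlongrightarrow> 2 / (1/2) * 1 * 1 powr \<mu> * exp (1 - 2 * ln 2)) (at_right 0)"
    by (intro tendsto_intros G0 Qr R0 R1) auto
  also have "2 / (1/2) * 1 * 1 powr \<mu> * exp (1 - 2 * ln 2) = (exp 1 :: real)"
  proof -
    have "exp (2 * ln 2) = (4 :: real)"
      by (simp add: exp_double power2_eq_square)
    then show ?thesis
      by (simp add: exp_diff)
  qed
  finally show ?thesis
  proof (rule Lim_transform_eventually)
    have "\<forall>\<^sub>F \<delta> in at_right 0. G \<delta> 0 > 0"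
      using order_tendstoD(1)[OF G0, of 0] by simp
    then show "\<forall>\<^sub>F \<delta> in at_right 0. 2 / G \<delta> 0 * ?Q (R \<delta> 0 / \<delta>) * (R \<delta> 0) powr \<mu> * exp ((R \<delta> 0 - 1) / \<delta>)
        = (lam \<delta>)\<^sup>2 * \<delta> powr \<mu> * exp (- 1 / \<delta>)"
      using pos
    proof eventually_elim
      case (elim \<delta>)
      define r where "r = R \<delta> 0 / \<delta>"
      define P where "P = \<Phi> r - \<Phi> 0"
      have R: "R \<delta> 0 > 0"
        using R_pos elim by simp
      have lam: "(lam \<delta>)\<^sup>2 = 2 / G \<delta> 0 * P"
        using elim lam_pos[of \<delta>] by (simp add: G_def P_def r_def field_simps)
      have pw: "r powr \<mu> * \<delta> powr \<mu> = (R \<delta> 0) powr \<mu>"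
        using elim R by (simp add: r_def powr_divide)
      have ex: "exp r * exp (- 1 / \<delta>) = exp ((R \<delta> 0 - 1) / \<delta>)"
        by (simp add: r_def diff_divide_distrib flip: exp_add)
      have "r > 0"
        using R elim by (simp add: r_def)
      then have "2 / G \<delta> 0 * ?Q r * (R \<delta> 0) powr \<mu> * exp ((R \<delta> 0 - 1) / \<delta>)
          = 2 / G \<delta> 0 * P * \<delta> powr \<mu> * exp (- 1 / \<delta>)"
        unfolding pw[symmetric] ex[symmetric] P_def by simp
      then show ?case
        unfolding lam r_def .
    qed
  qed
qed

text \<open>The factor \<open>16\<close> is the product of the height \<open>1/8\<close> and of \<open>2 \<ge> 2\<^bsup>1/p\<^esup>\<close> for the width \<open>\<delta>/2\<close> of the set where
  \<open>V\<close> stays away from \<open>V0\<close>.\<close>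

lemma norm_estimates_V:
  assumes wave: "concentrated_wave L \<delta> c (F \<delta>) (V \<delta>) (G \<delta>)" and small: "(wave_const L c + 1) * \<delta> \<le> 1/8"
    and p: "1 \<le> p"
  shows "Lp_norm L p (\<lambda>x. V \<delta> x - V_bar \<delta> x) \<le> ennreal (16 * wave_const L c * \<delta>) * Lp_norm L p (\<lambda>x. V \<delta> x - V0 L x)"
    and "ennreal (16 * wave_const L c * \<delta>) * Lp_norm L p (\<lambda>x. V \<delta> x - V0 L x)
      \<le> ennreal (16 * wave_const L c * limit_const L c * \<delta> powr (1 + enn2real (1 / p)))"
proof -
  interpret concentrated_wave L \<delta> c "F \<delta>" "V \<delta>" "G \<delta>"
    by (rule wave)
  define M where "M = wave_const L c"
  define Z where "Z = limit_const L c"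
  define a where "a = enn2real (1 / p)"
  have M: "4 \<le> M"
    using wave_const_ge by (simp add: M_def)
  have Z: "0 < Z"
    using wave_const_ge L by (simp add: Z_def limit_const_def)
  have a: "0 \<le> a" "a \<le> 1"
    using reciprocal_exponent_le_1[OF p] by (auto simp: a_def)
  have Vm: "V \<delta> \<in> borel_measurable (lebesgue_on {-L..L})" "V_bar \<delta> \<in> borel_measurable (lebesgue_on {-L..L})"
    using V_cont continuous_on_V_bar[OF \<delta>(1)] by (auto intro: continuous_on_UNIV_measurable)
  have upper: "Lp_norm L p (\<lambda>x. V \<delta> x - V_bar \<delta> x) \<le> ennreal (M * \<delta> * \<delta> powr a)"
    unfolding a_def
  proof (rule Lp_norm_le)
    show "(\<lambda>x. V \<delta> x - V_bar \<delta> x) \<in> borel_measurable (lebesgue_on {-L..L})"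
      using Vm by (rule borel_measurable_diff)
    show "\<bar>V \<delta> x - V_bar \<delta> x\<bar> \<le> M * \<delta>" if "x \<in> {-L..L}" for x
      unfolding M_def using that by (intro V_error_sup) (auto simp: abs_le_iff)
    have "(\<integral>\<^sup>+x. ennreal \<bar>V \<delta> x - V_bar \<delta> x\<bar> \<partial>lebesgue_on {-L..L}) \<le> ennreal (integral {-L..L} (\<lambda>x. \<bar>V \<delta> x - V_bar \<delta> x\<bar>))"
      by (rule nn_integral_le_integral[OF V_error_cont]) simp
    also have "\<dots> \<le> ennreal (M * \<delta> * \<delta>)"
      using V_error_L1 by (intro ennreal_leI) (simp add: M_def power2_eq_square mult.assoc)
    finally show "(\<integral>\<^sup>+x. ennreal \<bar>V \<delta> x - V_bar \<delta> x\<bar> \<partial>lebesgue_on {-L..L}) \<le> ennreal (M * \<delta> * \<delta>)" .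
  qed (use M \<delta> p in auto)
  have "ennreal (1/8 * ((1/2 + \<delta>) - (1/2 + \<delta>/2)) powr a) \<le> Lp_norm L p (\<lambda>x. V \<delta> x - V0 L x)"
    unfolding a_def by (rule Lp_norm_ge) (use V_away_from_V0[OF small] \<delta> L p in auto)
  moreover have "1/16 * \<delta> powr a \<le> 1/8 * ((1/2 + \<delta>) - (1/2 + \<delta>/2)) powr a"
  proof -
    have "(1/2) powr 1 \<le> (1/2 :: real) powr a"
      using a by (intro powr_mono') auto
    then have "1/2 * \<delta> powr a \<le> (1/2) powr a * \<delta> powr a"
      by (intro mult_right_mono) auto
    also have "\<dots> = (\<delta> / 2) powr a"
      using \<delta> by (simp flip: powr_mult)
    finally show ?thesis
      by (simp add: field_simps)
  qed
  ultimately have lower: "ennreal (1/16 * \<delta> powr a) \<le> Lp_norm L p (\<lambda>x. V \<delta> x - V0 L x)"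
    by (meson ennreal_leI order_trans)
  have limit: "Lp_norm L p (\<lambda>x. V \<delta> x - V0 L x) \<le> ennreal (Z * \<delta> powr a)"
    unfolding a_def
  proof (rule Lp_norm_le)
    show "(\<lambda>x. V \<delta> x - V0 L x) \<in> borel_measurable (lebesgue_on {-L..L})"
      using Vm(1) V0_measurable by (rule borel_measurable_diff)
    show "\<bar>V \<delta> x - V0 L x\<bar> \<le> Z" if "x \<in> {-L..L}" for x
      unfolding Z_def using that by (intro V_near_V0_sup) (auto simp: abs_le_iff)
    show "(\<integral>\<^sup>+x. ennreal \<bar>V \<delta> x - V0 L x\<bar> \<partial>lebesgue_on {-L..L}) \<le> ennreal (Z * \<delta>)"
      unfolding Z_def by (rule V_near_V0_L1)
  qed (use Z \<delta> p in auto)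
  have "ennreal (M * \<delta> * \<delta> powr a) = ennreal (16 * M * \<delta>) * ennreal (1/16 * \<delta> powr a)"
    using M \<delta> by (simp flip: ennreal_mult)
  also have "\<dots> \<le> ennreal (16 * M * \<delta>) * Lp_norm L p (\<lambda>x. V \<delta> x - V0 L x)"
    by (intro mult_left_mono lower) auto
  finally show "Lp_norm L p (\<lambda>x. V \<delta> x - V_bar \<delta> x) \<le> ennreal (16 * wave_const L c * \<delta>) * Lp_norm L p (\<lambda>x. V \<delta> x - V0 L x)"
    using upper unfolding M_def by (rule order_trans[rotated])
  have "ennreal (16 * M * \<delta>) * Lp_norm L p (\<lambda>x. V \<delta> x - V0 L x) \<le> ennreal (16 * M * \<delta>) * ennreal (Z * \<delta> powr a)"
    by (intro mult_left_mono limit) auto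
  also have "\<dots> = ennreal (16 * M * Z * \<delta> powr (1 + a))"
    using M Z \<delta> by (simp add: powr_add mult_ac flip: ennreal_mult)
  finally show "ennreal (16 * wave_const L c * \<delta>) * Lp_norm L p (\<lambda>x. V \<delta> x - V0 L x)
      \<le> ennreal (16 * wave_const L c * limit_const L c * \<delta> powr (1 + enn2real (1 / p)))"
    unfolding M_def Z_def a_def .
qed

lemma norm_estimates_R:
  assumes wave: "concentrated_wave L \<delta> c (F \<delta>) (V \<delta>) (G \<delta>)" and small: "(wave_const L c + 3) * \<delta> \<le> 1/4"
    and p: "1 \<le> p"
  shows "Lp_norm L p (\<lambda>x. R \<delta> x - R_bar \<delta> x) \<le> ennreal (32 * L * wave_const L c * \<delta>) * Lp_norm L p (\<lambda>x. R \<delta> x - R0 L x)"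
    and "ennreal (32 * L * wave_const L c * \<delta>) * Lp_norm L p (\<lambda>x. R \<delta> x - R0 L x)
      \<le> ennreal (32 * L * wave_const L c * (2 * L * (wave_const L c + 6)) * \<delta>\<^sup>2)"
proof -
  interpret concentrated_wave L \<delta> c "F \<delta>" "V \<delta>" "G \<delta>"
    by (rule wave)
  define M where "M = wave_const L c"
  define a where "a = enn2real (1 / p)"
  have M: "4 \<le> M"
    using wave_const_ge by (simp add: M_def)
  have a: "0 \<le> a" "a \<le> 1"
    using reciprocal_exponent_le_1[OF p] by (auto simp: a_def)
  have Rm: "R \<delta> \<in> borel_measurable (lebesgue_on {-L..L})" "R_bar \<delta> \<in> borel_measurable (lebesgue_on {-L..L})"
    using R_cont[OF \<delta>(1)] continuous_on_R_bar[OF \<delta>(1)] by (auto intro: continuous_on_UNIV_measurable)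
  have bound: "Lp_norm L p f \<le> ennreal (2 * L * B)"
    if f: "f \<in> borel_measurable (lebesgue_on {-L..L})" and le: "\<And>x. \<bar>x\<bar> \<le> L \<Longrightarrow> \<bar>f x\<bar> \<le> B" and "0 < B" for f B
  proof -
    have "Lp_norm L p f \<le> ennreal (2 * L * B * 1 powr enn2real (1 / p))"
    proof (rule Lp_norm_le[OF f])
      show "\<bar>f x\<bar> \<le> 2 * L * B" if "x \<in> {-L..L}" for x
      proof -
        have "\<bar>f x\<bar> \<le> 1 * B"
          using le[of x] that by (auto simp: abs_le_iff)
        also have "\<dots> \<le> 2 * L * B"
          using L \<open>0 < B\<close> by (intro mult_right_mono) auto
        finally show ?thesis .
      qed
      have "(\<integral>\<^sup>+x. ennreal \<bar>f x\<bar> \<partial>lebesgue_on {-L..L}) \<le> ennreal (integral {-L..L} (\<lambda>_. B))"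
        by (rule nn_integral_le_integral) (auto intro: le)
      then show "(\<integral>\<^sup>+x. ennreal \<bar>f x\<bar> \<partial>lebesgue_on {-L..L}) \<le> ennreal (2 * L * B * 1)"
        using L by simp
    qed (use L \<open>0 < B\<close> p in auto)
    then show ?thesis
      by simp
  qed
  have upper: "Lp_norm L p (\<lambda>x. R \<delta> x - R_bar \<delta> x) \<le> ennreal (2 * L * (M * \<delta>\<^sup>2))"
    unfolding M_def
    by (rule bound[OF borel_measurable_diff[OF Rm] wave_R_error[OF wave]]) (use M \<delta> in \<open>auto simp: M_def\<close>)
  have limit: "Lp_norm L p (\<lambda>x. R \<delta> x - R0 L x) \<le> ennreal (2 * L * ((M + 6) * \<delta>))"
  proof (rule bound[OF borel_measurable_diff[OF Rm(1) R0_measurable[OF L]]])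
    fix x assume x: "\<bar>x\<bar> \<le> L"
    have "M * \<delta>\<^sup>2 \<le> M * \<delta>"
      using M d3_le by (intro mult_left_mono) auto
    then show "\<bar>R \<delta> x - R0 L x\<bar> \<le> (M + 6) * \<delta>"
      using wave_R_error[OF wave x] R_bar_near_tent[OF \<delta>, of x] R0_eq[OF L x]
      unfolding M_def[symmetric] distrib_right by linarith
  qed (use M \<delta> in auto)
  have "ennreal (\<delta> / 4 * (1/2 - 1/4) powr a) \<le> Lp_norm L p (\<lambda>x. R \<delta> x - R0 L x)"
    unfolding a_def
  proof (rule Lp_norm_ge)
    fix x :: real assume x: "x \<in> {1/4..1/2}"
    have "\<bar>R \<delta> x - R_bar \<delta> x\<bar> \<le> M * \<delta>\<^sup>2"
      unfolding M_def using x L by (intro wave_R_error[OF wave]) auto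
    moreover have "(M + 3) * \<delta> * \<delta> \<le> 1/4 * \<delta>"
      using small \<delta> by (intro mult_right_mono) (auto simp: M_def)
    then have "M * \<delta>\<^sup>2 + 3 * \<delta>\<^sup>2 \<le> \<delta> / 4"
      by (simp add: power2_eq_square algebra_simps)
    ultimately show "\<delta> / 4 \<le> \<bar>R \<delta> x - R0 L x\<bar>"
      using R_bar_away_from_R0[OF x] by linarith
  qed (use \<delta> L p in auto)
  moreover have "\<delta> / 16 \<le> \<delta> / 4 * (1/2 - 1/4) powr a"
  proof -
    have "(1/4) powr 1 \<le> (1/4 :: real) powr a"
      using a by (intro powr_mono') auto
    then show ?thesis
      using \<delta> by simp
  qed
  ultimately have lower: "ennreal (\<delta> / 16) \<le> Lp_norm L p (\<lambda>x. R \<delta> x - R0 L x)"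
    by (meson ennreal_leI order_trans)
  have "ennreal (2 * L * (M * \<delta>\<^sup>2)) = ennreal (32 * L * M * \<delta>) * ennreal (\<delta> / 16)"
    using M \<delta> L by (simp add: power2_eq_square mult_ac flip: ennreal_mult)
  also have "\<dots> \<le> ennreal (32 * L * M * \<delta>) * Lp_norm L p (\<lambda>x. R \<delta> x - R0 L x)"
    by (intro mult_left_mono lower) auto
  finally show "Lp_norm L p (\<lambda>x. R \<delta> x - R_bar \<delta> x) \<le> ennreal (32 * L * wave_const L c * \<delta>) * Lp_norm L p (\<lambda>x. R \<delta> x - R0 L x)"
    using upper unfolding M_def by (rule order_trans[rotated])
  have "ennreal (32 * L * M * \<delta>) * Lp_norm L p (\<lambda>x. R \<delta> x - R0 L x) \<le> ennreal (32 * L * M * \<delta>) * ennreal (2 * L * ((M + 6) * \<delta>))"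
    by (intro mult_left_mono limit) auto
  also have "\<dots> = ennreal (32 * L * M * (2 * L * (M + 6)) * \<delta>\<^sup>2)"
    using M L \<delta> by (simp add: power2_eq_square mult_ac flip: ennreal_mult)
  finally show "ennreal (32 * L * wave_const L c * \<delta>) * Lp_norm L p (\<lambda>x. R \<delta> x - R0 L x)
      \<le> ennreal (32 * L * wave_const L c * (2 * L * (wave_const L c + 6)) * \<delta>\<^sup>2)"
    unfolding M_def .
qed

lemma norm_estimates:
  "\<exists>C\<^sub>1>0. \<exists>C\<^sub>2>0. \<exists>C\<^sub>3>0. \<exists>C\<^sub>4>0. \<forall>\<^sub>F \<delta> in at_right 0. \<forall>p::ennreal. p \<ge> 1 \<longrightarrow>
         Lp_norm L p (\<lambda>x. V \<delta> x - V_bar \<delta> x)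
           \<le> ennreal (C\<^sub>1 * \<delta>) * Lp_norm L p (\<lambda>x. V \<delta> x - V0 L x)
       \<and> ennreal (C\<^sub>1 * \<delta>) * Lp_norm L p (\<lambda>x. V \<delta> x - V0 L x)
           \<le> ennreal (C\<^sub>2 * \<delta> powr (1 + enn2real (1 / p)))
       \<and> Lp_norm L p (\<lambda>x. R \<delta> x - R_bar \<delta> x)
           \<le> ennreal (C\<^sub>3 * \<delta>) * Lp_norm L p (\<lambda>x. R \<delta> x - R0 L x)
       \<and> ennreal (C\<^sub>3 * \<delta>) * Lp_norm L p (\<lambda>x. R \<delta> x - R0 L x)
           \<le> ennreal (C\<^sub>4 * \<delta>\<^sup>2)"
proof -
  obtain c where c: "c \<ge> 0" and ev: "\<forall>\<^sub>F \<delta> in at_right 0. concentrated_wave L \<delta> c (F \<delta>) (V \<delta>) (G \<delta>)"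
    by (rule eventually_concentrated)
  define M where "M = wave_const L c"
  have M: "0 < M"
    using L c by (simp add: M_def wave_const_def front_const_def amp_const_def add_pos_nonneg)
  have Z: "0 < limit_const L c"
    using M L by (simp add: limit_const_def M_def)
  have "\<forall>\<^sub>F \<delta>::real in at_right 0. \<delta> < 1 / (8 * (M + 3))"
    using M by (intro eventually_at_rightI[of 0 "1 / (8 * (M + 3))"]) auto
  with ev have "\<forall>\<^sub>F \<delta> in at_right 0. \<forall>p::ennreal. p \<ge> 1 \<longrightarrow>
         Lp_norm L p (\<lambda>x. V \<delta> x - V_bar \<delta> x)
           \<le> ennreal (16 * M * \<delta>) * Lp_norm L p (\<lambda>x. V \<delta> x - V0 L x)
       \<and> ennreal (16 * M * \<delta>) * Lp_norm L p (\<lambda>x. V \<delta> x - V0 L x)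
           \<le> ennreal (16 * M * limit_const L c * \<delta> powr (1 + enn2real (1 / p)))
       \<and> Lp_norm L p (\<lambda>x. R \<delta> x - R_bar \<delta> x)
           \<le> ennreal (32 * L * M * \<delta>) * Lp_norm L p (\<lambda>x. R \<delta> x - R0 L x)
       \<and> ennreal (32 * L * M * \<delta>) * Lp_norm L p (\<lambda>x. R \<delta> x - R0 L x)
           \<le> ennreal (32 * L * M * (2 * L * (M + 6)) * \<delta>\<^sup>2)"
  proof eventually_elim
    case (elim \<delta>)
    have \<delta>: "\<delta> > 0"
      using concentrated_wave.\<delta>(1)[OF elim(1)] .
    have "(M + 3) * \<delta> \<le> 1/8"
      using elim(2) M by (simp add: field_simps)
    moreover have "(M + 1) * \<delta> \<le> (M + 3) * \<delta>"
      using \<delta> by (intro mult_right_mono) auto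
    ultimately have small: "(M + 1) * \<delta> \<le> 1/8" "(M + 3) * \<delta> \<le> 1/4"
      by linarith+
    show ?case
      using norm_estimates_V[OF elim(1) small(1)[unfolded M_def]] norm_estimates_R[OF elim(1) small(2)[unfolded M_def]]
      unfolding M_def by blast
  qed
  moreover have "0 < 16 * M" "0 < 16 * M * limit_const L c" "0 < 32 * L * M" "0 < 32 * L * M * (2 * L * (M + 6))"
    using M Z L by auto
  ultimately show ?thesis
    by blast
qed

end

theorem mainTheorem1:
  fixes L \<mu> C\<^sub>\<Psi> :: real
    and \<Psi> \<Psi>' \<Phi> \<Phi>' :: "real \<Rightarrow> real"
    and V R :: "real \<Rightarrow> real \<Rightarrow> real"
    and lam :: "real \<Rightarrow> real"
  assumes "2 < L"
    and "\<And>r. r \<ge> 0 \<Longrightarrow> \<Psi> r \<ge> 0"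
    and "\<And>r. r \<ge> 0 \<Longrightarrow> (\<Psi> has_real_derivative \<Psi>' r) (at r within {0..})"
    and "continuous_on {0..} \<Psi>'"
    and "\<Psi> 0 = 0"
    and "C\<^sub>\<Psi> > 0"
    and "\<And>r. r > 0 \<Longrightarrow> \<Psi> r > 0"
    and "\<And>r. r > 0 \<Longrightarrow> \<Psi>' r + \<Psi> r \<ge> 0"
    and "\<And>r. r > 0 \<Longrightarrow> \<bar>\<Psi> r / r powr \<mu> - 1\<bar> \<le> C\<^sub>\<Psi> / r"
    and "\<And>r. r \<ge> 0 \<Longrightarrow> \<Phi>' r = \<Psi> r * exp r"
    and "\<And>r. r \<ge> 0 \<Longrightarrow> (\<Phi> has_real_derivative \<Phi>' r) (at r within {0..})"
    and "\<And>\<delta>. \<delta> > 0 \<Longrightarrow> is_maximizer L \<Phi> \<delta> (V \<delta>)"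
    and "\<And>\<delta>. \<delta> > 0 \<Longrightarrow> continuous_on UNIV (V \<delta>)"
    and "\<And>\<delta>. \<delta> > 0 \<Longrightarrow> R \<delta> = avg (V \<delta>)"
    and "\<And>\<delta>. \<delta> > 0 \<Longrightarrow> lam \<delta> > 0"
    and "\<And>\<delta> x. \<delta> > 0 \<Longrightarrow>
           (lam \<delta>)\<^sup>2 * V \<delta> x = 1 / \<delta> * avg (\<lambda>y. \<Phi>' (avg (V \<delta>) y / \<delta>)) x"
    and "\<And>\<delta>. \<delta> > 0 \<Longrightarrow> R \<delta> \<in> profile_cone L"
    and "\<And>\<delta> x. \<delta> > 0 \<Longrightarrow> V \<delta> x > 0"
    and "\<And>\<delta> x. \<delta> > 0 \<Longrightarrow> R \<delta> x > 0"
    and "((\<lambda>\<delta>. Lp_norm L 2 (\<lambda>x. V \<delta> x - V0 L x)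
             + Lp_norm L \<infinity> (\<lambda>x. R \<delta> x - R0 L x)) \<longlongrightarrow> 0) (at_right 0)"
  shows "((\<lambda>\<delta>. (lam \<delta>)\<^sup>2 * \<delta> powr \<mu> * exp (- 1 / \<delta>)) \<longlongrightarrow> exp 1) (at_right 0)
    \<and> (\<exists>C\<^sub>1>0. \<exists>C\<^sub>2>0. \<exists>C\<^sub>3>0. \<exists>C\<^sub>4>0. \<forall>\<^sub>F \<delta> in at_right 0. \<forall>p::ennreal. p \<ge> 1 \<longrightarrow>
         Lp_norm L p (\<lambda>x. V \<delta> x - V_bar \<delta> x)
           \<le> ennreal (C\<^sub>1 * \<delta>) * Lp_norm L p (\<lambda>x. V \<delta> x - V0 L x)
       \<and> ennreal (C\<^sub>1 * \<delta>) * Lp_norm L p (\<lambda>x. V \<delta> x - V0 L x)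
           \<le> ennreal (C\<^sub>2 * \<delta> powr (1 + enn2real (1 / p)))
       \<and> Lp_norm L p (\<lambda>x. R \<delta> x - R_bar \<delta> x)
           \<le> ennreal (C\<^sub>3 * \<delta>) * Lp_norm L p (\<lambda>x. R \<delta> x - R0 L x)
       \<and> ennreal (C\<^sub>3 * \<delta>) * Lp_norm L p (\<lambda>x. R \<delta> x - R0 L x)
           \<le> ennreal (C\<^sub>4 * \<delta>\<^sup>2))"
proof -
  have "((\<lambda>\<delta>. Lp_norm L \<infinity> (\<lambda>x. R \<delta> x - R0 L x)) \<longlongrightarrow> 0) (at_right 0)"
    by (rule tendsto_sandwich[OF _ _ tendsto_const assms(20)]) (auto intro!: always_eventually add_increasing)
  with assms interpret high_energy_waves L \<mu> C\<^sub>\<Psi> \<Psi> \<Psi>' \<Phi> \<Phi>' V R lam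
    by unfold_locales
  show ?thesis
    using speed_limit norm_estimates by blast
qed

end
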